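(* Let $\Omega\subset\mathbb{R}^n$ be a $\delta$-Gromov hyperbolic domain. Then there exists a constant $M=M(\delta,n)$, depending only on $\delta$ and $n$, such that for any pair of points $x,y\in\Omega$ we have $$\mathrm{diam}(\Gamma)\le M\,\delta_{\Omega}(x,y)$$ for any quasihyperbolic geodesic $\Gamma$ joining $x$ and $y$ in $\Omega$.
   Context: A domain is a nonempty connected open set. For a domain $\Omega\subsetneq\mathbb{R}^n$ write $d_{\Omega}(z)=\mathrm{dist}(z,\partial\Omega)$. The quasihyperbolic distance is $k_{\Omega}(x,y)=\inf_{\gamma}\int_{\gamma}\frac{|dz|}{d_{\Omega}(z)}$, the infimum being over rectifiable curves $\gamma\subset\Omega$ joining $x$ and $y$. A quasihyperbolic geodesic joining $x$ and $y$ is a curve attaining this infimum (such curves always exist). For $0\le\delta<\infty$, the domain $\Omega\subsetneq\mathbb{R}^n$ is $\delta$-Gromov hyperbolic if for any three points $x,y,z\in\Omega$, any quasihyperbolic geodesics $\Gamma_{xy},\Gamma_{yz},\Gamma_{zx}$ joining them pairwise, and any $w$ lying on one of these three geodesics, the ball $\{u\in\Omega: k_{\Omega}(u,w)\le\delta\}$ intersects the union of the other two geodesics. The intrinsic diameter metric $\delta_{\Omega}(x,y)$ is the infimum of the Euclidean diameters of paths in $\Omega$ joining $x$ and $y$; $\mathrm{diam}$ is the Euclidean diameter. *)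

theory Defs
  imports "HOL-Analysis.Analysis"
begin

text \<open>Curves are continuous maps on \<open>{0..1}\<close>, as in the library notion \<^const>\<open>path\<close>.\<close>

definition variation_sums :: "(real \<Rightarrow> 'a::metric_space) \<Rightarrow> real \<Rightarrow> real set" where
  "variation_sums g t =
     {(\<Sum>i<m. dist (g (p i)) (g (p (Suc i)))) |(m::nat) (p::nat \<Rightarrow> real).
        (\<forall>i\<le>m. p i \<in> {0..t}) \<and> (\<forall>i<m. p i \<le> p (Suc i))}"

definition rectifiable_path :: "(real \<Rightarrow> 'a::metric_space) \<Rightarrow> bool" where
  "rectifiable_path g \<longleftrightarrow> path g \<and> bdd_above (variation_sums g 1)"

text \<open>The length of the restriction of \<open>g\<close> to \<open>{0..t}\<close>.\<close>

definition arc_length :: "(real \<Rightarrow> 'a::metric_space) \<Rightarrow> real \<Rightarrow> real" where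
  "arc_length g t = Sup (variation_sums g t)"

text \<open>
  The arc length parametrization, on \<open>{0..arc_length g 1}\<close>. For rectifiable \<open>g\<close> the function
  \<open>arc_length g\<close> maps \<open>{0..1}\<close> continuously onto that interval, and \<open>g\<close> is constant on each of
  its level sets, so the value does not depend on the chosen \<open>t\<close>.
\<close>

definition arc_length_param :: "(real \<Rightarrow> 'a::metric_space) \<Rightarrow> real \<Rightarrow> 'a" where
  "arc_length_param g s = g (SOME t. t \<in> {0..1} \<and> arc_length g t = s)"

definition curve_integral :: "(real \<Rightarrow> 'a::metric_space) \<Rightarrow> ('a \<Rightarrow> real) \<Rightarrow> real" where
  "curve_integral g f = integral {0..arc_length g 1} (\<lambda>s. f (arc_length_param g s))"

definition proper_domain :: "'a::euclidean_space set \<Rightarrow> bool" where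
  "proper_domain \<Omega> \<longleftrightarrow> \<Omega> \<noteq> {} \<and> connected \<Omega> \<and> open \<Omega> \<and> \<Omega> \<noteq> UNIV"

definition bdist :: "'a::euclidean_space set \<Rightarrow> 'a \<Rightarrow> real" where
  "bdist \<Omega> z = infdist z (frontier \<Omega>)"

definition joins_in :: "'a::topological_space set \<Rightarrow> 'a \<Rightarrow> 'a \<Rightarrow> (real \<Rightarrow> 'a) \<Rightarrow> bool" where
  "joins_in \<Omega> x y g \<longleftrightarrow> path g \<and> path_image g \<subseteq> \<Omega> \<and> pathstart g = x \<and> pathfinish g = y"

definition qh_length :: "'a::euclidean_space set \<Rightarrow> (real \<Rightarrow> 'a) \<Rightarrow> real" where
  "qh_length \<Omega> g = curve_integral g (\<lambda>z. 1 / bdist \<Omega> z)"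

text \<open>
  The infima below are over nonempty sets bounded below by \<open>0\<close> whenever \<open>\<Omega>\<close> is a proper domain
  and \<open>x\<close>, \<open>y\<close> lie in \<open>\<Omega>\<close>; nothing is intended outside that case.
\<close>

definition qh_dist :: "'a::euclidean_space set \<Rightarrow> 'a \<Rightarrow> 'a \<Rightarrow> real" where
  "qh_dist \<Omega> x y = Inf {qh_length \<Omega> g |g. rectifiable_path g \<and> joins_in \<Omega> x y g}"

definition qh_geodesic :: "'a::euclidean_space set \<Rightarrow> 'a \<Rightarrow> 'a \<Rightarrow> (real \<Rightarrow> 'a) \<Rightarrow> bool" where
  "qh_geodesic \<Omega> x y g \<longleftrightarrow>
     rectifiable_path g \<and> joins_in \<Omega> x y g \<and> qh_length \<Omega> g = qh_dist \<Omega> x y"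

definition intrinsic_diam_dist :: "'a::euclidean_space set \<Rightarrow> 'a \<Rightarrow> 'a \<Rightarrow> real" where
  "intrinsic_diam_dist \<Omega> x y = Inf {diameter (path_image g) |g. joins_in \<Omega> x y g}"

definition qh_cball :: "'a::euclidean_space set \<Rightarrow> 'a \<Rightarrow> real \<Rightarrow> 'a set" where
  "qh_cball \<Omega> w r = {u \<in> \<Omega>. qh_dist \<Omega> u w \<le> r}"

definition gromov_hyperbolic_domain :: "real \<Rightarrow> 'a::euclidean_space set \<Rightarrow> bool" where
  "gromov_hyperbolic_domain \<delta> \<Omega> \<longleftrightarrow> proper_domain \<Omega> \<and>
     (\<forall>x\<in>\<Omega>. \<forall>y\<in>\<Omega>. \<forall>z\<in>\<Omega>. \<forall>\<Gamma>xy \<Gamma>yz \<Gamma>zx.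
        qh_geodesic \<Omega> x y \<Gamma>xy \<longrightarrow> qh_geodesic \<Omega> y z \<Gamma>yz \<longrightarrow> qh_geodesic \<Omega> z x \<Gamma>zx \<longrightarrow>
          (\<forall>w\<in>path_image \<Gamma>xy. qh_cball \<Omega> w \<delta> \<inter> (path_image \<Gamma>yz \<union> path_image \<Gamma>zx) \<noteq> {}) \<and>
          (\<forall>w\<in>path_image \<Gamma>yz. qh_cball \<Omega> w \<delta> \<inter> (path_image \<Gamma>zx \<union> path_image \<Gamma>xy) \<noteq> {}) \<and>
          (\<forall>w\<in>path_image \<Gamma>zx. qh_cball \<Omega> w \<delta> \<inter> (path_image \<Gamma>xy \<union> path_image \<Gamma>yz) \<noteq> {}))"

end

theory Submission
  imports Defs "HOL-Complex_Analysis.Great_Picard"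
begin

text \<open>
  Let \<open>\<Gamma>\<close> be a geodesic from \<open>x\<close> to \<open>y\<close>, let \<open>w\<close> be a point of \<open>\<Gamma>\<close> and let \<open>r\<close> exceed the diameter of
  some curve \<open>\<gamma>\<close> in \<open>\<Omega>\<close> from \<open>x\<close> to \<open>y\<close>. It suffices to bound \<open>T = ln ((dist w x + r) / (2 * r))\<close> by
  a constant. Two facts about the geodesics from \<open>w\<close> to points of \<open>\<gamma>\<close> pull in opposite directions.

  Seen from \<open>w\<close>, the curve \<open>\<gamma>\<close> is large. With \<open>(a|b)\<^sub>w\<close> denoting the Gromov product and
  \<open>\<epsilon>\<close> small, \<open>exp (- \<epsilon> (a|b)\<^sub>w)\<close> is a quasi-ultrametric because triangles are thin, and
  its value at the ends of \<open>\<gamma>\<close> is one because \<open>w\<close> lies between them. By Frink's chain inequality the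
  associated chain metric does not collapse, and its increments along \<open>\<gamma>\<close> are weights of
  total mass at least \<open>1/2\<close> for which the shadow of a point \<open>q\<close>, the set of points of \<open>\<gamma>\<close> whose
  geodesic to \<open>w\<close> passes near \<open>q\<close>, has weight at most a constant times \<open>exp (- \<epsilon> k(w,q))\<close>
  (\<open>chain_weights_exist\<close>, \<open>shadow_weights_exist\<close>). This is a discrete Frostman measure.

  On the other hand each of these geodesics has to come from \<open>w\<close> into the ball of radius \<open>r\<close> about
  \<open>x\<close>. At a point \<open>z\<close> a unit step changes \<open>ln (dist z x + r)\<close> at most by a multiple of the relative
  size \<open>G z = bdist z / (dist z x + r)\<close>, so the relative sizes along the geodesic add up
  to at least a multiple of \<open>T\<close> (\<open>log_ratio_le_sum_relative_size\<close>). But space is limited: comparing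
  volumes in dyadic shells, the sum of \<open>G ^ n\<close> over any separated set of points in the region is at
  most a multiple of \<open>T + 1\<close> (\<open>sum_relative_size_power_le\<close>). Averaging the lower bound over the
  weights and interpolating between the \<open>n\<close>-th powers and the exponential decay of the shadow
  weights gives \<open>T \<le> C + T / 2\<close> with \<open>C\<close> depending only on \<open>\<delta>\<close> and \<open>n\<close>
  (\<open>log_distance_bounded\<close>).

  The hyperbolicity assumption only speaks about geodesics, so their existence is part of the proof.
  It rests on the fact that quasihyperbolic length is the length of a curve in the metric
  \<open>ln (1 + dist u v / min (bdist u) (bdist v))\<close> (\<open>qh_length_eq_ratio_length\<close>): lengths with respect
  to a metric are lower semicontinuous, so a minimizing sequence has a minimizing limit
  (\<open>qh_geodesic_exists\<close>). The same fact yields the additivity of quasihyperbolic length and the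
  lower bounds for the quasihyperbolic distance.
\<close>

section \<open>Length of curves with respect to a metric\<close>

definition partition_sums ::
    "('a \<Rightarrow> 'a \<Rightarrow> real) \<Rightarrow> (real \<Rightarrow> 'a) \<Rightarrow> real \<Rightarrow> real \<Rightarrow> real set" where
  "partition_sums \<rho> g a b =
     {(\<Sum>i<m. \<rho> (g (p i)) (g (p (Suc i)))) |(m::nat) (p::nat \<Rightarrow> real).
        (\<forall>i\<le>m. p i \<in> {a..b}) \<and> (\<forall>i<m. p i \<le> p (Suc i))}"

definition length_on :: "('a \<Rightarrow> 'a \<Rightarrow> real) \<Rightarrow> (real \<Rightarrow> 'a) \<Rightarrow> real \<Rightarrow> real \<Rightarrow> real" where
  "length_on \<rho> g a b = Sup (partition_sums \<rho> g a b)"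

lemma sum_lessThan_add:
  fixes f :: "nat \<Rightarrow> real"
  shows "sum f {..<m + k} = sum f {..<m} + (\<Sum>i<k. f (m + i))"
  by (induction k) (simp_all add: algebra_simps)

lemma variation_sums_eq: "variation_sums g t = partition_sums dist g 0 t"
  unfolding variation_sums_def partition_sums_def ..

lemma arc_length_eq: "arc_length g t = length_on dist g 0 t"
  unfolding arc_length_def length_on_def variation_sums_eq ..

lemma partition_sumsI:
  assumes "\<And>i. i \<le> m \<Longrightarrow> p i \<in> {a..b}" "\<And>i. i < m \<Longrightarrow> p i \<le> p (Suc i)"
  shows "(\<Sum>i<m. \<rho> (g (p i)) (g (p (Suc i)))) \<in> partition_sums \<rho> g a b"
  using assms unfolding partition_sums_def by blast

lemma partition_sumsE:
  assumes "x \<in> partition_sums \<rho> g a b"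
  obtains m p where "x = (\<Sum>i<m. \<rho> (g (p i)) (g (p (Suc i))))"
    "\<And>i. i \<le> m \<Longrightarrow> p i \<in> {a..b}" "\<And>i. i < m \<Longrightarrow> p i \<le> p (Suc i)"
  using assms unfolding partition_sums_def by blast

lemma partition_sums_mono:
  assumes "a \<le> s" "t \<le> b"
  shows "partition_sums \<rho> g s t \<subseteq> partition_sums \<rho> g a b"
proof
  fix x assume "x \<in> partition_sums \<rho> g s t"
  then obtain m p where x: "x = (\<Sum>i<m. \<rho> (g (p i)) (g (p (Suc i))))"
    and p: "\<And>i. i \<le> m \<Longrightarrow> p i \<in> {s..t}" "\<And>i. i < m \<Longrightarrow> p i \<le> p (Suc i)"
    by (rule partition_sumsE) blast
  show "x \<in> partition_sums \<rho> g a b"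
    unfolding x using p assms by (intro partition_sumsI) force+
qed

lemma zero_in_partition_sums: "a \<le> b \<Longrightarrow> 0 \<in> partition_sums \<rho> g a b"
  using partition_sumsI[of 0 "\<lambda>_. a" a b \<rho> g] by simp

lemma pair_in_partition_sums:
  assumes "a \<le> s" "s \<le> t" "t \<le> b"
  shows "\<rho> (g s) (g t) \<in> partition_sums \<rho> g a b"
  using partition_sumsI[of 1 "\<lambda>i. if i = 0 then s else t" a b \<rho> g] assms by simp

lemma partition_sum_le_increment:
  fixes F :: "real \<Rightarrow> real"
  assumes "x \<in> partition_sums \<rho> g a b"
    and mono: "\<And>s t. a \<le> s \<Longrightarrow> s \<le> t \<Longrightarrow> t \<le> b \<Longrightarrow> F s \<le> F t"
    and le: "\<And>s t. a \<le> s \<Longrightarrow> s \<le> t \<Longrightarrow> t \<le> b \<Longrightarrow> \<rho> (g s) (g t) \<le> F t - F s"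
  shows "x \<le> F b - F a"
proof -
  obtain m p where x: "x = (\<Sum>i<m. \<rho> (g (p i)) (g (p (Suc i))))"
    and p: "\<And>i. i \<le> m \<Longrightarrow> p i \<in> {a..b}" "\<And>i. i < m \<Longrightarrow> p i \<le> p (Suc i)"
    using assms(1) by (rule partition_sumsE) blast
  have "x \<le> (\<Sum>i<m. F (p (Suc i)) - F (p i))"
    unfolding x
  proof (rule sum_mono)
    fix i assume "i \<in> {..<m}"
    then show "\<rho> (g (p i)) (g (p (Suc i))) \<le> F (p (Suc i)) - F (p i)"
      using p(1)[of i] p(1)[of "Suc i"] p(2)[of i] by (intro le) auto
  qed
  also have "\<dots> = F (p m) - F (p 0)" by (rule sum_lessThan_telescope)
  also have "\<dots> \<le> F b - F a"
    using p(1)[of 0] p(1)[of m] by (intro diff_mono mono) auto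
  finally show ?thesis .
qed

lemma partition_sum_le_Lipschitz:
  assumes "x \<in> partition_sums \<rho> g a b" "0 \<le> C"
    and lip: "\<And>s t. a \<le> s \<Longrightarrow> s \<le> t \<Longrightarrow> t \<le> b \<Longrightarrow> \<rho> (g s) (g t) \<le> C * (t - s)"
  shows "x \<le> C * (b - a)"
  using partition_sum_le_increment[OF assms(1), of "\<lambda>t. C * t"] assms(2) lip
  by (simp add: right_diff_distrib mult_left_mono)

lemma partition_sum_le_compare:
  assumes "x \<in> partition_sums \<rho> g a b"
    and le: "\<And>s t. a \<le> s \<Longrightarrow> s \<le> t \<Longrightarrow> t \<le> b \<Longrightarrow> \<rho> (g s) (g t) \<le> C * \<sigma> (g s) (g t)"
  shows "\<exists>y \<in> partition_sums \<sigma> g a b. x \<le> C * y"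
proof -
  obtain m p where x: "x = (\<Sum>i<m. \<rho> (g (p i)) (g (p (Suc i))))"
    and p: "\<And>i. i \<le> m \<Longrightarrow> p i \<in> {a..b}" "\<And>i. i < m \<Longrightarrow> p i \<le> p (Suc i)"
    using assms(1) by (rule partition_sumsE) blast
  have "x \<le> (\<Sum>i<m. C * \<sigma> (g (p i)) (g (p (Suc i))))"
    unfolding x
  proof (rule sum_mono)
    fix i assume "i \<in> {..<m}"
    then show "\<rho> (g (p i)) (g (p (Suc i))) \<le> C * \<sigma> (g (p i)) (g (p (Suc i)))"
      using p(1)[of i] p(1)[of "Suc i"] p(2)[of i] by (intro le) auto
  qed
  also have "\<dots> = C * (\<Sum>i<m. \<sigma> (g (p i)) (g (p (Suc i))))"
    by (simp add: sum_distrib_left)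
  finally show ?thesis
    using partition_sumsI[of m p a b \<sigma> g] p by blast
qed

lemma
  assumes "a \<le> b" "0 \<le> C" "bdd_above (partition_sums \<sigma> g a b)"
    and le: "\<And>s t. a \<le> s \<Longrightarrow> s \<le> t \<Longrightarrow> t \<le> b \<Longrightarrow> \<rho> (g s) (g t) \<le> C * \<sigma> (g s) (g t)"
  shows bdd_partition_sums_compare: "bdd_above (partition_sums \<rho> g a b)"
    and length_on_compare: "length_on \<rho> g a b \<le> C * length_on \<sigma> g a b"
proof -
  have *: "x \<le> C * length_on \<sigma> g a b" if x: "x \<in> partition_sums \<rho> g a b" for x
  proof -
    obtain y where "y \<in> partition_sums \<sigma> g a b" "x \<le> C * y"
      using partition_sum_le_compare[OF x, of C \<sigma>] le by blast
    then show ?thesis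
      using cSup_upper[OF _ assms(3)] assms(2) unfolding length_on_def
      by (meson mult_left_mono order_trans)
  qed
  then show "bdd_above (partition_sums \<rho> g a b)" by (rule bdd_aboveI)
  show "length_on \<rho> g a b \<le> C * length_on \<sigma> g a b"
    unfolding length_on_def[of \<rho>]
    using * zero_in_partition_sums[OF assms(1), of \<rho> g] by (intro cSup_least) auto
qed

lemma partition_sums_cong:
  assumes "\<And>t. t \<in> {a..b} \<Longrightarrow> g t = h t"
  shows "partition_sums \<rho> g a b = partition_sums \<rho> h a b"
proof -
  have "partition_sums \<rho> g a b \<subseteq> partition_sums \<rho> h a b"
    if e: "\<And>t. t \<in> {a..b} \<Longrightarrow> g t = h t" for g h
  proof
    fix x assume "x \<in> partition_sums \<rho> g a b"
    then obtain m p where x: "x = (\<Sum>i<m. \<rho> (g (p i)) (g (p (Suc i))))"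
      and p: "\<And>i. i \<le> m \<Longrightarrow> p i \<in> {a..b}" "\<And>i. i < m \<Longrightarrow> p i \<le> p (Suc i)"
      by (rule partition_sumsE) blast
    have "x = (\<Sum>i<m. \<rho> (h (p i)) (h (p (Suc i))))"
      unfolding x using e p(1) by (intro sum.cong) auto
    then show "x \<in> partition_sums \<rho> h a b"
      using p partition_sumsI[of m p a b \<rho> h] by simp
  qed
  then show ?thesis using assms by (metis subset_antisym)
qed

lemma partition_sums_affine_subset:
  assumes "0 \<le> c"
  shows "partition_sums \<rho> (\<lambda>t. g (c * t + e)) a b \<subseteq> partition_sums \<rho> g (c * a + e) (c * b + e)"
proof
  fix x assume "x \<in> partition_sums \<rho> (\<lambda>t. g (c * t + e)) a b"
  then obtain m p where x: "x = (\<Sum>i<m. \<rho> (g (c * p i + e)) (g (c * p (Suc i) + e)))"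
    and p: "\<And>i. i \<le> m \<Longrightarrow> p i \<in> {a..b}" "\<And>i. i < m \<Longrightarrow> p i \<le> p (Suc i)"
    by (rule partition_sumsE) blast
  show "x \<in> partition_sums \<rho> g (c * a + e) (c * b + e)"
    unfolding x using p assms
    by (intro partition_sumsI[of m "\<lambda>i. c * p i + e"]) (auto intro: mult_left_mono)
qed

lemma partition_sums_affine:
  assumes "0 < c"
  shows "partition_sums \<rho> (\<lambda>t. g (c * t + e)) a b = partition_sums \<rho> g (c * a + e) (c * b + e)"
proof
  show "partition_sums \<rho> (\<lambda>t. g (c * t + e)) a b \<subseteq> partition_sums \<rho> g (c * a + e) (c * b + e)"
    using assms by (intro partition_sums_affine_subset) simp
  have "partition_sums \<rho> (\<lambda>t. g (c * ((1/c) * t + (- e/c)) + e)) (c * a + e) (c * b + e)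
      \<subseteq> partition_sums \<rho> (\<lambda>t. g (c * t + e)) ((1/c) * (c * a + e) + (- e/c)) ((1/c) * (c * b + e) + (- e/c))"
    using assms by (intro partition_sums_affine_subset[of "1/c" \<rho> "\<lambda>t. g (c * t + e)" "- e/c"]) simp
  moreover have "c * ((1/c) * t + (- e/c)) + e = t" "(1/c) * (c * t + e) + (- e/c) = t" for t
    using assms by (auto simp: field_simps)
  ultimately show "partition_sums \<rho> g (c * a + e) (c * b + e) \<subseteq> partition_sums \<rho> (\<lambda>t. g (c * t + e)) a b"
    by simp
qed

lemma partition_sums_reverse_subset:
  assumes "\<And>u v. \<rho> u v = \<rho> v u"
  shows "partition_sums \<rho> (\<lambda>t. g (1 - t)) 0 1 \<subseteq> partition_sums \<rho> g 0 1"
proof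
  fix x assume "x \<in> partition_sums \<rho> (\<lambda>t. g (1 - t)) 0 1"
  then obtain m p where x: "x = (\<Sum>i<m. \<rho> (g (1 - p i)) (g (1 - p (Suc i))))"
    and p: "\<And>i. i \<le> m \<Longrightarrow> p i \<in> {0..1}" "\<And>i. i < m \<Longrightarrow> p i \<le> p (Suc i)"
    by (rule partition_sumsE) blast
  define q where "q i = 1 - p (m - i)" for i
  have "x = (\<Sum>i<m. \<rho> (g (q i)) (g (q (Suc i))))"
    unfolding x
  proof (rule sum.reindex_bij_witness[of _ "\<lambda>i. m - Suc i" "\<lambda>i. m - Suc i"])
    fix i assume "i \<in> {..<m}"
    then have "m - (m - Suc i) = Suc i" "m - Suc (m - Suc i) = i" by auto
    then show "\<rho> (g (q (m - Suc i))) (g (q (Suc (m - Suc i)))) = \<rho> (g (1 - p i)) (g (1 - p (Suc i)))"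
      unfolding q_def using assms by metis
  qed auto
  moreover have "q i \<in> {0..1}" if "i \<le> m" for i using p(1)[of "m - i"] unfolding q_def by auto
  moreover have "q i \<le> q (Suc i)" if "i < m" for i
    using p(2)[of "m - Suc i"] that unfolding q_def by (simp add: Suc_diff_Suc)
  ultimately show "x \<in> partition_sums \<rho> g 0 1" using partition_sumsI[of m q 0 1 \<rho> g] by blast
qed

lemma partition_sums_reversepath:
  assumes "\<And>u v. \<rho> u v = \<rho> v u"
  shows "partition_sums \<rho> (reversepath g) 0 1 = partition_sums \<rho> g 0 1"
proof
  show "partition_sums \<rho> (reversepath g) 0 1 \<subseteq> partition_sums \<rho> g 0 1"
    using partition_sums_reverse_subset[of \<rho> g] assms by (simp add: reversepath_def)
  show "partition_sums \<rho> g 0 1 \<subseteq> partition_sums \<rho> (reversepath g) 0 1"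
    using partition_sums_reverse_subset[of \<rho> "reversepath g"] assms by (simp add: reversepath_def)
qed

context Metric_space
begin

text \<open>
  Clipping a partition at \<open>b\<close> from above and from below splits its sum termwise, so that \<open>b\<close> need
  not be inserted into the partition; only the step that crosses \<open>b\<close> uses the triangle inequality.
\<close>

lemma partition_sum_split:
  assumes "x \<in> partition_sums d g a c" "a \<le> b" "b \<le> c" "g ` {a..c} \<subseteq> M"
  shows "\<exists>y \<in> partition_sums d g a b. \<exists>z \<in> partition_sums d g b c. x \<le> y + z"
proof -
  obtain m p where x: "x = (\<Sum>i<m. d (g (p i)) (g (p (Suc i))))"
    and p: "\<And>i. i \<le> m \<Longrightarrow> p i \<in> {a..c}" "\<And>i. i < m \<Longrightarrow> p i \<le> p (Suc i)"
    using assms(1) by (rule partition_sumsE) blast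
  define q where "q i = min (p i) b" for i
  define r where "r i = max (p i) b" for i
  have "x \<le> (\<Sum>i<m. d (g (q i)) (g (q (Suc i))) + d (g (r i)) (g (r (Suc i))))"
    unfolding x
  proof (rule sum_mono)
    fix i assume "i \<in> {..<m}"
    then have "p i \<in> {a..c}" "p (Suc i) \<in> {a..c}" "p i \<le> p (Suc i)" using p by auto
    then have *: "g (p i) \<in> M" "g (p (Suc i)) \<in> M" "g b \<in> M" using assms by auto
    show "d (g (p i)) (g (p (Suc i)))
        \<le> d (g (q i)) (g (q (Suc i))) + d (g (r i)) (g (r (Suc i)))"
      using triangle[OF *(1,3,2)] * \<open>p i \<le> p (Suc i)\<close>
      by (auto simp: q_def r_def min_def max_def)
  qed
  moreover have "(\<Sum>i<m. d (g (q i)) (g (q (Suc i)))) \<in> partition_sums d g a b"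
    using p assms(2,3) by (intro partition_sumsI) (force simp: q_def)+
  moreover have "(\<Sum>i<m. d (g (r i)) (g (r (Suc i)))) \<in> partition_sums d g b c"
    using p assms(2,3) by (intro partition_sumsI) (force simp: r_def)+
  ultimately show ?thesis by (auto simp: sum.distrib)
qed

lemma partition_sum_concat:
  assumes "y \<in> partition_sums d g a b" "z \<in> partition_sums d g b c"
  shows "\<exists>x \<in> partition_sums d g a c. y + z \<le> x"
proof -
  obtain m p where y: "y = (\<Sum>i<m. d (g (p i)) (g (p (Suc i))))"
    and p: "\<And>i. i \<le> m \<Longrightarrow> p i \<in> {a..b}" "\<And>i. i < m \<Longrightarrow> p i \<le> p (Suc i)"
    using assms(1) by (rule partition_sumsE) blast
  obtain l q where z: "z = (\<Sum>i<l. d (g (q i)) (g (q (Suc i))))"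
    and q: "\<And>i. i \<le> l \<Longrightarrow> q i \<in> {b..c}" "\<And>i. i < l \<Longrightarrow> q i \<le> q (Suc i)"
    using assms(2) by (rule partition_sumsE) blast
  define r where "r i = (if i \<le> m then p i else q (i - Suc m))" for i
  let ?f = "\<lambda>i. d (g (r i)) (g (r (Suc i)))"
  have "sum ?f {..<m + Suc l} = sum ?f {..<m} + (?f m + (\<Sum>i<l. ?f (m + Suc i)))"
    unfolding sum_lessThan_add by (subst sum.lessThan_Suc_shift) simp
  moreover have "sum ?f {..<m} = y" unfolding y by (intro sum.cong) (auto simp: r_def)
  moreover have "(\<Sum>i<l. ?f (m + Suc i)) = z" unfolding z by (intro sum.cong) (auto simp: r_def)
  ultimately have "y + z \<le> sum ?f {..<m + Suc l}" by simp
  moreover have "sum ?f {..<m + Suc l} \<in> partition_sums d g a c"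
  proof (rule partition_sumsI)
    have "a \<le> b" "b \<le> c" using p(1)[of 0] q(1)[of 0] by auto
    then show "r i \<in> {a..c}" if "i \<le> m + Suc l" for i
    proof -
      have "i - Suc m \<le> l" using that by simp
      then show ?thesis
        using p(1)[of i] q(1)[of "i - Suc m"] \<open>a \<le> b\<close> \<open>b \<le> c\<close> by (cases "i \<le> m") (auto simp: r_def)
    qed
    show "r i \<le> r (Suc i)" if "i < m + Suc l" for i
    proof (cases "m < i")
      case True
      then have "Suc (i - Suc m) = Suc i - Suc m" "i - Suc m < l" using that by auto
      then show ?thesis using q(2)[of "i - Suc m"] True by (simp add: r_def)
    next
      case False
      then show ?thesis using p(1)[of i] p(2)[of i] q(1)[of 0] by (auto simp: r_def)
    qed
  qed
  ultimately show ?thesis by blast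
qed

lemma length_on_nonneg:
  "a \<le> b \<Longrightarrow> bdd_above (partition_sums d g a b) \<Longrightarrow> 0 \<le> length_on d g a b"
  unfolding length_on_def by (intro cSup_upper zero_in_partition_sums)

lemma dist_le_length_on:
  "bdd_above (partition_sums d g a b) \<Longrightarrow> a \<le> b \<Longrightarrow> d (g a) (g b) \<le> length_on d g a b"
  unfolding length_on_def by (intro cSup_upper pair_in_partition_sums) auto

lemma
  assumes "a \<le> b" "b \<le> c" "g ` {a..c} \<subseteq> M"
    and bdd: "bdd_above (partition_sums d g a b)" "bdd_above (partition_sums d g b c)"
  shows bdd_partition_sums_concat: "bdd_above (partition_sums d g a c)"
    and length_on_add: "length_on d g a c = length_on d g a b + length_on d g b c"
proof -
  let ?S = "length_on d g a b + length_on d g b c"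
  have le: "x \<le> ?S" if x: "x \<in> partition_sums d g a c" for x
  proof -
    obtain y z where "y \<in> partition_sums d g a b" "z \<in> partition_sums d g b c" "x \<le> y + z"
      using partition_sum_split[OF x assms(1-3)] by blast
    then show ?thesis
      using cSup_upper[OF _ bdd(1)] cSup_upper[OF _ bdd(2)] unfolding length_on_def by fastforce
  qed
  then show bdd3: "bdd_above (partition_sums d g a c)" by (rule bdd_aboveI)
  have "length_on d g a c \<le> ?S"
    unfolding length_on_def[of d g a c]
    using le zero_in_partition_sums[of a c d g] assms(1,2) by (intro cSup_least) auto
  moreover have "?S \<le> length_on d g a c"
  proof -
    have "y + z \<le> length_on d g a c"
      if yz: "y \<in> partition_sums d g a b" "z \<in> partition_sums d g b c" for y z
    proof -
      obtain x where "x \<in> partition_sums d g a c" "y + z \<le> x"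
        using partition_sum_concat[OF yz] by blast
      then show ?thesis using cSup_upper[OF _ bdd3] unfolding length_on_def by fastforce
    qed
    then have "z \<le> length_on d g a c - y"
      if "y \<in> partition_sums d g a b" "z \<in> partition_sums d g b c" for y z
      using that by (simp add: algebra_simps)
    then have "length_on d g b c \<le> length_on d g a c - y" if "y \<in> partition_sums d g a b" for y
      unfolding length_on_def[of d g b c]
      using that zero_in_partition_sums[of b c d g] assms(2) by (intro cSup_least) auto
    then have "y \<le> length_on d g a c - length_on d g b c" if "y \<in> partition_sums d g a b" for y
      using that by (simp add: algebra_simps)
    then have "length_on d g a b \<le> length_on d g a c - length_on d g b c"
      unfolding length_on_def[of d g a b]
      using zero_in_partition_sums[of a b d g] assms(1) by (intro cSup_least) auto
    then show ?thesis by simp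
  qed
  ultimately show "length_on d g a c = ?S" by simp
qed

lemma bdd_partition_sums_sub:
  assumes "bdd_above (partition_sums d g a b)" "a \<le> s" "t \<le> b"
  shows "bdd_above (partition_sums d g s t)"
  using assms partition_sums_mono bdd_above_mono by metis

text \<open>
  A partition of \<open>{a..b}\<close> whose sum is within \<open>e\<close> of the full length controls the length of every
  short subinterval \<open>{s..t}\<close>: clipping the partition to the three pieces shows that
  \<open>{s..t}\<close> carries at most \<open>e\<close> more than the clipped sum, which has a fixed number of small terms.
\<close>

lemma length_on_uniformly_small:
  assumes "a \<le> b" "g ` {a..b} \<subseteq> M" and bdd: "bdd_above (partition_sums d g a b)"
    and cont: "\<forall>e>0. \<exists>\<eta>>0. \<forall>u\<in>{a..b}. \<forall>v\<in>{a..b}. \<bar>u - v\<bar> < \<eta> \<longrightarrow> d (g u) (g v) < e"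
    and "0 < e"
  shows "\<exists>\<eta>>0. \<forall>s\<in>{a..b}. \<forall>t\<in>{a..b}. s \<le> t \<longrightarrow> t - s < \<eta> \<longrightarrow> length_on d g s t < e"
proof -
  have "length_on d g a b - e/2 < Sup (partition_sums d g a b)"
    using \<open>0 < e\<close> by (simp add: length_on_def)
  then obtain x where "x \<in> partition_sums d g a b" and xgt: "length_on d g a b - e/2 < x"
    using less_cSup_iff[OF _ bdd] zero_in_partition_sums[OF assms(1)] by blast
  then obtain m p where x: "x = (\<Sum>i<m. d (g (p i)) (g (p (Suc i))))"
    and p: "\<And>i. i \<le> m \<Longrightarrow> p i \<in> {a..b}" "\<And>i. i < m \<Longrightarrow> p i \<le> p (Suc i)"
    by (elim partition_sumsE) blast
  obtain \<eta> where "\<eta> > 0" and \<eta>: "\<And>u v. u \<in> {a..b} \<Longrightarrow> v \<in> {a..b} \<Longrightarrow> \<bar>u - v\<bar> < \<eta>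
      \<Longrightarrow> d (g u) (g v) < e / (2 * Suc m)"
    using cont[rule_format, of "e / (2 * Suc m)"] \<open>0 < e\<close> by auto
  have "length_on d g s t < e" if st: "s \<in> {a..b}" "t \<in> {a..b}" "s \<le> t" "t - s < \<eta>" for s t
  proof -
    define l where "l i = min (p i) s" for i
    define c where "c i = max s (min (p i) t)" for i
    define r where "r i = max (p i) t" for i
    let ?sum = "\<lambda>q. \<Sum>i<m. d (g (q i)) (g (q (Suc i)))"
    have "x \<le> (\<Sum>i<m. d (g (l i)) (g (l (Suc i))) + d (g (c i)) (g (c (Suc i)))
        + d (g (r i)) (g (r (Suc i))))"
      unfolding x
    proof (rule sum_mono)
      fix i assume "i \<in> {..<m}"
      then have pi: "p i \<in> {a..b}" "p (Suc i) \<in> {a..b}" "p i \<le> p (Suc i)" using p by auto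
      then have *: "g (p i) \<in> M" "g (p (Suc i)) \<in> M" "g s \<in> M" "g t \<in> M"
        using assms(2) st by auto
      show "d (g (p i)) (g (p (Suc i))) \<le> d (g (l i)) (g (l (Suc i)))
          + d (g (c i)) (g (c (Suc i))) + d (g (r i)) (g (r (Suc i)))"
        using triangle[OF *(1,3,2)] triangle[OF *(1,4,2)] triangle[OF *(1,3,4)]
          triangle[OF *(3,4,2)] * pi(3) st(3)
        by (auto simp: l_def r_def c_def min_def max_def)
    qed
    then have "x \<le> ?sum l + ?sum c + ?sum r" by (simp add: sum.distrib)
    moreover have "?sum l \<in> partition_sums d g a s"
      using p st by (intro partition_sumsI) (force simp: l_def)+
    then have "?sum l \<le> length_on d g a s"
      unfolding length_on_def using bdd_partition_sums_sub[OF bdd] st by (intro cSup_upper) auto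
    moreover have "?sum r \<in> partition_sums d g t b"
      using p st by (intro partition_sumsI) (force simp: r_def)+
    then have "?sum r \<le> length_on d g t b"
      unfolding length_on_def using bdd_partition_sums_sub[OF bdd] st by (intro cSup_upper) auto
    moreover have "?sum c \<le> (\<Sum>i<m. e / (2 * Suc m))"
    proof (rule sum_mono)
      fix i
      have "c i \<in> {s..t}" "c (Suc i) \<in> {s..t}" using st(3) by (auto simp: c_def)
      then have "c i \<in> {a..b}" "c (Suc i) \<in> {a..b}" "\<bar>c i - c (Suc i)\<bar> < \<eta>" using st by auto
      then show "d (g (c i)) (g (c (Suc i))) \<le> e / (2 * Suc m)" using \<eta> by fastforce
    qed
    moreover have "(\<Sum>i<m. e / (2 * Suc m)) < e / 2"
      using \<open>0 < e\<close> by (simp add: field_simps)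
    moreover have "length_on d g a b = length_on d g a s + length_on d g s t + length_on d g t b"
      using length_on_add[of a s b g] length_on_add[of s t b g] st assms(2)
        bdd_partition_sums_sub[OF bdd] by (auto simp: image_subset_iff)
    ultimately show ?thesis using xgt by linarith
  qed
  then show ?thesis using \<open>\<eta> > 0\<close> by blast
qed

text \<open>
  Parametrization by arc length. The length function \<open>\<l>\<close> is continuous and hence onto \<open>{0..\<l> 1}\<close>,
  and \<open>d (g s) (g t)\<close> is at most the increment of \<open>\<l>\<close>, so \<open>g\<close> is constant on its level sets and it
  does not matter which point of a level set is chosen.
\<close>

lemma
  assumes "g ` {0..1} \<subseteq> M" and bdd: "bdd_above (partition_sums d g 0 1)"
    and cont: "\<forall>e>0. \<exists>\<eta>>0. \<forall>u\<in>{0..1}. \<forall>v\<in>{0..1}. \<bar>u - v\<bar> < \<eta> \<longrightarrow> d (g u) (g v) < e"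
  defines "\<l> \<equiv> length_on d g 0"
  defines "h \<equiv> \<lambda>s. g (SOME t. t \<in> {0..1} \<and> \<l> t = s)"
  shows continuous_on_length: "continuous_on {0..1} \<l>"
    and length_on_diff: "\<And>s t. 0 \<le> s \<Longrightarrow> s \<le> t \<Longrightarrow> t \<le> 1 \<Longrightarrow> length_on d g s t = \<l> t - \<l> s"
    and arc_param_length: "\<And>t. t \<in> {0..1} \<Longrightarrow> h (\<l> t) = g t"
    and arc_param_lipschitz:
      "\<And>s s'. s \<in> {0..\<l> 1} \<Longrightarrow> s' \<in> {0..\<l> 1} \<Longrightarrow> d (h s) (h s') \<le> \<bar>s - s'\<bar>"
    and arc_param_image: "\<And>s. s \<in> {0..\<l> 1} \<Longrightarrow> h s \<in> g ` {0..1}"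
proof -
  show diff: "length_on d g s t = \<l> t - \<l> s" if "0 \<le> s" "s \<le> t" "t \<le> 1" for s t
    using length_on_add[of 0 s t g] that assms(1) bdd_partition_sums_sub[OF bdd]
    unfolding \<l>_def by (auto simp: image_subset_iff)
  have le: "d (g s) (g t) \<le> \<bar>\<l> t - \<l> s\<bar>" if "s \<in> {0..1}" "t \<in> {0..1}" for s t
  proof -
    have *: "d (g s) (g t) \<le> \<l> t - \<l> s" if "0 \<le> s" "s \<le> t" "t \<le> 1" for s t
      using dist_le_length_on[of g s t] bdd_partition_sums_sub[OF bdd] diff that by fastforce
    show ?thesis
      using *[of s t] *[of t s] that commute[of "g s" "g t"] by (cases "s \<le> t") auto
  qed
  have mono: "\<l> s \<le> \<l> t" if "0 \<le> s" "s \<le> t" "t \<le> 1" for s t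
    using diff[OF that] length_on_nonneg[of s t g] bdd_partition_sums_sub[OF bdd] that by fastforce
  show cont_l: "continuous_on {0..1} \<l>"
    unfolding continuous_on_iff
  proof (intro ballI allI impI)
    fix t e :: real assume "t \<in> {0..1}" "0 < e"
    then obtain \<eta> where "\<eta> > 0"
      and \<eta>: "\<And>s t. s \<in> {0..1} \<Longrightarrow> t \<in> {0..1} \<Longrightarrow> s \<le> t \<Longrightarrow> t - s < \<eta> \<Longrightarrow> length_on d g s t < e"
      using length_on_uniformly_small[OF _ assms(1) bdd cont] by (metis zero_le_one)
    have "dist (\<l> s) (\<l> t) < e" if "s \<in> {0..1}" "dist s t < \<eta>" for s
      using \<eta>[of s t] \<eta>[of t s] diff[of s t] diff[of t s] mono[of s t] mono[of t s] that
        \<open>t \<in> {0..1}\<close>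
      by (cases "s \<le> t") (auto simp: dist_real_def)
    then show "\<exists>\<eta>>0. \<forall>s\<in>{0..1}. dist s t < \<eta> \<longrightarrow> dist (\<l> s) (\<l> t) < e"
      using \<open>\<eta> > 0\<close> by blast
  qed
  have eq: "g s = g t" if "s \<in> {0..1}" "t \<in> {0..1}" "\<l> s = \<l> t" for s t
  proof -
    have "d (g s) (g t) = 0" using le[OF that(1,2)] that(3) nonneg[of "g s" "g t"] by linarith
    moreover have "g s \<in> M" "g t \<in> M" using assms(1) that by auto
    ultimately show ?thesis by simp
  qed
  show lh: "h (\<l> t) = g t" if "t \<in> {0..1}" for t
  proof -
    let ?u = "SOME u. u \<in> {0..1} \<and> \<l> u = \<l> t"
    have "?u \<in> {0..1} \<and> \<l> ?u = \<l> t" by (rule someI) (use that in auto)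
    then show ?thesis unfolding h_def using eq that by blast
  qed
  have l0: "\<l> 0 = 0" using diff[of 0 0] length_on_add[of 0 0 0 g] assms(1)
      bdd_partition_sums_sub[OF bdd, of 0 0] by (auto simp: \<l>_def image_subset_iff)
  have onto: "\<exists>t\<in>{0..1}. \<l> t = s" if "s \<in> {0..\<l> 1}" for s
    using IVT'[of \<l> 0 s 1] cont_l that l0 by auto
  show "h s \<in> g ` {0..1}" if "s \<in> {0..\<l> 1}" for s
    using onto[OF that] lh by force
  show "d (h s) (h s') \<le> \<bar>s - s'\<bar>" if "s \<in> {0..\<l> 1}" "s' \<in> {0..\<l> 1}" for s s'
    using onto[OF that(1)] onto[OF that(2)] lh le by (metis abs_minus_commute)
qed

end

section \<open>Quasihyperbolic length is length in the distance-ratio metric\<close>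

lemma path_uniformly_continuous:
  fixes g :: "real \<Rightarrow> 'a::metric_space"
  assumes "path g" "0 < e"
  shows "\<exists>\<eta>>0. \<forall>u\<in>{0..1}. \<forall>v\<in>{0..1}. \<bar>u - v\<bar> < \<eta> \<longrightarrow> dist (g u) (g v) < e"
proof -
  have "uniformly_continuous_on {0..1} g"
    using assms(1) by (intro compact_uniformly_continuous) (auto simp: path_def)
  then obtain \<eta> where "\<eta> > 0" "\<And>u v. u \<in> {0..1} \<Longrightarrow> v \<in> {0..1} \<Longrightarrow> dist v u < \<eta> \<Longrightarrow> dist (g v) (g u) < e"
    unfolding uniformly_continuous_on_def using assms(2) by metis
  then show ?thesis by (auto simp: dist_real_def intro!: exI[of _ \<eta>])
qed

text \<open>
  The metric \<open>j\<close> of Gehring and Osgood. Infinitesimally it is \<open>dist u v / bdist \<Omega> u\<close>, the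
  quasihyperbolic line element.
\<close>

definition ratio_dist :: "'a::euclidean_space set \<Rightarrow> 'a \<Rightarrow> 'a \<Rightarrow> real" where
  "ratio_dist \<Omega> u v = ln (1 + dist u v / min (bdist \<Omega> u) (bdist \<Omega> v))"

locale proper =
  fixes \<Omega> :: "'a::euclidean_space set"
  assumes proper: "proper_domain \<Omega>"
begin

lemma open_dom: "open \<Omega>" and connected_dom: "connected \<Omega>"
  using proper by (auto simp: proper_domain_def)

lemma frontier_nonempty: "frontier \<Omega> \<noteq> {}"
  using proper frontier_eq_empty[of \<Omega>] by (auto simp: proper_domain_def)

lemma bdist_nonneg: "0 \<le> bdist \<Omega> z"
  by (simp add: bdist_def infdist_nonneg)

lemma bdist_pos: "z \<in> \<Omega> \<Longrightarrow> 0 < bdist \<Omega> z"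
  unfolding bdist_def
  using infdist_pos_not_in_closed[OF frontier_closed frontier_nonempty, of z]
    open_dom frontier_disjoint_eq[of \<Omega>] by blast

lemma bdist_Lipschitz: "bdist \<Omega> u \<le> bdist \<Omega> v + dist u v"
  unfolding bdist_def by (rule infdist_triangle)

lemma continuous_on_bdist [continuous_intros]:
  "continuous_on S g \<Longrightarrow> continuous_on S (\<lambda>x. bdist \<Omega> (g x))"
  unfolding bdist_def by (rule continuous_on_infdist)

text \<open>
  A segment from \<open>z\<close> that leaves \<open>\<Omega>\<close> meets the frontier on its way.
\<close>

lemma in_dom_if_dist_less:
  assumes "z \<in> \<Omega>" "dist z u < bdist \<Omega> z"
  shows "u \<in> \<Omega>"
proof (rule ccontr)
  assume "u \<notin> \<Omega>"
  then have "closed_segment z u \<inter> frontier \<Omega> \<noteq> {}"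
    using assms(1) by (intro connected_Int_frontier) auto
  then obtain v where v: "v \<in> closed_segment z u" "v \<in> frontier \<Omega>" by blast
  then have "bdist \<Omega> z \<le> dist z v" unfolding bdist_def by (intro infdist_le)
  also have "\<dots> \<le> dist z u" using v(1) dist_in_closed_segment[OF v(1)] by (simp add: dist_commute)
  finally show False using assms(2) by simp
qed

lemma ratio_dist_nonneg: "0 \<le> ratio_dist \<Omega> u v"
  unfolding ratio_dist_def by (simp add: bdist_nonneg)

lemma ratio_dist_commute: "ratio_dist \<Omega> u v = ratio_dist \<Omega> v u"
  unfolding ratio_dist_def by (simp add: dist_commute min.commute)

lemma exp_ratio_dist:
  assumes "u \<in> \<Omega>" "v \<in> \<Omega>"
  shows "exp (ratio_dist \<Omega> u v) = 1 + dist u v / min (bdist \<Omega> u) (bdist \<Omega> v)"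
proof -
  have "0 < min (bdist \<Omega> u) (bdist \<Omega> v)" using bdist_pos assms by simp
  then have "0 \<le> dist u v / min (bdist \<Omega> u) (bdist \<Omega> v)" by simp
  then show ?thesis unfolding ratio_dist_def by (subst exp_ln) linarith+
qed

lemma dist_le_ratio_dist:
  assumes "u \<in> \<Omega>" "v \<in> \<Omega>"
  shows "dist u v \<le> bdist \<Omega> u * (exp (ratio_dist \<Omega> u v) - 1)"
    and "dist u v \<le> bdist \<Omega> v * (exp (ratio_dist \<Omega> u v) - 1)"
proof -
  have *: "0 < bdist \<Omega> u" "0 < bdist \<Omega> v" using bdist_pos assms by auto
  have "dist u v = min (bdist \<Omega> u) (bdist \<Omega> v) * (exp (ratio_dist \<Omega> u v) - 1)"
    unfolding exp_ratio_dist[OF assms] using * by (simp add: min_def)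
  then show "dist u v \<le> bdist \<Omega> u * (exp (ratio_dist \<Omega> u v) - 1)"
    "dist u v \<le> bdist \<Omega> v * (exp (ratio_dist \<Omega> u v) - 1)"
    using ratio_dist_nonneg by (auto intro!: mult_right_mono)
qed

lemma bdist_le_ratio_dist:
  assumes "u \<in> \<Omega>" "v \<in> \<Omega>"
  shows "bdist \<Omega> v \<le> bdist \<Omega> u * exp (ratio_dist \<Omega> u v)"
  using dist_le_ratio_dist(1)[OF assms] bdist_Lipschitz[of v u]
  by (simp add: dist_commute algebra_simps)

lemma ratio_dist_le:
  assumes "m \<le> bdist \<Omega> u" "m \<le> bdist \<Omega> v" "0 < m"
  shows "ratio_dist \<Omega> u v \<le> dist u v / m"
proof -
  have "ratio_dist \<Omega> u v \<le> dist u v / min (bdist \<Omega> u) (bdist \<Omega> v)"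
    unfolding ratio_dist_def
    using assms by (intro ln_add_one_self_le_self divide_nonneg_pos) auto
  also have "\<dots> \<le> dist u v / m" using assms by (intro divide_left_mono) auto
  finally show ?thesis .
qed

lemma ratio_dist_ge:
  assumes "u \<in> \<Omega>" "v \<in> \<Omega>" "dist u v + min (bdist \<Omega> u) (bdist \<Omega> v) \<le> D"
  shows "dist u v \<le> D * ratio_dist \<Omega> u v"
proof -
  define m where "m = min (bdist \<Omega> u) (bdist \<Omega> v)"
  have "0 < m" using bdist_pos assms by (simp add: m_def)
  have "1 - inverse (1 + dist u v / m) \<le> ratio_dist \<Omega> u v"
    unfolding ratio_dist_def m_def[symmetric]
    using \<open>0 < m\<close> ln_le_minus_one[of "inverse (1 + dist u v / m)"]
    by (simp add: ln_inverse add_pos_nonneg)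
  moreover have "1 - inverse (1 + dist u v / m) = dist u v / (dist u v + m)"
  proof -
    have "0 < m + dist u v" using \<open>0 < m\<close> by (simp add: add_pos_nonneg)
    then show ?thesis using \<open>0 < m\<close> by (simp add: field_simps)
  qed
  ultimately have "dist u v \<le> (dist u v + m) * ratio_dist \<Omega> u v"
    using \<open>0 < m\<close> zero_le_dist[of u v] by (simp add: field_simps add_nonneg_pos)
  also have "\<dots> \<le> D * ratio_dist \<Omega> u v"
    using assms(3) ratio_dist_nonneg m_def by (intro mult_right_mono) auto
  finally show ?thesis .
qed

text \<open>
  The triangle inequality comes from \<open>bdist v \<le> bdist u + dist u v\<close>: passing from \<open>u\<close> to \<open>v\<close>
  multiplies the scale at most by \<open>1 + dist u v / bdist u\<close>.
\<close>

lemma Metric_space_ratio_dist: "Metric_space \<Omega> (ratio_dist \<Omega>)"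
proof
  fix u v :: 'a
  show "0 \<le> ratio_dist \<Omega> u v" by (rule ratio_dist_nonneg)
  show "ratio_dist \<Omega> u v = ratio_dist \<Omega> v u" by (rule ratio_dist_commute)
next
  fix u v assume "u \<in> \<Omega>" "v \<in> \<Omega>"
  then have "0 < min (bdist \<Omega> u) (bdist \<Omega> v)" using bdist_pos by simp
  then show "(ratio_dist \<Omega> u v = 0) = (u = v)"
    using exp_ratio_dist[OF \<open>u \<in> \<Omega>\<close> \<open>v \<in> \<Omega>\<close>]
    by (auto simp: ratio_dist_def)
next
  have *: "ratio_dist \<Omega> u w \<le> ratio_dist \<Omega> u v + ratio_dist \<Omega> v w"
    if uvw: "u \<in> \<Omega>" "v \<in> \<Omega>" "w \<in> \<Omega>" and le: "bdist \<Omega> u \<le> bdist \<Omega> w" for u v w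
  proof -
    have pos: "0 < bdist \<Omega> u" "0 < bdist \<Omega> v" "0 < bdist \<Omega> w" using bdist_pos uvw by auto
    have "dist u w \<le> dist u v + dist v w" by (rule dist_triangle)
    also have "dist v w \<le> bdist \<Omega> v * (exp (ratio_dist \<Omega> v w) - 1)"
      by (rule dist_le_ratio_dist(1)) fact+
    also have "\<dots> \<le> (bdist \<Omega> u * exp (ratio_dist \<Omega> u v)) * (exp (ratio_dist \<Omega> v w) - 1)"
      using bdist_le_ratio_dist[OF uvw(1,2)] ratio_dist_nonneg by (intro mult_right_mono) auto
    also have "dist u v \<le> bdist \<Omega> u * (exp (ratio_dist \<Omega> u v) - 1)"
      by (rule dist_le_ratio_dist(1)) fact+
    finally have "bdist \<Omega> u + dist u w
        \<le> bdist \<Omega> u * (exp (ratio_dist \<Omega> u v) * exp (ratio_dist \<Omega> v w))"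
      by (simp add: algebra_simps)
    moreover have "exp (ratio_dist \<Omega> u w) = (bdist \<Omega> u + dist u w) / bdist \<Omega> u"
      unfolding exp_ratio_dist[OF uvw(1,3)] using pos le by (simp add: min_absorb1 field_simps)
    ultimately have "exp (ratio_dist \<Omega> u w) \<le> exp (ratio_dist \<Omega> u v + ratio_dist \<Omega> v w)"
      using pos by (simp add: pos_divide_le_eq exp_add mult.commute)
    then show ?thesis by simp
  qed
  fix u v w assume "u \<in> \<Omega>" "v \<in> \<Omega>" "w \<in> \<Omega>"
  then show "ratio_dist \<Omega> u w \<le> ratio_dist \<Omega> u v + ratio_dist \<Omega> v w"
    using *[of u v w] *[of w v u] by (cases "bdist \<Omega> u \<le> bdist \<Omega> w") (auto simp: ratio_dist_commute)
qed

sublocale ratio: Metric_space \<Omega> "ratio_dist \<Omega>"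
  by (rule Metric_space_ratio_dist)

lemma bdist_bounds_on_path:
  assumes "path g" "path_image g \<subseteq> \<Omega>"
  obtains m D where "0 < m" "0 < D" "\<And>t. t \<in> {0..1} \<Longrightarrow> m \<le> bdist \<Omega> (g t)"
    "\<And>s t. s \<in> {0..1} \<Longrightarrow> t \<in> {0..1} \<Longrightarrow> dist (g s) (g t) + bdist \<Omega> (g s) \<le> D"
proof -
  have c: "continuous_on {0..1} (\<lambda>t. bdist \<Omega> (g t))"
    using assms(1) by (intro continuous_intros) (simp add: path_def)
  obtain t0 where t0: "t0 \<in> {0..1}" "\<And>t. t \<in> {0..1} \<Longrightarrow> bdist \<Omega> (g t0) \<le> bdist \<Omega> (g t)"
    using continuous_attains_inf[OF _ _ c] by auto
  obtain t1 where t1: "t1 \<in> {0..1}" "\<And>t. t \<in> {0..1} \<Longrightarrow> bdist \<Omega> (g t) \<le> bdist \<Omega> (g t1)"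
    using continuous_attains_sup[OF _ _ c] by auto
  have in_dom: "g t \<in> \<Omega>" if "t \<in> {0..1}" for t using assms(2) that by (auto simp: path_image_def)
  have "bounded (path_image g)" using assms(1) by (rule bounded_path_image)
  then obtain B where B: "\<And>u v. u \<in> path_image g \<Longrightarrow> v \<in> path_image g \<Longrightarrow> dist u v \<le> B"
    by (auto simp: bounded_two_points)
  show thesis
  proof (rule that[of "bdist \<Omega> (g t0)" "B + bdist \<Omega> (g t1)"])
    show "0 < bdist \<Omega> (g t0)" using t0 in_dom bdist_pos by auto
    have "0 \<le> B" using B[of "g 0" "g 0"] by (auto simp: path_image_def)
    then show "0 < B + bdist \<Omega> (g t1)" using t1 in_dom bdist_pos[of "g t1"] by auto
    show "bdist \<Omega> (g t0) \<le> bdist \<Omega> (g t)" if "t \<in> {0..1}" for t using t0 that by blast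
    show "dist (g s) (g t) + bdist \<Omega> (g s) \<le> B + bdist \<Omega> (g t1)" if "s \<in> {0..1}" "t \<in> {0..1}" for s t
      using B[of "g s" "g t"] t1(2)[of s] that by (intro add_mono) (auto simp: path_image_def)
  qed
qed

text \<open>
  On the compact image of a curve the Euclidean and the distance-ratio metric are comparable.
\<close>

lemma rectifiable_iff_ratio_dist:
  assumes "path g" "path_image g \<subseteq> \<Omega>"
  shows "rectifiable_path g \<longleftrightarrow> bdd_above (partition_sums (ratio_dist \<Omega>) g 0 1)"
proof -
  obtain m D where mD: "0 < m" "0 < D" "\<And>t. t \<in> {0..1} \<Longrightarrow> m \<le> bdist \<Omega> (g t)"
    "\<And>s t. s \<in> {0..1} \<Longrightarrow> t \<in> {0..1} \<Longrightarrow> dist (g s) (g t) + bdist \<Omega> (g s) \<le> D"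
    using bdist_bounds_on_path[OF assms] by blast
  have in_dom: "g t \<in> \<Omega>" if "t \<in> {0..1}" for t using assms(2) that by (auto simp: path_image_def)
  have 1: "ratio_dist \<Omega> (g s) (g t) \<le> (1/m) * dist (g s) (g t)" if "0 \<le> s" "s \<le> t" "t \<le> 1" for s t
    using ratio_dist_le[of m "g s" "g t"] mD that by auto
  have 2: "dist (g s) (g t) \<le> D * ratio_dist \<Omega> (g s) (g t)" if "0 \<le> s" "s \<le> t" "t \<le> 1" for s t
    using ratio_dist_ge[of "g s" "g t" D] mD(4)[of s t] in_dom that by fastforce
  show ?thesis
    unfolding rectifiable_path_def variation_sums_eq
    using assms(1) bdd_partition_sums_compare[of 0 1 D "ratio_dist \<Omega>" g dist]
      bdd_partition_sums_compare[of 0 1 "1/m" dist g "ratio_dist \<Omega>"] 1 2 mD(1,2) by auto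
qed

lemma path_uniformly_continuous_ratio_dist:
  assumes "path g" "path_image g \<subseteq> \<Omega>" "0 < e"
  shows "\<exists>\<eta>>0. \<forall>u\<in>{0..1}. \<forall>v\<in>{0..1}. \<bar>u - v\<bar> < \<eta> \<longrightarrow> ratio_dist \<Omega> (g u) (g v) < e"
proof -
  obtain m where m: "0 < m" "\<And>t. t \<in> {0..1} \<Longrightarrow> m \<le> bdist \<Omega> (g t)"
    using bdist_bounds_on_path[OF assms(1,2)] by metis
  obtain \<eta> where "\<eta> > 0" and \<eta>: "\<And>u v. u \<in> {0..1} \<Longrightarrow> v \<in> {0..1} \<Longrightarrow> \<bar>u - v\<bar> < \<eta> \<Longrightarrow> dist (g u) (g v) < e * m"
    using path_uniformly_continuous[OF assms(1), of "e * m"] assms(3) m(1) by auto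
  have "ratio_dist \<Omega> (g u) (g v) < e" if "u \<in> {0..1}" "v \<in> {0..1}" "\<bar>u - v\<bar> < \<eta>" for u v
    using ratio_dist_le[OF m(2)[OF that(1)] m(2)[OF that(2)] m(1)] \<eta>[OF that] m(1)
    by (meson le_less_trans pos_divide_less_eq)
  then show ?thesis using \<open>\<eta> > 0\<close> by blast
qed

text \<open>
  Along a curve parametrized by arc length, \<open>bdist\<close> grows at most at unit rate, so the density
  \<open>1 / bdist\<close> integrates to at least the logarithm that defines the distance-ratio metric.
\<close>

lemma ratio_dist_le_integral:
  assumes "s \<le> t"
    and dom: "\<And>r. r \<in> {s..t} \<Longrightarrow> h r \<in> \<Omega>"
    and lip: "\<And>r r'. r \<in> {s..t} \<Longrightarrow> r' \<in> {s..t} \<Longrightarrow> dist (h r) (h r') \<le> \<bar>r - r'\<bar>"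
  shows "ratio_dist \<Omega> (h s) (h t) \<le> integral {s..t} (\<lambda>r. 1 / bdist \<Omega> (h r))"
proof -
  have cont_h: "continuous_on {s..t} h"
    unfolding continuous_on_iff using lip by (metis dist_real_def le_less_trans)
  have pos: "0 < bdist \<Omega> (h r)" if "r \<in> {s..t}" for r using dom bdist_pos that by blast
  have int: "(\<lambda>r. 1 / bdist \<Omega> (h r)) integrable_on {s..t}"
    using pos by (intro integrable_continuous_real continuous_intros cont_h) force
  have log_le: "ln (1 + dist (h s) (h t) / c) \<le> ln (1 + (t - s) / c)" if "0 < c" for c
    using lip[of s t] assms(1) that
    by (intro ln_mono add_left_mono divide_right_mono) (auto intro!: add_pos_nonneg)
  define a where "a = bdist \<Omega> (h s)"
  define b where "b = bdist \<Omega> (h t)"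
  have ab: "0 < a" "0 < b" using pos assms(1) by (auto simp: a_def b_def)
  have "ln (1 + (t - s) / a) \<le> integral {s..t} (\<lambda>r. 1 / bdist \<Omega> (h r))"
  proof -
    have "((\<lambda>r. 1 / (a + (r - s))) has_integral (ln (a + (t - s)) - ln (a + (s - s)))) {s..t}"
      using assms(1) ab(1)
      by (intro fundamental_theorem_of_calculus)
         (auto intro!: derivative_eq_intros simp: has_real_derivative_iff_has_vector_derivative[symmetric])
    moreover have "1 / (a + (r - s)) \<le> 1 / bdist \<Omega> (h r)" if "r \<in> {s..t}" for r
    proof -
      have "bdist \<Omega> (h r) \<le> a + (r - s)"
        using bdist_Lipschitz[of "h r" "h s"] lip[of r s] that by (auto simp: a_def)
      then show ?thesis using pos[OF that] by (intro divide_left_mono mult_pos_pos) auto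
    qed
    ultimately have "ln (a + (t - s)) - ln (a + (s - s)) \<le> integral {s..t} (\<lambda>r. 1 / bdist \<Omega> (h r))"
      using int by (intro has_integral_le[OF _ integrable_integral]) auto
    moreover have "ln (1 + (t - s) / a) = ln (a + (t - s)) - ln (a + (s - s))"
      using ab(1) assms(1) by (simp add: field_simps flip: ln_divide_pos)
    ultimately show ?thesis by simp
  qed
  moreover have "ln (1 + (t - s) / b) \<le> integral {s..t} (\<lambda>r. 1 / bdist \<Omega> (h r))"
  proof -
    have "((\<lambda>r. 1 / (b + (t - r))) has_integral (- ln (b + (t - t)) - (- ln (b + (t - s))))) {s..t}"
      using assms(1) ab(2)
      by (intro fundamental_theorem_of_calculus)
         (auto intro!: derivative_eq_intros simp: has_real_derivative_iff_has_vector_derivative[symmetric])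
    moreover have "1 / (b + (t - r)) \<le> 1 / bdist \<Omega> (h r)" if "r \<in> {s..t}" for r
    proof -
      have "bdist \<Omega> (h r) \<le> b + (t - r)"
        using bdist_Lipschitz[of "h r" "h t"] lip[of r t] that by (auto simp: b_def)
      then show ?thesis using pos[OF that] by (intro divide_left_mono mult_pos_pos) auto
    qed
    ultimately have "- ln (b + (t - t)) - (- ln (b + (t - s))) \<le> integral {s..t} (\<lambda>r. 1 / bdist \<Omega> (h r))"
      using int by (intro has_integral_le[OF _ integrable_integral]) auto
    moreover have "ln (1 + (t - s) / b) = - ln (b + (t - t)) - (- ln (b + (t - s)))"
      using ab(2) assms(1) by (simp add: field_simps flip: ln_divide_pos)
    ultimately show ?thesis by simp
  qed
  ultimately show ?thesis
    unfolding ratio_dist_def a_def[symmetric] b_def[symmetric]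
    using log_le[OF ab(1)] log_le[OF ab(2)] by (auto simp: min_def)
qed

end

lemma local_mono_imp_le:
  fixes A :: "real \<Rightarrow> real"
  assumes "0 < \<eta>"
    and loc: "\<And>s t. s \<in> {0..1} \<Longrightarrow> t \<in> {0..1} \<Longrightarrow> s \<le> t \<Longrightarrow> t - s < \<eta> \<Longrightarrow> A s \<le> A t"
  shows "A 0 \<le> A 1"
proof -
  obtain N :: nat where N: "0 < N" "1 / N < \<eta>"
    using assms(1) reals_Archimedean2[of "1/\<eta>"]
    by (metis divide_less_eq gr0I less_divide_eq mult.commute of_nat_0_less_iff of_nat_eq_0_iff
        less_trans zero_less_divide_1_iff not_less_iff_gr_or_eq)
  have "A 0 \<le> A (i / N)" if "i \<le> N" for i :: nat
    using that
  proof (induction i)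
    case (Suc i)
    have "A (i / N) \<le> A (Suc i / N)"
      using Suc.prems N by (intro loc) (auto simp: field_simps)
    then show ?case using Suc by simp
  qed simp
  from this[of N] show ?thesis using N by simp
qed

context proper
begin

text \<open>
  Both sides are additive over subintervals, so they need only be compared on short pieces. There
  \<open>bdist\<close> is almost constant, so the two metrics are almost proportional, with a ratio that tends
  to one as the pieces shrink. This identity makes additivity, invariance under reparametrization
  and lower semicontinuity of the quasihyperbolic length immediate.
\<close>

lemma qh_length_eq_ratio_length:
  assumes rect: "rectifiable_path g" and img: "path_image g \<subseteq> \<Omega>"
  shows "qh_length \<Omega> g = length_on (ratio_dist \<Omega>) g 0 1"
proof -
  have pg: "path g" and bdd: "bdd_above (partition_sums dist g 0 1)"
    using rect by (auto simp: rectifiable_path_def variation_sums_eq)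
  define l where "l = length_on dist g 0"
  define h where "h s = g (SOME t. t \<in> {0..1} \<and> l t = s)" for s
  define f where "f r = 1 / bdist \<Omega> (h r)" for r
  define \<Phi> where "\<Phi> t = integral {0..l t} f" for t
  have puc: "\<forall>e>0. \<exists>\<eta>>0. \<forall>u\<in>{0..1}. \<forall>v\<in>{0..1}. \<bar>u - v\<bar> < \<eta> \<longrightarrow> dist (g u) (g v) < e"
    using path_uniformly_continuous[OF pg] by blast
  have pucr: "\<forall>e>0. \<exists>\<eta>>0. \<forall>u\<in>{0..1}. \<forall>v\<in>{0..1}. \<bar>u - v\<bar> < \<eta> \<longrightarrow> ratio_dist \<Omega> (g u) (g v) < e"
    using path_uniformly_continuous_ratio_dist[OF pg img] by blast
  note par = Met_TC.continuous_on_length[OF subset_UNIV bdd puc, folded l_def]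
    Met_TC.length_on_diff[OF subset_UNIV bdd puc, folded l_def]
    Met_TC.arc_param_length[OF subset_UNIV bdd puc, folded l_def, folded h_def]
    Met_TC.arc_param_lipschitz[OF subset_UNIV bdd puc, folded l_def, folded h_def]
    Met_TC.arc_param_image[OF subset_UNIV bdd puc, folded l_def, folded h_def]
  have qh: "qh_length \<Omega> g = \<Phi> 1"
    unfolding qh_length_def curve_integral_def \<Phi>_def f_def h_def arc_length_param_def l_def
      arc_length_eq ..
  have bddr: "bdd_above (partition_sums (ratio_dist \<Omega>) g 0 1)"
    using rectifiable_iff_ratio_dist[OF pg img] rect by simp
  have in_dom: "g t \<in> \<Omega>" if "t \<in> {0..1}" for t using img that by (auto simp: path_image_def)
  have gdom: "g ` {0..1} \<subseteq> \<Omega>" using in_dom by blast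
  define J where "J = length_on (ratio_dist \<Omega>) g 0"
  note J_diff = ratio.length_on_diff[OF gdom bddr pucr, folded J_def]
  have l_mono: "l s \<le> l t" if "0 \<le> s" "s \<le> t" "t \<le> 1" for s t
    using par(2)[OF that] Met_TC.length_on_nonneg[of s t g] that
      Met_TC.bdd_partition_sums_sub[OF bdd, of s t] by auto
  have l0: "l 0 = 0" using par(2)[of 0 0] by (simp add: l_def)
  have J0: "J 0 = 0" using J_diff[of 0 0] by (simp add: J_def)
  have l_range: "l t \<in> {0..l 1}" if "t \<in> {0..1}" for t
    using l_mono[of 0 t] l_mono[of t 1] that unfolding l0 atLeastAtMost_iff by blast
  have h_dom: "h r \<in> \<Omega>" if "r \<in> {0..l 1}" for r by (rule subsetD[OF gdom par(5)[OF that]])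
  have f_pos: "0 < f r" if "r \<in> {0..l 1}" for r
    unfolding f_def using bdist_pos[OF h_dom[OF that]] by simp
  have cont_h: "continuous_on {0..l 1} h"
    unfolding continuous_on_iff using par(4) by (metis dist_real_def le_less_trans)
  have cont_f: "continuous_on {0..l 1} f"
    unfolding f_def using h_dom bdist_pos
    by (intro continuous_intros cont_h) (metis less_irrefl)
  have f_int: "f integrable_on {l s..l t}" if "0 \<le> s" "s \<le> t" "t \<le> 1" for s t
    using l_range[of s] l_range[of t] that
    by (intro integrable_continuous_real continuous_on_subset[OF cont_f]) auto
  have \<Phi>_diff: "\<Phi> t - \<Phi> s = integral {l s..l t} f" if "0 \<le> s" "s \<le> t" "t \<le> 1" for s t
    using Henstock_Kurzweil_Integration.integral_combine[of 0 "l s" "l t" f] l_mono[of 0 s]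
      l_mono[of s t] l0 f_int[of 0 t] that
    by (simp add: \<Phi>_def)
  have \<Phi>0: "\<Phi> 0 = 0" by (simp add: \<Phi>_def l0)
  \<comment> \<open>\<open>J \<le> \<Phi>\<close>: each step of a partition is bounded by the integral of the density over it.\<close>
  have "J 1 \<le> \<Phi> 1"
  proof -
    have "x \<le> \<Phi> 1 - \<Phi> 0" if "x \<in> partition_sums (ratio_dist \<Omega>) g 0 1" for x
    proof (rule partition_sum_le_increment[OF that])
      fix s t :: real assume st: "0 \<le> s" "s \<le> t" "t \<le> 1"
      have sub: "{l s..l t} \<subseteq> {0..l 1}" using l_range[of s] l_range[of t] st by auto
      show "\<Phi> s \<le> \<Phi> t"
        using \<Phi>_diff[OF st] integral_nonneg[OF f_int[OF st]] f_pos sub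
        by (smt (verit) subsetD)
      have "ratio_dist \<Omega> (h (l s)) (h (l t)) \<le> integral {l s..l t} (\<lambda>r. 1 / bdist \<Omega> (h r))"
        using l_mono[OF st] h_dom sub par(4) by (intro ratio_dist_le_integral) auto
      then show "ratio_dist \<Omega> (g s) (g t) \<le> \<Phi> t - \<Phi> s"
        using \<Phi>_diff[OF st] par(3)[of s] par(3)[of t] st by (simp add: f_def[abs_def])
    qed
    then show ?thesis
      unfolding J_def length_on_def using zero_in_partition_sums[of 0 1 "ratio_dist \<Omega>" g] \<Phi>0
      by (intro cSup_least) auto
  qed
  moreover have "\<Phi> 1 \<le> J 1"
  proof -
    have "(1 - \<epsilon>) * \<Phi> 1 \<le> J 1" if \<epsilon>: "0 < \<epsilon>" "\<epsilon> < 1" for \<epsilon>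
    proof -
      obtain m where m: "0 < m" "\<And>t. t \<in> {0..1} \<Longrightarrow> m \<le> bdist \<Omega> (g t)"
        using bdist_bounds_on_path[OF pg img] by metis
      \<comment> \<open>On a piece shorter than \<open>\<theta>\<close>, the value of \<open>bdist\<close> lies between \<open>b - \<theta>\<close> and \<open>b + \<theta>\<close>, and
        \<open>b - \<theta>\<close> is at least \<open>(1 - \<epsilon>) * (b + 2 * \<theta>)\<close>.\<close>
      define \<theta> where "\<theta> = \<epsilon> * m / 3"
      have \<theta>: "0 < \<theta>" "\<theta> < m" using \<epsilon> m(1) by (auto simp: \<theta>_def field_simps)
      obtain \<eta> where \<eta>: "0 < \<eta>"
        "\<And>s t. s \<in> {0..1} \<Longrightarrow> t \<in> {0..1} \<Longrightarrow> s \<le> t \<Longrightarrow> t - s < \<eta> \<Longrightarrow> length_on dist g s t < \<theta>"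
        using Met_TC.length_on_uniformly_small[OF zero_le_one subset_UNIV bdd puc \<theta>(1)] by metis
      have "J 0 - (1 - \<epsilon>) * \<Phi> 0 \<le> J 1 - (1 - \<epsilon>) * \<Phi> 1"
      proof (rule local_mono_imp_le[OF \<eta>(1)])
        fix s t :: real assume st': "s \<in> {0..1}" "t \<in> {0..1}" "s \<le> t" "t - s < \<eta>"
        then have st: "0 \<le> s" "s \<le> t" "t \<le> 1" by auto
        define b where "b = bdist \<Omega> (g s)"
        define \<mu> where "\<mu> = l t - l s"
        have bm: "m \<le> b" using m(2) st by (simp add: b_def)
        have \<mu>: "length_on dist g s t = \<mu>" "0 \<le> \<mu>" "\<mu> < \<theta>"
          using par(2)[OF st] l_mono[OF st] \<eta>(2)[OF st'] by (auto simp: \<mu>_def)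
        have sub: "{l s..l t} \<subseteq> {0..l 1}" using l_range[of s] l_range[of t] st by auto
        have "f r \<le> 1 / (b - \<theta>)" if "r \<in> {l s..l t}" for r
        proof -
          have "dist (h r) (h (l s)) \<le> r - l s"
            using par(4)[of r "l s"] that sub l_range[of s] st by auto
          then have "dist (h r) (g s) \<le> \<theta>" using par(3)[of s] st that \<mu> \<mu>_def by auto
          then have "b - \<theta> \<le> bdist \<Omega> (h r)"
            using bdist_Lipschitz[of "g s" "h r"] by (simp add: b_def dist_commute)
          then show ?thesis unfolding f_def using \<theta> bm by (intro divide_left_mono mult_pos_pos) auto
        qed
        then have "integral {l s..l t} f \<le> integral {l s..l t} (\<lambda>_. 1 / (b - \<theta>))"
          using f_int[OF st] by (intro integral_le) auto
        then have 1: "\<Phi> t - \<Phi> s \<le> \<mu> / (b - \<theta>)"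
          using \<Phi>_diff[OF st] l_mono[OF st] by (simp add: \<mu>_def)
        have "length_on dist g s t \<le> (b + 2 * \<theta>) * length_on (ratio_dist \<Omega>) g s t"
        proof (rule length_on_compare[OF st(2)])
          show "bdd_above (partition_sums (ratio_dist \<Omega>) g s t)"
            using ratio.bdd_partition_sums_sub[OF bddr] st by simp
          fix u v assume uv: "s \<le> u" "u \<le> v" "v \<le> t"
          have "dist (g u') (g v') \<le> \<theta>" if "s \<le> u'" "u' \<le> v'" "v' \<le> t" for u' v'
          proof -
            have "dist (g u') (g v') \<le> length_on dist g u' v'"
              using Met_TC.dist_le_length_on[OF Met_TC.bdd_partition_sums_sub[OF bdd]] that st by auto
            also have "\<dots> \<le> \<mu>"
              using par(2)[of u' v'] l_mono[of s u'] l_mono[of v' t] that st by (simp add: \<mu>_def)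
            finally show ?thesis using \<mu> by simp
          qed
          from this[of u v] this[of s u] have "dist (g u) (g v) \<le> \<theta>" "dist (g u) (g s) \<le> \<theta>"
            using uv by (auto simp: dist_commute)
          then show "dist (g u) (g v) \<le> (b + 2 * \<theta>) * ratio_dist \<Omega> (g u) (g v)"
            using bdist_Lipschitz[of "g u" "g s"] in_dom uv st
            by (intro ratio_dist_ge) (auto simp: b_def)
        qed (use bm m \<theta> in auto)
        then have 2: "\<mu> \<le> (b + 2 * \<theta>) * (J t - J s)" using \<mu>(1) J_diff[OF st] by simp
        have pos: "0 < b - \<theta>" "0 < b + 2 * \<theta>" using bm \<theta> m(1) by auto
        have "3 * \<theta> \<le> \<epsilon> * (b + 2 * \<theta>)"
        proof -
          have "3 * \<theta> = \<epsilon> * m" by (simp add: \<theta>_def)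
          also have "\<dots> \<le> \<epsilon> * (b + 2 * \<theta>)" using bm \<epsilon> \<theta>(1) by (intro mult_left_mono) auto
          finally show ?thesis .
        qed
        then have "(1 - \<epsilon>) * (b + 2 * \<theta>) \<le> b - \<theta>" by (simp add: algebra_simps)
        then have "(1 - \<epsilon>) * ((b + 2 * \<theta>) * \<mu>) \<le> (b - \<theta>) * \<mu>"
          using mult_right_mono[OF _ \<mu>(2)] by (metis mult.assoc)
        then have "(1 - \<epsilon>) * (\<mu> / (b - \<theta>)) \<le> \<mu> / (b + 2 * \<theta>)"
          using pos by (simp add: field_simps)
        moreover have "(1 - \<epsilon>) * (\<Phi> t - \<Phi> s) \<le> (1 - \<epsilon>) * (\<mu> / (b - \<theta>))"
          using 1 \<epsilon> by (intro mult_left_mono) auto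
        moreover have "\<mu> / (b + 2 * \<theta>) \<le> J t - J s"
          using 2 pos by (simp add: field_simps)
        ultimately show "J s - (1 - \<epsilon>) * \<Phi> s \<le> J t - (1 - \<epsilon>) * \<Phi> t"
          by (simp add: algebra_simps)
      qed
      then show ?thesis using J0 \<Phi>0 by simp
    qed
    then have "\<Phi> 1 \<le> J 1 + \<epsilon> * \<Phi> 1" if "0 < \<epsilon>" "\<epsilon> < 1" for \<epsilon>
      using that by (simp add: algebra_simps)
    have nn: "0 \<le> \<Phi> 1"
      unfolding \<Phi>_def using f_int[of 0 1] f_pos l0 by (intro integral_nonneg) (auto intro: less_imp_le)
    show ?thesis
    proof (rule field_le_epsilon)
      fix e :: real assume "0 < e"
      define \<epsilon> where "\<epsilon> = min (1/2) (e / (\<Phi> 1 + 1))"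
      have \<epsilon>: "0 < \<epsilon>" "\<epsilon> < 1" using \<open>0 < e\<close> nn by (auto simp: \<epsilon>_def)
      have "\<epsilon> * \<Phi> 1 \<le> e / (\<Phi> 1 + 1) * \<Phi> 1" using nn by (intro mult_right_mono) (auto simp: \<epsilon>_def)
      also have "\<dots> \<le> e" using nn \<open>0 < e\<close> by (simp add: field_simps)
      finally show "\<Phi> 1 \<le> J 1 + e"
        using \<open>\<And>\<epsilon>. 0 < \<epsilon> \<Longrightarrow> \<epsilon> < 1 \<Longrightarrow> \<Phi> 1 \<le> J 1 + \<epsilon> * \<Phi> 1\<close>[OF \<epsilon>] by linarith
    qed
  qed
  ultimately show ?thesis using qh by (simp add: J_def)
qed

section \<open>The quasihyperbolic distance and its geodesics\<close>

abbreviation "qd \<equiv> qh_dist \<Omega>"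
abbreviation "rd \<equiv> ratio_dist \<Omega>"

definition curves :: "'a \<Rightarrow> 'a \<Rightarrow> (real \<Rightarrow> 'a) set" where
  "curves x y = {g. rectifiable_path g \<and> joins_in \<Omega> x y g}"

lemma curves_iff:
  "g \<in> curves x y \<longleftrightarrow> joins_in \<Omega> x y g \<and> bdd_above (partition_sums rd g 0 1)"
  using rectifiable_iff_ratio_dist by (auto simp: curves_def joins_in_def)

lemma joins_inD:
  assumes "joins_in \<Omega> x y g"
  shows "path g" "path_image g \<subseteq> \<Omega>" "g 0 = x" "g 1 = y" "g ` {0..1} \<subseteq> \<Omega>" "x \<in> \<Omega>" "y \<in> \<Omega>"
  using assms unfolding joins_in_def path_image_def pathstart_def pathfinish_def by auto

lemma qh_dist_eq_Inf: "qd x y = Inf ((\<lambda>g. length_on rd g 0 1) ` curves x y)"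
proof -
  have "{qh_length \<Omega> g |g. rectifiable_path g \<and> joins_in \<Omega> x y g} = (\<lambda>g. length_on rd g 0 1) ` curves x y"
    using qh_length_eq_ratio_length by (force simp: curves_def joins_in_def)
  then show ?thesis by (simp add: qh_dist_def)
qed

lemma ratio_dist_le_length: "g \<in> curves x y \<Longrightarrow> rd x y \<le> length_on rd g 0 1"
  using ratio.dist_le_length_on[of g 0 1] joins_inD[of x y g] by (auto simp: curves_iff)

lemma qh_dist_le_length:
  assumes "g \<in> curves x y"
  shows "qd x y \<le> length_on rd g 0 1"
  unfolding qh_dist_eq_Inf
  by (rule cINF_lower[OF _ assms]) (auto intro!: bdd_belowI2[of _ "rd x y"] ratio_dist_le_length)

text \<open>
  Any two points of a connected open set are joined in it by a polynomial curve, which is Lipschitz.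
\<close>

lemma curves_nonempty:
  assumes "x \<in> \<Omega>" "y \<in> \<Omega>"
  shows "curves x y \<noteq> {}"
proof -
  obtain g where g: "polynomial_function g" "path_image g \<subseteq> \<Omega>" "pathstart g = x" "pathfinish g = y"
    using connected_open_polynomial_connected[OF open_dom connected_dom assms] by blast
  then obtain g' where g': "polynomial_function g'" "\<And>t. (g has_vector_derivative g' t) (at t)"
    using has_vector_derivative_polynomial_function by blast
  have pg: "path g" using g(1) by (rule path_polynomial_function)
  have "bounded (path_image g')" using path_polynomial_function[OF g'(1)] by (rule bounded_path_image)
  then obtain B where B: "0 < B" "\<And>t. t \<in> {0..1} \<Longrightarrow> norm (g' t) \<le> B"
    unfolding bounded_pos path_image_def by auto
  have lip: "dist (g s) (g t) \<le> B * (t - s)" if "0 \<le> s" "s \<le> t" "t \<le> 1" for s t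
  proof -
    have "norm (g s - g t) \<le> B * norm (s - t)"
    proof (rule differentiable_bound[of "{0..1}" g "\<lambda>t h. h *\<^sub>R g' t"])
      fix t :: real assume "t \<in> {0..1}"
      show "(g has_derivative (\<lambda>h. h *\<^sub>R g' t)) (at t within {0..1})"
        using g'(2)[of t] unfolding has_vector_derivative_def by (rule has_derivative_at_withinI)
      show "onorm (\<lambda>h. h *\<^sub>R g' t) \<le> B"
        using B(2)[OF \<open>t \<in> {0..1}\<close>] by (intro onorm_le) (auto simp: mult.commute[of B] intro: mult_left_mono)
    qed (use that in auto)
    then show ?thesis using that by (simp add: dist_norm)
  qed
  have "x \<le> B * (1 - 0)" if "x \<in> partition_sums dist g 0 1" for x
    using partition_sum_le_Lipschitz[OF that, of B] B(1) lip by auto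
  then have "bdd_above (partition_sums dist g 0 1)" by (rule bdd_aboveI)
  then have "g \<in> curves x y"
    using pg g by (auto simp: curves_def joins_in_def rectifiable_path_def variation_sums_eq)
  then show ?thesis by blast
qed

lemma ratio_dist_le_qh_dist: "x \<in> \<Omega> \<Longrightarrow> y \<in> \<Omega> \<Longrightarrow> rd x y \<le> qd x y"
  unfolding qh_dist_eq_Inf by (intro cINF_greatest curves_nonempty ratio_dist_le_length)

lemma qh_dist_nonneg: "x \<in> \<Omega> \<Longrightarrow> y \<in> \<Omega> \<Longrightarrow> 0 \<le> qd x y"
  using ratio_dist_le_qh_dist ratio_dist_nonneg by (meson order_trans)

lemma qh_dist_commute: "qd x y = qd y x"
proof -
  have *: "reversepath g \<in> curves y x" "length_on rd (reversepath g) 0 1 = length_on rd g 0 1"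
    if "g \<in> curves x y" for g x y
    using that partition_sums_reversepath[of rd g, OF ratio_dist_commute]
    by (auto simp: curves_iff joins_in_def length_on_def)
  have "(\<lambda>g. length_on rd g 0 1) ` curves x y \<subseteq> (\<lambda>g. length_on rd g 0 1) ` curves y x" for x y
  proof (rule image_subsetI)
    fix g assume "g \<in> curves x y"
    then show "length_on rd g 0 1 \<in> (\<lambda>g. length_on rd g 0 1) ` curves y x"
      using *[of g x y] by (intro image_eqI[of _ _ "reversepath g"]) auto
  qed
  then show ?thesis unfolding qh_dist_eq_Inf by (metis subset_antisym)
qed

lemma qh_dist_le_length_sub:
  assumes "g \<in> curves x y" "0 \<le> s" "s < t" "t \<le> 1"
  shows "qd (g s) (g t) \<le> length_on rd g s t"
proof -
  have g: "path g" "path_image g \<subseteq> \<Omega>" "bdd_above (partition_sums rd g 0 1)"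
    using assms(1) by (auto simp: curves_iff joins_in_def)
  have sums: "partition_sums rd (subpath s t g) 0 1 = partition_sums rd g s t"
    using partition_sums_affine[of "t - s" rd g s 0 1] assms by (simp add: subpath_def)
  have "subpath s t g \<in> curves (g s) (g t)"
    unfolding curves_iff sums joins_in_def
    using g assms ratio.bdd_partition_sums_sub[OF g(3)] path_image_subpath_subset[of s t g]
    by (auto intro!: path_subpath)
  then show ?thesis using qh_dist_le_length sums by (metis length_on_def)
qed

lemma qh_dist_triangle:
  assumes "x \<in> \<Omega>" "y \<in> \<Omega>" "z \<in> \<Omega>"
  shows "qd x z \<le> qd x y + qd y z"
proof -
  have *: "qd x z \<le> length_on rd g 0 1 + length_on rd h 0 1"
    if gh: "g \<in> curves x y" "h \<in> curves y z" for g h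
  proof -
    let ?f = "g +++ h"
    have g: "joins_in \<Omega> x y g" "bdd_above (partition_sums rd g 0 1)"
      and h: "joins_in \<Omega> y z h" "bdd_above (partition_sums rd h 0 1)" using gh by (auto simp: curves_iff)
    have "partition_sums rd ?f 0 (1/2) = partition_sums rd (\<lambda>t. g (2 * t + 0)) 0 (1/2)"
      by (rule partition_sums_cong) (simp add: joinpaths_def)
    then have 1: "partition_sums rd ?f 0 (1/2) = partition_sums rd g 0 1"
      using partition_sums_affine[of 2 rd g 0 0 "1/2"] by simp
    have "partition_sums rd ?f (1/2) 1 = partition_sums rd (\<lambda>t. h (2 * t + (-1))) (1/2) 1"
    proof (intro partition_sums_cong)
      fix t :: real assume "t \<in> {1/2..1}"
      show "?f t = h (2 * t + (-1))"
      proof (cases "t = 1/2")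
        case True
        show ?thesis unfolding True using joins_inD(4)[OF g(1)] joins_inD(3)[OF h(1)]
          by (simp add: joinpaths_def)
      qed (use \<open>t \<in> {1/2..1}\<close> in \<open>auto simp: joinpaths_def\<close>)
    qed
    then have 2: "partition_sums rd ?f (1/2) 1 = partition_sums rd h 0 1"
      using partition_sums_affine[of 2 rd h "-1" "1/2" 1] by simp
    have j: "joins_in \<Omega> x z ?f"
      using g(1) h(1) path_image_join_subset[of g h] by (auto simp: joins_in_def)
    have img: "?f ` {0..1} \<subseteq> \<Omega>" using joins_inD[OF j] by blast
    have "length_on rd ?f 0 1 = length_on rd ?f 0 (1/2) + length_on rd ?f (1/2) 1"
      by (rule ratio.length_on_add) (use 1 2 g h img in auto)
    moreover have "?f \<in> curves x z"
      unfolding curves_iff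
      using j ratio.bdd_partition_sums_concat[of 0 "1/2" 1 ?f] 1 2 g h img by auto
    ultimately show ?thesis using qh_dist_le_length[of ?f x z] 1 2 by (simp add: length_on_def)
  qed
  have "qd x z - length_on rd g 0 1 \<le> qd y z" if "g \<in> curves x y" for g
    unfolding qh_dist_eq_Inf[of y z]
    using *[OF that] assms by (intro cINF_greatest curves_nonempty) (auto simp: algebra_simps)
  then have "qd x z - qd y z \<le> length_on rd g 0 1" if "g \<in> curves x y" for g
    using that by (simp add: algebra_simps)
  then have "qd x z - qd y z \<le> qd x y"
    unfolding qh_dist_eq_Inf[of x y] using assms by (intro cINF_greatest curves_nonempty) auto
  then show ?thesis by simp
qed

lemma qh_dist_le_dist:
  assumes "x \<in> \<Omega>" "dist x y \<le> bdist \<Omega> x / 2"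
  shows "y \<in> \<Omega>" "qd x y \<le> 2 * dist x y / bdist \<Omega> x"
proof -
  define m where "m = bdist \<Omega> x / 2"
  have m: "0 < m" using bdist_pos[OF assms(1)] by (simp add: m_def)
  let ?g = "linepath x y"
  have near: "dist x (?g t) \<le> m" if "t \<in> {0..1}" for t
  proof -
    have "?g t \<in> closed_segment x y" using that by (metis imageI linepath_image_01)
    then have "dist x (?g t) \<le> dist x y" using dist_in_closed_segment by (metis dist_commute)
    then show ?thesis using assms(2) m_def by simp
  qed
  have dom: "?g t \<in> \<Omega>" if "t \<in> {0..1}" for t
    using near[OF that] m by (intro in_dom_if_dist_less[OF assms(1)]) (auto simp: m_def)
  from dom[of 1] show "y \<in> \<Omega>" by (simp add: linepath_def)
  have m_le: "m \<le> bdist \<Omega> (?g t)" if "t \<in> {0..1}" for t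
    using near[OF that] bdist_Lipschitz[of x "?g t"] by (simp add: m_def)
  have lip: "rd (?g s) (?g t) \<le> dist x y / m * (t - s)" if "0 \<le> s" "s \<le> t" "t \<le> 1" for s t
  proof -
    have "?g s - ?g t = (t - s) *\<^sub>R (x - y)" by (simp add: linepath_def algebra_simps)
    then have "dist (?g s) (?g t) = (t - s) * dist x y" using that by (simp add: dist_norm)
    then show ?thesis using ratio_dist_le[OF m_le m_le m, of s t] that by (simp add: mult.commute)
  qed
  have le: "r \<le> dist x y / m * (1 - 0)" if "r \<in> partition_sums rd ?g 0 1" for r
    by (rule partition_sum_le_Lipschitz[OF that]) (use m lip in auto)
  then have "bdd_above (partition_sums rd ?g 0 1)" by (rule bdd_aboveI)
  then have "?g \<in> curves x y"
    unfolding curves_iff using dom by (auto simp: joins_in_def path_image_def)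
  then have "qd x y \<le> length_on rd ?g 0 1" by (rule qh_dist_le_length)
  also have "\<dots> \<le> dist x y / m"
    unfolding length_on_def using le zero_in_partition_sums[of 0 1 rd ?g] by (intro cSup_least) auto
  finally show "qd x y \<le> 2 * dist x y / bdist \<Omega> x" by (simp add: m_def mult.commute)
qed

lemma qh_dist_refl [simp]: "x \<in> \<Omega> \<Longrightarrow> qd x x = 0"
  using qh_dist_le_dist(2)[of x x] qh_dist_nonneg[of x x] bdist_nonneg[of x] by auto

lemma path_uniformly_continuous_qh_dist:
  assumes "path g" "path_image g \<subseteq> \<Omega>" "0 < e"
  shows "\<exists>\<eta>>0. \<forall>u\<in>{0..1}. \<forall>v\<in>{0..1}. \<bar>u - v\<bar> < \<eta> \<longrightarrow> qd (g u) (g v) < e"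
proof -
  obtain m where m: "0 < m" "\<And>t. t \<in> {0..1} \<Longrightarrow> m \<le> bdist \<Omega> (g t)"
    using bdist_bounds_on_path[OF assms(1,2)] by metis
  obtain \<eta> where "\<eta> > 0" and \<eta>: "\<And>u v. u \<in> {0..1} \<Longrightarrow> v \<in> {0..1} \<Longrightarrow> \<bar>u - v\<bar> < \<eta>
      \<Longrightarrow> dist (g u) (g v) < min (m/2) (e * m / 2)"
    using path_uniformly_continuous[OF assms(1), of "min (m/2) (e * m / 2)"] assms(3) m(1) by auto
  have "qd (g u) (g v) < e" if "u \<in> {0..1}" "v \<in> {0..1}" "\<bar>u - v\<bar> < \<eta>" for u v
  proof -
    have *: "g u \<in> \<Omega>" "m \<le> bdist \<Omega> (g u)" "dist (g u) (g v) < min (m/2) (e * m / 2)"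
      using m(2) \<eta> that assms(2) by (auto simp: path_image_def)
    then have "qd (g u) (g v) \<le> 2 * dist (g u) (g v) / bdist \<Omega> (g u)"
      by (intro qh_dist_le_dist(2)) linarith+
    also have "\<dots> \<le> 2 * dist (g u) (g v) / m"
      using * m(1) by (intro divide_left_mono mult_pos_pos) auto
    also have "\<dots> < e" using * m(1) by (simp add: field_simps)
    finally show ?thesis .
  qed
  then show ?thesis using \<open>\<eta> > 0\<close> by blast
qed

lemma continuous_on_qh_dist_path:
  assumes "path g" "path_image g \<subseteq> \<Omega>" "w \<in> \<Omega>"
  shows "continuous_on {0..1} (\<lambda>t. qd w (g t))"
  unfolding continuous_on_iff
proof (intro ballI allI impI)
  fix t e :: real assume t: "t \<in> {0..1}" and "0 < e"
  obtain \<eta> where "\<eta> > 0" and \<eta>: "\<And>u v. u \<in> {0..1} \<Longrightarrow> v \<in> {0..1} \<Longrightarrow> \<bar>u - v\<bar> < \<eta> \<Longrightarrow> qd (g u) (g v) < e"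
    using path_uniformly_continuous_qh_dist[OF assms(1,2) \<open>0 < e\<close>] by blast
  have "dist (qd w (g s)) (qd w (g t)) < e" if s: "s \<in> {0..1}" "dist s t < \<eta>" for s
  proof -
    have "g s \<in> \<Omega>" "g t \<in> \<Omega>" using s t assms(2) by (auto simp: path_image_def)
    then have "\<bar>qd w (g s) - qd w (g t)\<bar> \<le> qd (g s) (g t)"
      using qh_dist_triangle[of w "g s" "g t"] qh_dist_triangle[of w "g t" "g s"] assms(3)
        qh_dist_commute[of "g s" "g t"] by auto
    also have "\<dots> < e" using \<eta> s t by (auto simp: dist_real_def)
    finally show ?thesis by (simp add: dist_real_def)
  qed
  then show "\<exists>\<eta>>0. \<forall>s\<in>{0..1}. dist s t < \<eta> \<longrightarrow> dist (qd w (g s)) (qd w (g t)) < e"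
    using \<open>\<eta> > 0\<close> by blast
qed

lemma qh_geodesic_iff:
  "qh_geodesic \<Omega> x y g \<longleftrightarrow> g \<in> curves x y \<and> length_on rd g 0 1 = qd x y"
  using qh_length_eq_ratio_length by (auto simp: qh_geodesic_def curves_def joins_in_def)

text \<open>
  The two parts of the geodesic are at least as long as the distances of their endpoints, and
  together they have length \<open>qd x y\<close>.
\<close>

lemma qh_geodesic_add:
  assumes "qh_geodesic \<Omega> x y g" "z \<in> path_image g"
  shows "qd x z + qd z y = qd x y"
proof -
  have g: "g \<in> curves x y" "length_on rd g 0 1 = qd x y" using assms(1) by (auto simp: qh_geodesic_iff)
  then have j: "joins_in \<Omega> x y g" and bdd: "bdd_above (partition_sums rd g 0 1)" by (auto simp: curves_iff)
  note jD = joins_inD[OF j]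
  obtain t where t: "t \<in> {0..1}" "z = g t" using assms(2) by (auto simp: path_image_def)
  then have z: "z \<in> \<Omega>" using jD(5) by blast
  have "qd x z + qd z y \<le> qd x y"
  proof (cases "t = 0 \<or> t = 1")
    case True then show ?thesis using t jD by auto
  next
    case False
    then have "qd x z \<le> length_on rd g 0 t" "qd z y \<le> length_on rd g t 1"
      using qh_dist_le_length_sub[OF g(1), of 0 t] qh_dist_le_length_sub[OF g(1), of t 1] t jD by auto
    moreover have "length_on rd g 0 1 = length_on rd g 0 t + length_on rd g t 1"
      using t jD ratio.bdd_partition_sums_sub[OF bdd] by (intro ratio.length_on_add) auto
    ultimately show ?thesis using g(2) by simp
  qed
  then show ?thesis using qh_dist_triangle[of x z y] jD z by simp
qed

lemma qh_geodesic_in_dom: "qh_geodesic \<Omega> x y g \<Longrightarrow> z \<in> path_image g \<Longrightarrow> z \<in> \<Omega>"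
  by (auto simp: qh_geodesic_def joins_in_def)

lemma qh_dist_on_geodesic:
  assumes g: "qh_geodesic \<Omega> x y g" and pq: "p \<in> path_image g" "q \<in> path_image g"
  shows "qd p q \<le> \<bar>qd x p - qd x q\<bar>"
proof -
  have gc: "g \<in> curves x y" "length_on rd g 0 1 = qd x y" using g by (auto simp: qh_geodesic_iff)
  then have j: "joins_in \<Omega> x y g" and bdd: "bdd_above (partition_sums rd g 0 1)" by (auto simp: curves_iff)
  note jD = joins_inD[OF j]
  have len: "qd (g s) (g t) \<le> length_on rd g s t" if "0 \<le> s" "s \<le> t" "t \<le> 1" for s t
  proof (cases "s = t")
    case True
    moreover have "g t \<in> \<Omega>" using that jD(5) by auto
    ultimately show ?thesis using that ratio.length_on_nonneg[of s s g]
        ratio.bdd_partition_sums_sub[OF bdd, of s s] by auto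
  qed (use qh_dist_le_length_sub[OF gc(1), of s t] that in auto)
  have *: "qd (g s) (g t) \<le> qd x (g t) - qd x (g s)" if st: "0 \<le> s" "s \<le> t" "t \<le> 1" for s t
  proof -
    have "length_on rd g 0 1 = length_on rd g 0 s + length_on rd g s 1"
      "length_on rd g s 1 = length_on rd g s t + length_on rd g t 1"
      using st jD(5) ratio.bdd_partition_sums_sub[OF bdd] by (intro ratio.length_on_add; force)+
    then have "qd x (g s) + qd (g s) (g t) + qd (g t) y \<le> qd x y"
      using len[of 0 s] len[of s t] len[of t 1] st gc(2) jD(3,4) by auto
    moreover have "g t \<in> path_image g" using st by (auto simp: path_image_def)
    ultimately show ?thesis using qh_geodesic_add[OF g, of "g t"] by simp
  qed
  obtain s t where st: "s \<in> {0..1}" "p = g s" "t \<in> {0..1}" "q = g t"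
    using pq by (auto simp: path_image_def)
  show ?thesis
    using *[of s t] *[of t s] st qh_dist_commute[of p q] by (cases "s \<le> t") auto
qed

lemma qh_geodesic_point_at:
  assumes "qh_geodesic \<Omega> x y g" "0 \<le> r" "r \<le> qd x y"
  shows "\<exists>z\<in>path_image g. qd x z = r"
proof -
  have j: "joins_in \<Omega> x y g" using assms(1) by (auto simp: qh_geodesic_def)
  note jD = joins_inD[OF j]
  have "\<exists>t. 0 \<le> t \<and> t \<le> 1 \<and> qd x (g t) = r"
    using continuous_on_qh_dist_path[OF jD(1,2,6)] assms(2,3) jD by (intro IVT') auto
  then show ?thesis by (auto simp: path_image_def)
qed

lemma proportional_param:
  assumes "g \<in> curves x y"
  obtains h where "h 0 = x" "h 1 = y" "h ` {0..1} \<subseteq> \<Omega>"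
    "\<And>s t. s \<in> {0..1} \<Longrightarrow> t \<in> {0..1} \<Longrightarrow> rd (h s) (h t) \<le> length_on rd g 0 1 * \<bar>s - t\<bar>"
proof -
  have j: "joins_in \<Omega> x y g" and bdd: "bdd_above (partition_sums rd g 0 1)"
    using assms by (auto simp: curves_iff)
  note jD = joins_inD[OF j]
  have pucr: "\<forall>e>0. \<exists>\<eta>>0. \<forall>u\<in>{0..1}. \<forall>v\<in>{0..1}. \<bar>u - v\<bar> < \<eta> \<longrightarrow> rd (g u) (g v) < e"
    using path_uniformly_continuous_ratio_dist[OF jD(1,2)] by blast
  define l where "l = length_on rd g 0"
  define h where "h s = g (SOME t. t \<in> {0..1} \<and> l t = s)" for s
  note diff = ratio.length_on_diff[OF jD(5) bdd pucr, folded l_def]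
  note hl = ratio.arc_param_length[OF jD(5) bdd pucr, folded l_def, folded h_def]
  note lip = ratio.arc_param_lipschitz[OF jD(5) bdd pucr, folded l_def, folded h_def]
  note img = ratio.arc_param_image[OF jD(5) bdd pucr, folded l_def, folded h_def]
  have L: "0 \<le> l 1" using ratio.length_on_nonneg[OF zero_le_one bdd] by (simp add: l_def)
  have l0: "l 0 = 0" using diff[of 0 0] by (simp add: l_def)
  have rng: "l 1 * s \<in> {0..l 1}" if "s \<in> {0..1}" for s
    using L that by (auto simp: mult_left_le)
  show thesis
  proof (rule that[of "\<lambda>s. h (l 1 * s)"])
    show "h (l 1 * 0) = x" "h (l 1 * 1) = y" using hl[of 0] hl[of 1] l0 jD(3,4) by auto
    show "(\<lambda>s. h (l 1 * s)) ` {0..1} \<subseteq> \<Omega>" using img[OF rng] jD(5) by blast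
    show "rd (h (l 1 * s)) (h (l 1 * t)) \<le> length_on rd g 0 1 * \<bar>s - t\<bar>"
      if "s \<in> {0..1}" "t \<in> {0..1}" for s t
      using lip[OF rng[OF that(1)] rng[OF that(2)]] L
      by (simp add: l_def abs_mult flip: right_diff_distrib)
  qed
qed

text \<open>
  The closed balls of the distance-ratio metric are compact, which keeps a minimizing sequence,
  parametrized proportionally to length, equicontinuous and away from the boundary. Its uniform
  limit is a geodesic because partition sums pass to the limit: this is lower semicontinuity.
\<close>

lemma qh_geodesic_exists:
  assumes x: "x \<in> \<Omega>" and y: "y \<in> \<Omega>"
  shows "\<exists>g. qh_geodesic \<Omega> x y g"
proof -
  define k where "k = qd x y"
  have k0: "0 \<le> k" using qh_dist_nonneg[OF x y] by (simp add: k_def)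
  have "\<exists>h. h 0 = x \<and> h 1 = y \<and> h ` {0..1} \<subseteq> \<Omega> \<and>
      (\<forall>s\<in>{0..1}. \<forall>t\<in>{0..1}. rd (h s) (h t) \<le> (k + 1 / Suc n) * \<bar>s - t\<bar>)" for n
  proof -
    have "Inf ((\<lambda>g. length_on rd g 0 1) ` curves x y) < k + 1 / Suc n"
      using qh_dist_eq_Inf[of x y] by (simp add: k_def)
    then obtain g where g: "g \<in> curves x y" "length_on rd g 0 1 < k + 1 / Suc n"
      using curves_nonempty[OF x y] cInf_lessD[of "(\<lambda>g. length_on rd g 0 1) ` curves x y"] by blast
    obtain h where h: "h 0 = x" "h 1 = y" "h ` {0..1} \<subseteq> \<Omega>"
      "\<And>s t. s \<in> {0..1} \<Longrightarrow> t \<in> {0..1} \<Longrightarrow> rd (h s) (h t) \<le> length_on rd g 0 1 * \<bar>s - t\<bar>"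
      using proportional_param[OF g(1)] by metis
    have "rd (h s) (h t) \<le> (k + 1 / Suc n) * \<bar>s - t\<bar>" if "s \<in> {0..1}" "t \<in> {0..1}" for s t
      using h(4)[OF that] mult_right_mono[of "length_on rd g 0 1" "k + 1 / Suc n" "\<bar>s - t\<bar>"] g(2)
      by linarith
    then show ?thesis using h by blast
  qed
  then obtain H where H: "\<And>n. H n 0 = x" "\<And>n. H n 1 = y" "\<And>n. H n ` {0..1} \<subseteq> \<Omega>"
    "\<And>n s t. s \<in> {0..1} \<Longrightarrow> t \<in> {0..1} \<Longrightarrow> rd (H n s) (H n t) \<le> (k + 1 / Suc n) * \<bar>s - t\<bar>"
    by metis
  define B where "B = k + 1"
  have B: "0 < B" using k0 by (simp add: B_def)
  have HB: "rd (H n s) (H n t) \<le> B * \<bar>s - t\<bar>" if "s \<in> {0..1}" "t \<in> {0..1}" for n s t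
  proof -
    have "k + 1 / Suc n \<le> B" by (simp add: B_def)
    then show ?thesis using H(4)[OF that, of n] mult_right_mono[of "k + 1 / Suc n" B "\<bar>s - t\<bar>"]
      by linarith
  qed
  have Hdom: "H n t \<in> \<Omega>" if "t \<in> {0..1}" for n t using H(3) that by blast
  have rdB: "rd (H n s) (H n t) \<le> B" if "s \<in> {0..1}" "t \<in> {0..1}" for n s t
  proof -
    have "B * \<bar>s - t\<bar> \<le> B * 1" using B that by (intro mult_left_mono) auto
    then show ?thesis using HB[OF that, of n] by simp
  qed
  define D where "D = bdist \<Omega> x * exp B"
  have D: "0 < D" using bdist_pos[OF x] by (simp add: D_def)
  \<comment> \<open>The curves \<open>H n\<close> stay in a fixed compact subset of the domain, where they are uniformly Lipschitz.\<close>
  have up: "bdist \<Omega> (H n t) \<le> D" if "t \<in> {0..1}" for n t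
  proof -
    have "bdist \<Omega> (H n t) \<le> bdist \<Omega> x * exp (rd x (H n t))"
      by (rule bdist_le_ratio_dist[OF x Hdom[OF that]])
    also have "\<dots> \<le> D"
      unfolding D_def using rdB[of 0 t n] that H(1) bdist_nonneg by (intro mult_left_mono) auto
    finally show ?thesis .
  qed
  have low: "bdist \<Omega> x * exp (- B) \<le> bdist \<Omega> (H n t)" if "t \<in> {0..1}" for n t
  proof -
    have "bdist \<Omega> x \<le> bdist \<Omega> (H n t) * exp (rd (H n t) x)"
      by (rule bdist_le_ratio_dist[OF Hdom[OF that] x])
    also have "\<dots> \<le> bdist \<Omega> (H n t) * exp B"
      using rdB[of t 0 n] that H(1) bdist_nonneg by (intro mult_left_mono) auto
    finally show ?thesis by (simp add: exp_minus field_simps)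
  qed
  define C where "C = D * exp B * B"
  have C: "0 < C" using B D by (simp add: C_def)
  have lip: "dist (H n s) (H n t) \<le> C * \<bar>s - t\<bar>" if "s \<in> {0..1}" "t \<in> {0..1}" for n s t
  proof -
    define r where "r = rd (H n s) (H n t)"
    have r: "0 \<le> r" "r \<le> B" using ratio_dist_nonneg rdB that by (auto simp: r_def)
    have "exp r * (1 - r) \<le> exp r * exp (- r)"
      using exp_ge_add_one_self[of "- r"] by (intro mult_left_mono) auto
    then have "exp r - 1 \<le> exp r * r" by (simp add: algebra_simps flip: exp_add)
    also have "\<dots> \<le> exp B * r" using r by (intro mult_right_mono) auto
    also have "\<dots> \<le> exp B * (B * \<bar>s - t\<bar>)"
      unfolding r_def using HB[OF that, of n] by (intro mult_left_mono) auto
    finally have *: "exp r - 1 \<le> exp B * (B * \<bar>s - t\<bar>)" .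
    have "dist (H n s) (H n t) \<le> bdist \<Omega> (H n s) * (exp r - 1)"
      unfolding r_def by (rule dist_le_ratio_dist(1)[OF Hdom Hdom]) (use that in auto)
    also have "\<dots> \<le> D * (exp r - 1)" using up[OF that(1), of n] r by (intro mult_right_mono) auto
    also have "\<dots> \<le> D * (exp B * (B * \<bar>s - t\<bar>))" using * D by (intro mult_left_mono) auto
    finally show ?thesis by (simp add: C_def mult.assoc)
  qed
  have bnd: "norm (H n t) \<le> norm x + C" if "t \<in> {0..1}" for n t
  proof -
    have "dist (H n t) x \<le> C * \<bar>t - 0\<bar>" using lip[of t 0 n] that H(1) by simp
    also have "\<dots> \<le> C * 1" using C that by (intro mult_left_mono) auto
    finally show ?thesis using norm_triangle_ineq2[of "H n t" x] by (simp add: dist_norm)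
  qed
  obtain h k' where h: "continuous_on {0..1::real} h" and mono: "strict_mono (k' :: nat \<Rightarrow> nat)"
    and conv: "\<And>e. 0 < e \<Longrightarrow> \<exists>N. \<forall>n t. n \<ge> N \<and> t \<in> {0..1} \<longrightarrow> norm (H (k' n) t - h t) < e"
  proof (rule Arzela_Ascoli[of "{0..1::real}" H "norm x + C"])
    fix s e :: real assume s: "s \<in> {0..1}" and "0 < e"
    have "norm (H n s - H n t) < e" if "t \<in> {0..1}" "norm (s - t) < e / C" for n t
    proof -
      have "C * \<bar>s - t\<bar> < e" using that(2) C by (simp add: field_simps)
      then show ?thesis using lip[OF s that(1), of n] by (simp add: dist_norm)
    qed
    then show "\<exists>d>0. \<forall>n t. t \<in> {0..1} \<and> norm (s - t) < d \<longrightarrow> norm (H n s - H n t) < e"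
      using \<open>0 < e\<close> C by (intro exI[of _ "e / C"]) auto
  qed (use bnd in auto)
  have lim: "(\<lambda>n. H (k' n) t) \<longlonglongrightarrow> h t" if "t \<in> {0..1}" for t
  proof (rule LIMSEQ_I)
    fix e :: real assume "0 < e"
    from conv[OF this] that show "\<exists>N. \<forall>n\<ge>N. norm (H (k' n) t - h t) < e" by blast
  qed
  have hdom: "h t \<in> \<Omega>" if t: "t \<in> {0..1}" for t
  proof -
    have "h t \<in> closure \<Omega>"
      unfolding closure_sequential using Hdom[OF t] lim[OF t] by (intro exI[of _ "\<lambda>n. H (k' n) t"]) auto
    moreover have "bdist \<Omega> x * exp (- B) \<le> bdist \<Omega> (h t)"
    proof (rule LIMSEQ_le_const)
      show "(\<lambda>n. bdist \<Omega> (H (k' n) t)) \<longlonglongrightarrow> bdist \<Omega> (h t)"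
        unfolding bdist_def by (intro tendsto_intros lim[OF t])
    qed (use low[OF t] in auto)
    then have "0 < bdist \<Omega> (h t)" using bdist_pos[OF x] by (smt (verit) exp_gt_zero mult_pos_pos)
    then have "h t \<notin> frontier \<Omega>" by (auto simp: bdist_def)
    ultimately show ?thesis using interior_open[OF open_dom] by (auto simp: frontier_def)
  qed
  have "h 0 = x" "h 1 = y"
    using lim[of 0] lim[of 1] H(1,2) LIMSEQ_unique tendsto_const
    by (auto simp: LIMSEQ_const_iff)
  then have joins: "joins_in \<Omega> x y h"
    using h hdom by (auto simp: joins_in_def path_def path_image_def pathstart_def pathfinish_def)
  have rd_le: "rd (h s) (h t) \<le> k * (t - s)" if "0 \<le> s" "s \<le> t" "t \<le> 1" for s t
  proof (rule LIMSEQ_le)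
    have *: "s \<in> {0..1}" "t \<in> {0..1}" using that by auto
    have pos: "0 < bdist \<Omega> (h s)" "0 < bdist \<Omega> (h t)" using hdom * bdist_pos by auto
    have "0 \<le> dist (h s) (h t) / min (bdist \<Omega> (h s)) (bdist \<Omega> (h t))" using pos by simp
    then have "1 + dist (h s) (h t) / min (bdist \<Omega> (h s)) (bdist \<Omega> (h t)) \<noteq> 0" by linarith
    then show "(\<lambda>n. rd (H (k' n) s) (H (k' n) t)) \<longlonglongrightarrow> rd (h s) (h t)"
      unfolding ratio_dist_def bdist_def using pos
      by (intro tendsto_intros lim *) (auto simp: bdist_def min_def)
    have "(\<lambda>n. 1 / real (Suc (k' n))) \<longlonglongrightarrow> 0"
      using LIMSEQ_subseq_LIMSEQ[OF LIMSEQ_inverse_real_of_nat mono]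
      by (simp add: o_def inverse_eq_divide)
    then have "(\<lambda>n. (k + 1 / Suc (k' n)) * \<bar>s - t\<bar>) \<longlonglongrightarrow> (k + 0) * \<bar>s - t\<bar>"
      by (intro tendsto_intros)
    then show "(\<lambda>n. (k + 1 / Suc (k' n)) * \<bar>s - t\<bar>) \<longlonglongrightarrow> k * (t - s)" using that by simp
    show "\<exists>N. \<forall>n\<ge>N. rd (H (k' n) s) (H (k' n) t) \<le> (k + 1 / Suc (k' n)) * \<bar>s - t\<bar>"
      using H(4)[OF *] by blast
  qed
  have le: "r \<le> k * (1 - 0)" if "r \<in> partition_sums rd h 0 1" for r
    by (rule partition_sum_le_Lipschitz[OF that k0]) (use rd_le in auto)
  then have "bdd_above (partition_sums rd h 0 1)" by (rule bdd_aboveI)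
  then have "h \<in> curves x y" using joins by (simp add: curves_iff)
  moreover have "length_on rd h 0 1 \<le> k"
    unfolding length_on_def using le zero_in_partition_sums[of 0 1 rd h] by (intro cSup_least) auto
  ultimately have "qh_geodesic \<Omega> x y h"
    using qh_dist_le_length[of h x y] by (simp add: qh_geodesic_iff k_def)
  then show ?thesis by blast
qed

end

section \<open>Weights spread over a chain in a quasi-ultrametric\<close>

text \<open>
  Frink's chain inequality. Cut the chain at the edge where the partial sums pass half the total:
  by induction both parts have endpoints at distance at most the total, so has the edge, and the
  quasi-ultrametric inequality is applied only twice.
\<close>

lemma Frink_chain_inequality:
  fixes D :: "'b \<Rightarrow> 'b \<Rightarrow> real"
  assumes K: "1 \<le> K" "K\<^sup>2 \<le> 2" and nonneg: "\<And>a b. 0 \<le> D a b"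
    and quasi: "\<And>a b c. a \<in> X \<Longrightarrow> b \<in> X \<Longrightarrow> c \<in> X \<Longrightarrow> D a c \<le> K * max (D a b) (D b c)"
    and "0 < N" "\<And>i. i \<le> N \<Longrightarrow> f i \<in> X"
  shows "D (f 0) (f N) \<le> K\<^sup>2 * (\<Sum>i<N. D (f i) (f (Suc i)))"
  using assms(5,6)
proof (induction N arbitrary: f rule: less_induct)
  case (less N)
  define S where "S = (\<Sum>i<N. D (f i) (f (Suc i)))"
  have S0: "0 \<le> S" unfolding S_def by (intro sum_nonneg nonneg)
  let ?P = "{p. p < N \<and> (\<Sum>i<p. D (f i) (f (Suc i))) \<le> S / 2}"
  define p where "p = Max ?P"
  have "finite ?P" by simp
  have "0 \<in> ?P" using less.prems(1) S0 by simp
  then have "p \<in> ?P" unfolding p_def using Max_in[OF \<open>finite ?P\<close>] by blast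
  then have p: "p < N" "(\<Sum>i<p. D (f i) (f (Suc i))) \<le> S / 2" by auto
  have half: "D (f' 0) (f' n) \<le> S"
    if "0 < n" "n < N" "\<And>i. i \<le> n \<Longrightarrow> f' i \<in> X" "(\<Sum>i<n. D (f' i) (f' (Suc i))) \<le> S / 2" for f' n
  proof -
    have "D (f' 0) (f' n) \<le> K\<^sup>2 * (\<Sum>i<n. D (f' i) (f' (Suc i)))" by (rule less.IH) (use that in auto)
    also have "\<dots> \<le> 2 * (S / 2)" using K that(4) by (intro mult_mono sum_nonneg nonneg) auto
    finally show ?thesis by simp
  qed
  have mid: "D (f p) (f (Suc p)) \<le> S"
    unfolding S_def using p(1) nonneg by (intro member_le_sum[of p "{..<N}" "\<lambda>i. D (f i) (f (Suc i))"]) auto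
  have S_le: "S \<le> K * S" using K(1) S0 by (simp add: mult_right_le_one_le mult_le_cancel_right1)
  have right: "D (f p) (f N) \<le> K * S"
  proof (cases "Suc p = N")
    case True then show ?thesis using mid S_le by simp
  next
    case False
    then have pN: "Suc p < N" using p(1) by simp
    have "Suc p \<notin> ?P"
    proof
      assume "Suc p \<in> ?P"
      from Max_ge[OF \<open>finite ?P\<close> this] show False unfolding p_def[symmetric] by simp
    qed
    then have gt: "S / 2 < (\<Sum>i<Suc p. D (f i) (f (Suc i)))" using pN by simp
    have "S = (\<Sum>i<Suc p. D (f i) (f (Suc i))) + (\<Sum>i<N - Suc p. D (f (Suc p + i)) (f (Suc (Suc p + i))))"
      unfolding S_def using sum_lessThan_add[of "\<lambda>i. D (f i) (f (Suc i))" "Suc p" "N - Suc p"] pN by simp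
    then have "D (f (Suc p + 0)) (f (Suc p + (N - Suc p))) \<le> S"
      using gt less.prems(2) pN by (intro half[of "N - Suc p" "\<lambda>i. f (Suc p + i)"]) auto
    then have "D (f (Suc p)) (f N) \<le> S" using pN by simp
    then have "max (D (f p) (f (Suc p))) (D (f (Suc p)) (f N)) \<le> S" using mid by simp
    then have "K * max (D (f p) (f (Suc p))) (D (f (Suc p)) (f N)) \<le> K * S"
      using K(1) by (intro mult_left_mono) auto
    moreover have "f p \<in> X" "f (Suc p) \<in> X" "f N \<in> X" using less.prems(2) pN by auto
    ultimately show ?thesis using quasi by (meson order_trans)
  qed
  have "D (f 0) (f N) \<le> K * (K * S)"
  proof (cases "p = 0")
    case True
    have "K * S \<le> K * (K * S)" using S_le K(1) by (intro mult_left_mono) auto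
    then show ?thesis using right True by simp
  next
    case False
    have "D (f 0) (f p) \<le> S" using half[of p f] False p less.prems(2) by auto
    then have "max (D (f 0) (f p)) (D (f p) (f N)) \<le> K * S" using right S_le by simp
    then have "K * max (D (f 0) (f p)) (D (f p) (f N)) \<le> K * (K * S)"
      using K(1) by (intro mult_left_mono) auto
    moreover have "f 0 \<in> X" "f p \<in> X" "f N \<in> X" using less.prems(2) p(1) by auto
    ultimately show ?thesis using quasi by (meson order_trans)
  qed
  then show ?case by (simp add: S_def power2_eq_square mult.assoc)
qed

text \<open>
  A discrete Frostman measure. The chain metric \<open>\<phi>\<close> grows from \<open>0\<close> to at least \<open>D 0 N / K\<^sup>2\<close> along
  the chain; the increments of its running maximum are the weights. A set of small diameter can
  only carry little weight because the running maximum is attained by \<open>\<phi>\<close> at its points of increase.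
\<close>

lemma chain_weights_exist:
  fixes D :: "nat \<Rightarrow> nat \<Rightarrow> real"
  assumes K: "1 \<le> K" "K\<^sup>2 \<le> 2" and nonneg: "\<And>a b. 0 \<le> D a b"
    and quasi: "\<And>a b c. a \<le> N \<Longrightarrow> b \<le> N \<Longrightarrow> c \<le> N \<Longrightarrow> D a c \<le> K * max (D a b) (D b c)"
    and N: "0 < N"
  obtains \<nu> :: "nat \<Rightarrow> real" where "\<And>i. 0 \<le> \<nu> i" "D 0 N / 2 \<le> (\<Sum>i\<le>N. \<nu> i)"
    "\<And>S c. S \<subseteq> {..N} \<Longrightarrow> 0 \<le> c \<Longrightarrow> (\<And>i j. i \<in> S \<Longrightarrow> j \<in> S \<Longrightarrow> D i j \<le> c) \<Longrightarrow>
      (\<And>i. i \<in> S \<Longrightarrow> 0 < i \<Longrightarrow> D (i - 1) i \<le> c) \<Longrightarrow> sum \<nu> S \<le> 2 * c"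
proof -
  define chains where
    "chains i = {(\<Sum>l<m. D (f l) (f (Suc l))) |(m::nat) f. f 0 = 0 \<and> f m = i \<and> (\<forall>l\<le>m. f l \<le> N)}" for i
  define \<phi> where "\<phi> i = Inf (chains i)" for i
  have chainsI: "(\<Sum>l<m. D (f l) (f (Suc l))) \<in> chains i"
    if "f 0 = 0" "f m = i" "\<And>l. l \<le> m \<Longrightarrow> f l \<le> N" for m f i
    using that unfolding chains_def by blast
  have chains_nonneg: "0 \<le> s" if "s \<in> chains i" for s i
    using that nonneg unfolding chains_def by (auto intro!: sum_nonneg)
  then have bdd: "bdd_below (chains i)" for i by (rule bdd_belowI)
  have chains_ne: "chains i \<noteq> {}" if "i \<le> N" for i
  proof -
    have "(\<Sum>l<1. D (if l = 0 then 0 else i) (if Suc l = 0 then 0 else i)) \<in> chains i"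
      using that by (intro chainsI[of "\<lambda>l. if l = 0 then 0 else i" 1 i]) auto
    then show ?thesis by blast
  qed
  have \<phi>0: "\<phi> 0 \<le> 0"
    unfolding \<phi>_def using cInf_lower[OF _ bdd] chainsI[of "\<lambda>_. 0" 0 0] by fastforce
  have \<phi>_nonneg: "0 \<le> \<phi> i" if "i \<le> N" for i
    unfolding \<phi>_def using chains_nonneg chains_ne[OF that] by (intro cInf_greatest) auto
  have \<phi>_step: "\<phi> j \<le> \<phi> i + D i j" if "i \<le> N" "j \<le> N" for i j
  proof -
    have "\<phi> j - D i j \<le> s" if s: "s \<in> chains i" for s
    proof -
      obtain m f where f: "s = (\<Sum>l<m. D (f l) (f (Suc l)))" "f 0 = 0" "f m = i" "\<forall>l\<le>m. f l \<le> N"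
        using s unfolding chains_def by blast
      let ?f = "f(Suc m := j)"
      have "(\<Sum>l<Suc m. D (?f l) (?f (Suc l))) \<in> chains j"
        using f \<open>j \<le> N\<close> by (intro chainsI) auto
      moreover have "(\<Sum>l<Suc m. D (?f l) (?f (Suc l))) = s + D i j"
        unfolding f(1) using f(3) by (auto intro!: sum.cong)
      ultimately have "\<phi> j \<le> s + D i j" unfolding \<phi>_def using cInf_lower[OF _ bdd] by metis
      then show ?thesis by simp
    qed
    then have "\<phi> j - D i j \<le> \<phi> i" unfolding \<phi>_def[of i] using chains_ne[OF that(1)] by (intro cInf_greatest)
    then show ?thesis by simp
  qed
  have \<phi>N: "D 0 N / 2 \<le> \<phi> N"
    unfolding \<phi>_def
  proof (rule cInf_greatest)
    fix s assume "s \<in> chains N"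
    then obtain m f where f: "s = (\<Sum>l<m. D (f l) (f (Suc l)))" "f 0 = 0" "f m = N" "\<forall>l\<le>m. f l \<le> N"
      unfolding chains_def by blast
    then have "0 < m" using N by (cases m) auto
    have "D (f 0) (f m) \<le> K\<^sup>2 * s"
      unfolding f(1)
      by (rule Frink_chain_inequality[where X = "{..N}", OF K nonneg _ \<open>0 < m\<close>]) (use quasi f(4) in auto)
    also have "\<dots> \<le> 2 * s" using K chains_nonneg[OF \<open>s \<in> chains N\<close>] by (intro mult_right_mono) auto
    finally show "D 0 N / 2 \<le> s" using f by simp
  qed (use chains_ne in simp)
  define M where "M i = Max (\<phi> ` {..i})" for i
  define \<nu> where "\<nu> i = M i - M (i - 1)" for i
  have M_Suc: "M (Suc i) = max (\<phi> (Suc i)) (M i)" for i by (simp add: M_def atMost_Suc)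
  have M0: "M 0 = \<phi> 0" by (simp add: M_def)
  have \<phi>_le: "\<phi> i \<le> M i" for i by (simp add: M_def)
  have \<nu>_nonneg: "0 \<le> \<nu> i" for i
    unfolding \<nu>_def using M_Suc[of "i - 1"] by (cases i) auto
  have telescope: "(\<Sum>l\<in>{a<..b}. \<nu> l) = M b - M a" if "a \<le> b" for a b
    using that
  proof (induction b rule: dec_induct)
    case (step b)
    have "{a<..Suc b} = insert (Suc b) {a<..b}" using step by auto
    then show ?case using step by (simp add: \<nu>_def)
  qed simp
  have \<nu>0: "\<nu> 0 = 0" by (simp add: \<nu>_def)
  show thesis
  proof (rule that[OF \<nu>_nonneg])
    have "(\<Sum>i\<le>N. \<nu> i) = (\<Sum>i\<in>{0<..N}. \<nu> i)"
      by (rule sum.mono_neutral_right) (auto simp: \<nu>0)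
    then show "D 0 N / 2 \<le> (\<Sum>i\<le>N. \<nu> i)"
      using telescope[of 0 N] M0 \<phi>0 \<phi>N \<phi>_le[of N] by simp
  next
    fix S and c :: real
    assume S: "S \<subseteq> {..N}" "0 \<le> c" "\<And>i j. i \<in> S \<Longrightarrow> j \<in> S \<Longrightarrow> D i j \<le> c"
      "\<And>i. i \<in> S \<Longrightarrow> 0 < i \<Longrightarrow> D (i - 1) i \<le> c"
    define T where "T = {i \<in> S. \<nu> i \<noteq> 0}"
    have finT: "finite T" using S(1) finite_subset unfolding T_def by fastforce
    have sumT: "sum \<nu> S = sum \<nu> T"
      using S(1) finite_subset[OF S(1)] by (intro sum.mono_neutral_right) (auto simp: T_def)
    show "sum \<nu> S \<le> 2 * c"
    proof (cases "T = {}")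
      case False
      define a b where "a = Min T" and "b = Max T"
      have ab: "a \<in> T" "b \<in> T" "\<And>i. i \<in> T \<Longrightarrow> a \<le> i \<and> i \<le> b"
        using finT False by (auto simp: a_def b_def)
      then have abS: "a \<in> S" "b \<in> S" "a \<le> N" "b \<le> N" using S(1) by (auto simp: T_def)
      \<comment> \<open>\<open>\<nu> 0 = M 0 - M (0 - 1)\<close> vanishes because \<open>0 - 1 = 0\<close> on the naturals.\<close>
      have "0 < a" using ab(1) \<nu>0 by (cases a) (auto simp: T_def)
      have "0 < b" using ab(2) \<nu>0 by (cases b) (auto simp: T_def)
      have "sum \<nu> T \<le> (\<Sum>l\<in>{a - 1<..b}. \<nu> l)"
        using ab \<open>0 < a\<close> \<nu>_nonneg by (intro sum_mono2) fastforce+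
      also have "\<dots> = M b - M (a - 1)" using ab \<open>0 < a\<close> by (intro telescope) force
      also have "M b = \<phi> b"
        using M_Suc[of "b - 1"] \<open>0 < b\<close> ab(2) by (auto simp: T_def \<nu>_def max_def split: if_splits)
      finally have "sum \<nu> T \<le> \<phi> b - \<phi> (a - 1)" using \<phi>_le[of "a - 1"] by linarith
      moreover have "\<phi> b \<le> \<phi> a + D a b" using abS by (intro \<phi>_step)
      moreover have "\<phi> a \<le> \<phi> (a - 1) + D (a - 1) a" using abS by (intro \<phi>_step) auto
      moreover have "D a b \<le> c" "D (a - 1) a \<le> c" using S abS \<open>0 < a\<close> by auto
      ultimately show ?thesis using sumT by linarith
    qed (use sumT S(2) in simp)
  qed
qed

section \<open>Gromov products\<close>

context proper
begin

lemma qh_chain_on_path: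
  assumes "path g" "path_image g \<subseteq> \<Omega>"
  obtains N where "0 < N" "\<And>i. i < N \<Longrightarrow> qd (g (real i / real N)) (g (real (Suc i) / real N)) \<le> 1"
proof -
  obtain \<eta> where "\<eta> > 0" and \<eta>: "\<And>u v. u \<in> {0..1} \<Longrightarrow> v \<in> {0..1} \<Longrightarrow> \<bar>u - v\<bar> < \<eta> \<Longrightarrow> qd (g u) (g v) < 1"
    using path_uniformly_continuous_qh_dist[OF assms zero_less_one] by blast
  obtain N :: nat where N: "0 < N" "1 / N < \<eta>"
    using \<open>\<eta> > 0\<close> by (metis nat_approx_posE zero_less_Suc)
  show thesis
  proof (rule that[OF N(1)])
    fix i assume "i < N"
    then have "qd (g (real i / real N)) (g (real (Suc i) / real N)) < 1"
      using N by (intro \<eta>) (auto simp: field_simps)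
    then show "qd (g (real i / real N)) (g (real (Suc i) / real N)) \<le> 1" by simp
  qed
qed

text \<open>
  The Gromov product \<open>(a|b)\<^sub>w\<close>; in a tree it is the distance from \<open>w\<close> to the geodesic from \<open>a\<close> to \<open>b\<close>.
\<close>

definition gromov_product :: "'a \<Rightarrow> 'a \<Rightarrow> 'a \<Rightarrow> real" where
  "gromov_product w a b = (qd w a + qd w b - qd a b) / 2"

lemma gromov_product_commute: "gromov_product w a b = gromov_product w b a"
  by (simp add: gromov_product_def qh_dist_commute)

lemma gromov_product_on_geodesic:
  assumes "qh_geodesic \<Omega> a b g" "w \<in> path_image g"
  shows "gromov_product w a b = 0"
  using qh_geodesic_add[OF assms] by (simp add: gromov_product_def qh_dist_commute)

lemma gromov_product_le_dist_geodesic: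
  assumes "qh_geodesic \<Omega> a b g" "p \<in> path_image g" "w \<in> \<Omega>"
  shows "gromov_product w a b \<le> qd w p"
proof -
  have "joins_in \<Omega> a b g" using assms(1) by (auto simp: qh_geodesic_def)
  note jD = joins_inD[OF this]
  have "p \<in> \<Omega>" using assms jD by blast
  then show ?thesis
    using qh_geodesic_add[OF assms(1,2)] qh_dist_triangle[of w p a] qh_dist_triangle[of w p b]
      qh_dist_commute[of a p] assms jD by (simp add: gromov_product_def)
qed

end

locale hyperbolic =
  fixes \<Omega> :: "'a::euclidean_space set" and \<delta> :: real
  assumes hyperbolic: "gromov_hyperbolic_domain \<delta> \<Omega>" and \<delta>_nonneg: "0 \<le> \<delta>"
begin

sublocale proper \<Omega>
  using hyperbolic by unfold_locales (simp add: gromov_hyperbolic_domain_def)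

lemma thin_triangle:
  assumes "qh_geodesic \<Omega> x y f" "qh_geodesic \<Omega> y z g" "qh_geodesic \<Omega> z x h" "p \<in> path_image f"
  obtains q where "q \<in> path_image g \<union> path_image h" "qd p q \<le> \<delta>"
proof -
  have "x \<in> \<Omega>" "y \<in> \<Omega>" "z \<in> \<Omega>"
    using assms(1-3) unfolding qh_geodesic_def using joins_inD(6,7) by metis+
  then have "qh_cball \<Omega> p \<delta> \<inter> (path_image g \<union> path_image h) \<noteq> {}"
    using hyperbolic assms unfolding gromov_hyperbolic_domain_def by blast
  then show thesis using that by (auto simp: qh_cball_def qh_dist_commute)
qed

text \<open>
  Up to a constant, the Gromov product is the distance from the base point to a geodesic: some
  point of the geodesic is close to both other sides of the triangle with apex \<open>w\<close>.
\<close>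

lemma dist_geodesic_le_gromov_product:
  assumes g: "qh_geodesic \<Omega> a b g" and w: "w \<in> \<Omega>"
  obtains p where "p \<in> path_image g" "qd w p \<le> gromov_product w a b + 2 * \<delta> + 1"
proof -
  have j: "joins_in \<Omega> a b g" using g by (auto simp: qh_geodesic_def)
  note jD = joins_inD[OF j]
  obtain gb where gb: "qh_geodesic \<Omega> b w gb" using qh_geodesic_exists[OF jD(7) w] by blast
  obtain ga where ga: "qh_geodesic \<Omega> w a ga" using qh_geodesic_exists[OF w jD(6)] by blast
  have ends: "a \<in> path_image ga" "b \<in> path_image gb"
    using ga gb by (auto simp: qh_geodesic_def joins_in_def)
  obtain N where N: "0 < N" "\<And>i. i < N \<Longrightarrow> qd (g (real i / real N)) (g (real (Suc i) / real N)) \<le> 1"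
    using qh_chain_on_path[OF jD(1,2)] by blast
  let ?p = "\<lambda>i. g (real i / real N)"
  have pim: "?p i \<in> path_image g" if "i \<le> N" for i
    using that N(1) by (auto simp: path_image_def field_simps)
  have dom: "z \<in> \<Omega>" if "z \<in> path_image g \<union> path_image ga \<union> path_image gb" for z
    using that g ga gb qh_geodesic_in_dom by blast
  define near_b where "near_b i = (\<exists>q\<in>path_image gb. qd (?p i) q \<le> \<delta>)" for i
  have alt: "near_b i \<or> (\<exists>q\<in>path_image ga. qd (?p i) q \<le> \<delta>)" if i: "i \<le> N" for i
    using thin_triangle[OF g gb ga pim[OF i]] unfolding near_b_def by blast
  \<comment> \<open>Walk along the geodesic from \<open>a\<close> in steps of length at most one and stop just before the first
    point near the side \<open>gb\<close>; this point is still near the side \<open>ga\<close>.\<close>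
  have "\<exists>p\<in>path_image g. \<exists>q\<in>path_image ga. \<exists>q'\<in>path_image gb. qd p q \<le> \<delta> \<and> qd p q' \<le> \<delta> + 1"
  proof -
    have "near_b N" unfolding near_b_def using ends N(1) jD(4,7) \<delta>_nonneg by (intro bexI[of _ b]) auto
    then obtain i where i: "near_b i" "i \<le> N" "\<And>j. j < i \<Longrightarrow> \<not> near_b j"
      using exists_least_iff[of near_b] by (metis leI)
    obtain q' where q': "q' \<in> path_image gb" "qd (?p i) q' \<le> \<delta>" using i(1) by (auto simp: near_b_def)
    show ?thesis
    proof (cases i)
      case 0
      then show ?thesis
        using q' ends pim[of 0] jD(3,6) \<delta>_nonneg
        by (intro bexI[of _ "?p 0"] bexI[of _ a] bexI[of _ q']) auto
    next
      case (Suc l)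
      then obtain q where q: "q \<in> path_image ga" "qd (?p l) q \<le> \<delta>" using alt[of l] i by auto
      have "qd (?p l) q' \<le> qd (?p l) (?p i) + qd (?p i) q'"
        using dom pim[of l] pim[of i] q' Suc i(2) by (intro qh_dist_triangle) auto
      then have "qd (?p l) q' \<le> \<delta> + 1" using N(2)[of l] Suc i(2) q' by auto
      then show ?thesis using q q' pim[of l] Suc i(2) by (metis Suc_leD)
    qed
  qed
  then obtain p q q' where p: "p \<in> path_image g" and q: "q \<in> path_image ga" "qd p q \<le> \<delta>"
    and q': "q' \<in> path_image gb" "qd p q' \<le> \<delta> + 1" by blast
  have d: "p \<in> \<Omega>" "q \<in> \<Omega>" "q' \<in> \<Omega>" using dom p q q' by auto
  have "qd w p \<le> qd w q + \<delta>" "qd p a \<le> \<delta> + qd q a"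
    using qh_dist_triangle[of w q p] qh_dist_triangle[of p q a] d w jD q qh_dist_commute[of q p] by auto
  moreover have "qd w p \<le> qd w q' + (\<delta> + 1)" "qd p b \<le> (\<delta> + 1) + qd q' b"
    using qh_dist_triangle[of w q' p] qh_dist_triangle[of p q' b] d w jD q' qh_dist_commute[of q' p] by auto
  moreover have "qd w q + qd q a = qd w a" using qh_geodesic_add[OF ga q(1)] .
  moreover have "qd b q' + qd q' w = qd b w" using qh_geodesic_add[OF gb q'(1)] .
  moreover have "qd a p + qd p b = qd a b" using qh_geodesic_add[OF g p] .
  ultimately have "qd w p \<le> gromov_product w a b + 2 * \<delta> + 1"
    unfolding gromov_product_def
    using qh_dist_commute[of a p] qh_dist_commute[of b q'] qh_dist_commute[of q' w]
      qh_dist_commute[of b w] by (simp add: field_simps)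
  then show thesis using p that by blast
qed

text \<open>
  A point of the geodesic from \<open>a\<close> to \<open>c\<close> that almost realizes \<open>gromov_product w a c\<close> is close to
  one of the other two sides, whose distance from \<open>w\<close> bounds the corresponding product from above.
\<close>

lemma gromov_product_quasi_ultrametric:
  assumes "a \<in> \<Omega>" "b \<in> \<Omega>" "c \<in> \<Omega>" "w \<in> \<Omega>"
  shows "min (gromov_product w a b) (gromov_product w b c) \<le> gromov_product w a c + (3 * \<delta> + 1)"
proof -
  obtain f g h where f: "qh_geodesic \<Omega> a c f" and g: "qh_geodesic \<Omega> c b g" and h: "qh_geodesic \<Omega> b a h"
    using qh_geodesic_exists assms by metis
  obtain p where p: "p \<in> path_image f" "qd w p \<le> gromov_product w a c + 2 * \<delta> + 1"
    using dist_geodesic_le_gromov_product[OF f assms(4)] by blast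
  obtain q where q: "q \<in> path_image g \<union> path_image h" "qd p q \<le> \<delta>"
    using thin_triangle[OF f g h p(1)] by blast
  have "p \<in> \<Omega>" "q \<in> \<Omega>" using p q f g h qh_geodesic_in_dom by blast+
  then have "qd w q \<le> qd w p + \<delta>" using qh_dist_triangle[of w p q] assms q by simp
  moreover have "gromov_product w c b \<le> qd w q \<or> gromov_product w b a \<le> qd w q"
    using gromov_product_le_dist_geodesic[OF g _ assms(4)] gromov_product_le_dist_geodesic[OF h _ assms(4)] q by blast
  ultimately show ?thesis using p(2) gromov_product_commute[of w a b] gromov_product_commute[of w b c] by linarith
qed

end

section \<open>Volume of separated sets\<close>

text \<open>
  Disjoint balls inside a ball of radius \<open>R\<close> have total volume at most that of the large ball.
\<close>

lemma sum_radius_power_le: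
  fixes x :: "'a::euclidean_space" and \<rho> :: "'a \<Rightarrow> real"
  assumes "finite Z" and pos: "\<And>q. q \<in> Z \<Longrightarrow> 0 \<le> \<rho> q"
    and disj: "\<And>p q. p \<in> Z \<Longrightarrow> q \<in> Z \<Longrightarrow> p \<noteq> q \<Longrightarrow> \<rho> p + \<rho> q \<le> dist p q"
    and sub: "\<And>q. q \<in> Z \<Longrightarrow> dist q x + \<rho> q \<le> R" and "0 \<le> R"
  shows "(\<Sum>q\<in>Z. \<rho> q ^ DIM('a)) \<le> R ^ DIM('a)"
proof -
  let ?v = "unit_ball_vol (real DIM('a))"
  have v: "0 < ?v" by (intro unit_ball_vol_pos) simp
  have "disjoint_family_on (\<lambda>q. ball q (\<rho> q)) Z"
    unfolding disjoint_family_on_def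
  proof (intro ballI impI)
    fix p q assume "p \<in> Z" "q \<in> Z" "p \<noteq> q"
    then have "\<rho> p + \<rho> q \<le> dist p q" by (rule disj)
    then show "ball p (\<rho> p) \<inter> ball q (\<rho> q) = {}" by (rule disjoint_ballI)
  qed
  then have "measure lborel (\<Union>q\<in>Z. ball q (\<rho> q)) = (\<Sum>q\<in>Z. measure lborel (ball q (\<rho> q)))"
    using \<open>finite Z\<close> emeasure_lborel_ball_finite
    by (intro measure_finite_Union) (auto simp: less_top[symmetric])
  moreover have "measure lborel (\<Union>q\<in>Z. ball q (\<rho> q)) \<le> measure lborel (ball x R)"
  proof (rule measure_mono_fmeasurable)
    show "(\<Union>q\<in>Z. ball q (\<rho> q)) \<subseteq> ball x R"
    proof (intro UN_least subsetI)
      fix q z assume "q \<in> Z" "z \<in> ball q (\<rho> q)"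
      then show "z \<in> ball x R"
        using sub[of q] dist_triangle[of x z q] by (auto simp: dist_commute)
    qed
    show "(\<Union>q\<in>Z. ball q (\<rho> q)) \<in> sets lborel" by (simp add: borel_open open_UN)
    show "ball x R \<in> fmeasurable lborel"
      using emeasure_lborel_ball_finite[of x R] by (intro fmeasurableI) auto
  qed
  ultimately have "(\<Sum>q\<in>Z. ?v * \<rho> q ^ DIM('a)) \<le> ?v * R ^ DIM('a)"
    using pos \<open>0 \<le> R\<close> by (simp add: content_ball)
  then show ?thesis using v by (simp flip: sum_distrib_left)
qed

lemma maximal_separated_subset:
  fixes d :: "'b \<Rightarrow> 'b \<Rightarrow> real"
  assumes "finite Q" and refl: "\<And>p. p \<in> Q \<Longrightarrow> d p p = 0" and sym: "\<And>p q. d p q = d q p"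
  shows "\<exists>Z\<subseteq>Q. (\<forall>p\<in>Z. \<forall>q\<in>Z. p \<noteq> q \<longrightarrow> 1 \<le> d p q) \<and> (\<forall>p\<in>Q. \<exists>q\<in>Z. d p q < 1)"
  using assms(1,2)
proof (induction Q rule: finite_induct)
  case (insert p Q)
  then obtain Z where Z: "Z \<subseteq> Q" "\<forall>p\<in>Z. \<forall>q\<in>Z. p \<noteq> q \<longrightarrow> 1 \<le> d p q" "\<forall>p\<in>Q. \<exists>q\<in>Z. d p q < 1"
    by (metis insertCI)
  show ?case
  proof (cases "\<exists>q\<in>Z. d p q < 1")
    case True
    then show ?thesis using Z by (intro exI[of _ Z]) auto
  next
    case False
    then have "\<forall>q\<in>Z. 1 \<le> d p q \<and> 1 \<le> d q p" using sym[of p] by force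
    then show ?thesis using Z insert.prems by (intro exI[of _ "insert p Z"]) force
  qed
qed auto

context proper
begin

lemma qh_dist_ge_1_imp:
  assumes "p \<in> \<Omega>" "q \<in> \<Omega>" "1 \<le> qd p q"
  shows "bdist \<Omega> p / 4 + bdist \<Omega> q / 4 \<le> dist p q"
proof -
  have *: "bdist \<Omega> p / 2 \<le> dist p q" if "p \<in> \<Omega>" "1 \<le> qd p q" for p q
  proof (rule ccontr)
    assume "\<not> bdist \<Omega> p / 2 \<le> dist p q"
    then have "qd p q \<le> 2 * dist p q / bdist \<Omega> p" "2 * dist p q / bdist \<Omega> p < 1"
      using qh_dist_le_dist(2)[of p q] that bdist_pos[of p] by auto
    then show False using that by simp
  qed
  show ?thesis
    using *[of p q] *[of q p] assms qh_dist_commute[of p q] by (simp add: dist_commute)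
qed

text \<open>
  The Euclidean size of a quasihyperbolic unit ball at \<open>z\<close>, up to a constant, relative to the
  distance from \<open>x\<close>, which is cut off at scale \<open>r\<close>.
\<close>

definition relative_size :: "'a \<Rightarrow> real \<Rightarrow> 'a \<Rightarrow> real" where
  "relative_size x r z = bdist \<Omega> z / (dist z x + r)"

lemma relative_size_nonneg: "0 \<le> r \<Longrightarrow> 0 \<le> relative_size x r z"
  by (simp add: relative_size_def bdist_nonneg)

text \<open>
  When \<open>bdist \<Omega> x\<close> is at most \<open>2 * r\<close> relative sizes are bounded, and they satisfy a Harnack
  inequality at quasihyperbolic scale one.
\<close>

lemma bdist_le_two: "bdist \<Omega> x \<le> 2 * r \<Longrightarrow> bdist \<Omega> z \<le> 2 * (dist z x + r)"
  using bdist_Lipschitz[of z x] zero_le_dist[of z x] unfolding distrib_left by linarith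

lemma relative_size_le_2: "bdist \<Omega> x \<le> 2 * r \<Longrightarrow> 0 < r \<Longrightarrow> relative_size x r z \<le> 2"
  using bdist_le_two[of x r z] by (simp add: relative_size_def add_nonneg_pos pos_divide_le_eq)

lemma dist_le_if_qh_dist_le_1:
  assumes "p \<in> \<Omega>" "q \<in> \<Omega>" "qd p q \<le> 1"
  shows "dist p q \<le> 2 * bdist \<Omega> p" "bdist \<Omega> p \<le> 3 * bdist \<Omega> q"
proof -
  have rd: "rd p q \<le> 1" using ratio_dist_le_qh_dist[OF assms(1,2)] assms(3) by simp
  then have e: "exp (rd p q) \<le> 3" using exp_le by (smt (verit) exp_le_cancel_iff)
  have "dist p q \<le> bdist \<Omega> p * (exp (rd p q) - 1)" by (rule dist_le_ratio_dist(1)[OF assms(1,2)])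
  also have "\<dots> \<le> bdist \<Omega> p * 2" using e bdist_nonneg by (intro mult_left_mono) auto
  finally show "dist p q \<le> 2 * bdist \<Omega> p" by simp
  have "bdist \<Omega> p \<le> bdist \<Omega> q * exp (rd q p)" by (rule bdist_le_ratio_dist[OF assms(2,1)])
  also have "\<dots> \<le> bdist \<Omega> q * 3"
    using e bdist_nonneg ratio_dist_commute[of p q] by (intro mult_left_mono) auto
  finally show "bdist \<Omega> p \<le> 3 * bdist \<Omega> q" by simp
qed

lemma relative_size_Harnack:
  assumes "p \<in> \<Omega>" "q \<in> \<Omega>" "qd p q \<le> 1" "bdist \<Omega> x \<le> 2 * r" "0 < r"
  shows "relative_size x r p \<le> 15 * relative_size x r q"
proof -
  have "dist q x + r \<le> dist p x + r + dist p q" using dist_triangle[of q x p] by (simp add: dist_commute)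
  also have "\<dots> \<le> 5 * (dist p x + r)"
    using dist_le_if_qh_dist_le_1(1)[OF assms(1-3)] bdist_le_two[OF assms(4), of p]
    unfolding distrib_left by linarith
  finally have D: "dist q x + r \<le> 5 * (dist p x + r)" .
  have pos: "0 < dist q x + r" "0 < dist p x + r" using assms(5) by (auto intro: add_nonneg_pos)
  have "bdist \<Omega> p / (dist p x + r) \<le> 3 * bdist \<Omega> q / (dist p x + r)"
    using dist_le_if_qh_dist_le_1(2)[OF assms(1-3)] pos by (intro divide_right_mono) auto
  also have "\<dots> = 15 * bdist \<Omega> q / (5 * (dist p x + r))"
    using mult_divide_mult_cancel_left[of 5 "3 * bdist \<Omega> q" "dist p x + r"] by simp
  also have "\<dots> \<le> 15 * bdist \<Omega> q / (dist q x + r)"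
    using D pos bdist_nonneg by (intro divide_left_mono mult_pos_pos) auto
  finally show ?thesis by (simp add: relative_size_def)
qed

text \<open>
  Each dyadic shell about \<open>x\<close> contributes a bounded amount, by comparing volumes: the balls of
  radius a quarter of the distance to the boundary are disjoint.
\<close>

lemma sum_relative_size_power_le:
  assumes Z: "finite Z" "Z \<subseteq> \<Omega>" and sep: "\<And>p q. p \<in> Z \<Longrightarrow> q \<in> Z \<Longrightarrow> p \<noteq> q \<Longrightarrow> 1 \<le> qd p q"
    and "0 < r" "bdist \<Omega> x \<le> 2 * r" and L: "\<And>q. q \<in> Z \<Longrightarrow> dist q x + r < 2 ^ L * r"
  shows "(\<Sum>q\<in>Z. relative_size x r q ^ DIM('a)) \<le> L * 12 ^ DIM('a)"
proof -
  define idx where "idx q = (LEAST l. dist q x + r < 2 ^ Suc l * r)" for q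
  have idx: "idx q < L" "2 ^ idx q * r \<le> dist q x + r" "dist q x + r < 2 ^ Suc (idx q) * r" if "q \<in> Z" for q
  proof -
    have "L \<noteq> 0" using L[OF that] by (cases L) auto
    then obtain L' where L': "L = Suc L'" using not0_implies_Suc by blast
    then have ex: "dist q x + r < 2 ^ Suc L' * r" using L[OF that] by simp
    show "dist q x + r < 2 ^ Suc (idx q) * r" unfolding idx_def by (rule LeastI) (rule ex)
    show "idx q < L" unfolding idx_def L' using Least_le[of _ L'] ex by (metis (lifting) le_imp_less_Suc)
    show "2 ^ idx q * r \<le> dist q x + r"
    proof (cases "idx q")
      case (Suc l)
      then have "\<not> dist q x + r < 2 ^ Suc l * r" using not_less_Least[of l "\<lambda>l. dist q x + r < 2 ^ Suc l * r"]
        by (simp add: idx_def)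
      then show ?thesis using Suc by simp
    qed simp
  qed
  have shell: "(\<Sum>q\<in>{q\<in>Z. idx q = l}. relative_size x r q ^ DIM('a)) \<le> 12 ^ DIM('a)" for l
  proof -
    let ?Y = "{q\<in>Z. idx q = l}"
    have pos: "0 < 2 ^ l * r" using \<open>0 < r\<close> by simp
    have vol: "(\<Sum>q\<in>?Y. (bdist \<Omega> q / 4) ^ DIM('a)) \<le> (3 * (2 ^ l * r)) ^ DIM('a)"
    proof (rule sum_radius_power_le)
      fix p q assume "p \<in> ?Y" "q \<in> ?Y" "p \<noteq> q"
      then show "bdist \<Omega> p / 4 + bdist \<Omega> q / 4 \<le> dist p q"
        using sep[of p q] Z by (intro qh_dist_ge_1_imp) auto
    next
      fix q assume "q \<in> ?Y"
      then show "dist q x + bdist \<Omega> q / 4 \<le> 3 * (2 ^ l * r)"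
        using idx(3)[of q] bdist_le_two[OF assms(5), of q] \<open>0 < r\<close> by auto
    qed (use Z pos bdist_nonneg in auto)
    have "relative_size x r q ^ DIM('a) * ((2 ^ l * r) / 4) ^ DIM('a) \<le> (bdist \<Omega> q / 4) ^ DIM('a)"
      if "q \<in> ?Y" for q
    proof -
      have "relative_size x r q * (2 ^ l * r) \<le> relative_size x r q * (dist q x + r)"
        using that idx(2)[of q] relative_size_nonneg[of r x q] \<open>0 < r\<close> by (intro mult_left_mono) auto
      also have "\<dots> = bdist \<Omega> q"
        using \<open>0 < r\<close> by (simp add: relative_size_def add_nonneg_eq_0_iff)
      finally show ?thesis
        using relative_size_nonneg[of r x q] pos \<open>0 < r\<close>
        by (subst power_mult_distrib[symmetric]) (auto intro!: power_mono)
    qed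
    then have le: "(\<Sum>q\<in>?Y. relative_size x r q ^ DIM('a) * ((2 ^ l * r) / 4) ^ DIM('a))
        \<le> (\<Sum>q\<in>?Y. (bdist \<Omega> q / 4) ^ DIM('a))" by (rule sum_mono)
    have "(\<Sum>q\<in>?Y. relative_size x r q ^ DIM('a)) * ((2 ^ l * r) / 4) ^ DIM('a)
        = (\<Sum>q\<in>?Y. relative_size x r q ^ DIM('a) * ((2 ^ l * r) / 4) ^ DIM('a))"
      by (rule sum_distrib_right)
    also note le
    also note vol
    also have "3 * (2 ^ l * r) = 12 * ((2 ^ l * r) / 4)" by simp
    finally have "(\<Sum>q\<in>?Y. relative_size x r q ^ DIM('a)) * ((2 ^ l * r) / 4) ^ DIM('a)
        \<le> (12 * ((2 ^ l * r) / 4)) ^ DIM('a)" .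
    then show ?thesis using pos unfolding power_mult_distrib[of 12]
      by (subst (asm) mult_le_cancel_right_pos) auto
  qed
  have "(\<Sum>q\<in>Z. relative_size x r q ^ DIM('a))
      = (\<Sum>l\<in>{..<L}. \<Sum>q\<in>{q\<in>Z. idx q = l}. relative_size x r q ^ DIM('a))"
    using Z idx(1) by (intro sum.group[symmetric]) auto
  also have "\<dots> \<le> (\<Sum>l\<in>{..<L}. 12 ^ DIM('a))" by (intro sum_mono shell)
  finally show ?thesis by simp
qed

section \<open>Geodesics issuing from a far point\<close>

text \<open>
  Marks at distances \<open>0, 1, 2, \<dots>\<close> from \<open>w\<close> along a geodesic; all marks from number
  \<open>nat \<lceil>qd w b\<rceil>\<close> on are the endpoint \<open>b\<close>.
\<close>

lemma geodesic_unit_steps: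
  assumes w: "w \<in> \<Omega>" and b: "b \<in> \<Omega>"
  shows "\<exists>z::nat \<Rightarrow> 'a. z 0 = w \<and> z (nat \<lceil>qd w b\<rceil>) = b \<and>
    (\<forall>m. z m \<in> \<Omega> \<and> qd w (z m) = min (real m) (qd w b) \<and>
      qd w (z m) + qd (z m) b = qd w b \<and> qd (z m) (z (Suc m)) \<le> 1)"
proof -
  obtain g where g: "qh_geodesic \<Omega> w b g" using qh_geodesic_exists[OF w b] by blast
  have nn: "0 \<le> qd w b" by (rule qh_dist_nonneg[OF w b])
  have "\<exists>z\<in>path_image g. qd w z = min (real m) (qd w b)" for m :: nat
    using nn by (intro qh_geodesic_point_at[OF g]) auto
  then obtain z where z: "\<And>m. z m \<in> path_image g" "\<And>m. qd w (z m) = min (real m) (qd w b)"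
    by metis
  have dom: "z m \<in> \<Omega>" for m using qh_geodesic_in_dom[OF g z(1)] .
  have add: "qd w (z m) + qd (z m) b = qd w b" for m using qh_geodesic_add[OF g z(1)] .
  have eqI: "p = q" if "p \<in> \<Omega>" "q \<in> \<Omega>" "qd p q \<le> 0" for p q
  proof -
    have "rd p q = 0" using ratio_dist_le_qh_dist[OF that(1,2)] that(3) ratio_dist_nonneg[of p q] by linarith
    then show ?thesis using ratio.zero that by blast
  qed
  have "z 0 = w" using z(2)[of 0] nn by (intro eqI[symmetric] w dom) simp
  moreover have "z (nat \<lceil>qd w b\<rceil>) = b"
  proof (rule eqI[OF dom b])
    have "qd w b \<le> real (nat \<lceil>qd w b\<rceil>)" by (rule real_nat_ceiling_ge)
    then show "qd (z (nat \<lceil>qd w b\<rceil>)) b \<le> 0" using add[of "nat \<lceil>qd w b\<rceil>"] z(2)[of "nat \<lceil>qd w b\<rceil>"] by simp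
  qed
  moreover have "qd (z m) (z (Suc m)) \<le> 1" for m
    using qh_dist_on_geodesic[OF g z(1)[of m] z(1)[of "Suc m"]] z(2)[of m] z(2)[of "Suc m"] by linarith
  ultimately show ?thesis using dom z(2) add by (intro exI[of _ z]) auto
qed

text \<open>
  A step of quasihyperbolic length one away from \<open>z\<close> moves by at most \<open>2 * bdist z\<close>, and so it
  raises \<open>ln (dist z x + r)\<close> by at most twice the relative size at \<open>z\<close>. Truncating the logarithm
  at \<open>dist w x\<close> makes the points beyond that distance irrelevant.
\<close>

lemma log_ratio_le_sum_relative_size:
  assumes dom: "\<And>m. z m \<in> \<Omega>" and step: "\<And>m. qd (z m) (z (Suc m)) \<le> 1"
    and "0 < r" and w: "z 0 = w" and l: "dist (z l) x \<le> r" and R: "r \<le> dist w x"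
  shows "ln ((dist w x + r) / (2 * r))
    \<le> 2 * (\<Sum>m\<in>{m. m \<le> l \<and> dist (z m) x < dist w x}. relative_size x r (z m))"
proof -
  define R where "R = dist w x"
  define u where "u p = ln (min (dist p x) R + r)" for p
  define G where "G p = (if dist p x < R then relative_size x r p else 0)" for p
  have R0: "0 < R" using assms(3) R unfolding R_def by linarith
  have ppos: "0 < min (dist p x) R + r" for p using \<open>0 < r\<close> R0 by (intro add_nonneg_pos) auto
  have Gnn: "0 \<le> G p" for p using relative_size_nonneg[of r x p] \<open>0 < r\<close> by (auto simp: G_def)
  have incr: "u (z m) \<le> u (z (Suc m)) + 2 * G (z (Suc m))" for m
  proof (cases "dist (z (Suc m)) x < R")
    case False
    then have "u (z m) \<le> u (z (Suc m))" unfolding u_def using ppos[of "z m"] by (intro ln_mono) auto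
    then show ?thesis using Gnn[of "z (Suc m)"] by simp
  next
    case True
    let ?p = "z (Suc m)" and ?q = "z m"
    have D: "0 < dist ?p x + r" using \<open>0 < r\<close> by (simp add: add_nonneg_pos)
    have "dist ?p ?q \<le> 2 * bdist \<Omega> ?p"
      using dist_le_if_qh_dist_le_1(1)[OF dom dom] step[of m] by (simp add: qh_dist_commute)
    then have "min (dist ?q x) R + r \<le> dist ?p x + r + 2 * bdist \<Omega> ?p"
      using dist_triangle[of ?q x ?p] by (auto simp: dist_commute min_def)
    also have "\<dots> = (dist ?p x + r) * (1 + 2 * relative_size x r ?p)"
      using D by (simp add: relative_size_def field_simps)
    finally have "u ?q \<le> ln ((dist ?p x + r) * (1 + 2 * relative_size x r ?p))"
      unfolding u_def using ppos by (intro ln_mono) auto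
    also have "\<dots> = ln (dist ?p x + r) + ln (1 + 2 * relative_size x r ?p)"
      using D relative_size_nonneg[of r x ?p] \<open>0 < r\<close> by (intro ln_mult_pos) auto
    also have "ln (1 + 2 * relative_size x r ?p) \<le> 2 * relative_size x r ?p"
      using relative_size_nonneg[of r x ?p] \<open>0 < r\<close> by (intro ln_add_one_self_le_self) auto
    finally show ?thesis using True by (simp add: u_def G_def)
  qed
  have "u (z 0) \<le> u (z l) + 2 * (\<Sum>m\<in>{1..l}. G (z m))"
  proof (induction l)
    case (Suc l)
    then show ?case using incr[of l] by simp
  qed simp
  also have "(\<Sum>m\<in>{1..l}. G (z m)) \<le> (\<Sum>m\<in>{..l}. G (z m))"
    using Gnn by (intro sum_mono2) auto
  also have "(\<Sum>m\<in>{..l}. G (z m)) = (\<Sum>m\<in>{m. m \<le> l \<and> dist (z m) x < R}. relative_size x r (z m))"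
    unfolding G_def by (subst sum.inter_filter[symmetric]) (auto intro: sum.cong)
  finally have "u (z 0) \<le> u (z l) + 2 * (\<Sum>m\<in>{m. m \<le> l \<and> dist (z m) x < R}. relative_size x r (z m))"
    by simp
  moreover have "u (z 0) = ln (R + r)" by (simp add: u_def w R_def)
  moreover have "u (z l) \<le> ln (2 * r)"
    unfolding u_def using ppos[of "z l"] l by (intro ln_mono) auto
  moreover have "ln ((R + r) / (2 * r)) = ln (R + r) - ln (2 * r)"
    using \<open>0 < r\<close> R0 by (intro ln_divide_pos) auto
  ultimately show ?thesis by (simp add: R_def)
qed

end

section \<open>A curve with small diameter cannot pull the geodesic far away\<close>

text \<open>
  Chosen so that the visual quasi-metric with this exponent has quasi-ultrametric constant \<open>sqrt 2\<close>,
  the largest one for which the chain inequality above applies.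
\<close>

definition visual_exponent :: "real \<Rightarrow> real" where
  "visual_exponent \<delta> = ln 2 / (2 * (3 * \<delta> + 1))"

lemma visual_exponent:
  assumes "0 \<le> \<delta>"
  shows "0 < visual_exponent \<delta>" "(exp (visual_exponent \<delta> * (3 * \<delta> + 1)))\<^sup>2 = 2"
proof -
  show "0 < visual_exponent \<delta>" using assms by (simp add: visual_exponent_def)
  have "visual_exponent \<delta> * (3 * \<delta> + 1) = ln 2 / 2"
  proof -
    have "3 * \<delta> + 1 \<noteq> 0" using assms by simp
    then show ?thesis unfolding visual_exponent_def by (metis nonzero_mult_divide_mult_cancel_right times_divide_eq_left)
  qed
  then have "2 * (visual_exponent \<delta> * (3 * \<delta> + 1)) = ln 2" by simp
  then show "(exp (visual_exponent \<delta> * (3 * \<delta> + 1)))\<^sup>2 = 2" by (simp flip: exp_double)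
qed

text \<open>
  Below the threshold \<open>\<mu>\<close> the first summand suffices, above it the second.
\<close>

lemma Young_threshold:
  fixes t \<mu> :: real
  assumes "0 \<le> t" "0 < \<mu>"
  shows "t \<le> \<mu> + t ^ Suc n / \<mu> ^ n"
proof (cases "t \<le> \<mu>")
  case True
  then show ?thesis using assms by (simp add: add_increasing2)
next
  case False
  then have "\<mu> ^ n \<le> t ^ n" using assms by (intro power_mono) auto
  then have "t * \<mu> ^ n \<le> t * t ^ n" using assms by (intro mult_left_mono) auto
  then have "t \<le> t ^ Suc n / \<mu> ^ n" using assms by (simp add: pos_le_divide_eq)
  then show ?thesis using assms by simp
qed

lemma geometric_sum_le:
  fixes c :: real
  assumes "0 < c" "finite F"
  shows "(\<Sum>m\<in>F. exp (- (c * real m))) \<le> 1 / (1 - exp (- c))"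
proof -
  have *: "exp (- (c * real m)) = exp (- c) ^ m" for m
    by (metis exp_of_nat_mult mult.commute mult_minus_right)
  have "norm (exp (- c)) < 1" using assms by simp
  then show ?thesis
    unfolding * using sum_le_suminf[OF summable_geometric assms(2), of "exp (- c)"]
      suminf_geometric[of "exp (- c)"] by simp
qed

text \<open>
  The product of \<open>2 * 15 ^ Suc n\<close> from the Harnack inequality and the bound \<open>2\<close> for relative sizes,
  \<open>3\<close> for the number of marks on one geodesic near a given point, \<open>2 * exp (4 * \<epsilon>)\<close> from the weight
  of a shadow measured against the threshold, and \<open>12 ^ n\<close> from the volume of a dyadic shell.
\<close>

definition volume_const :: "real \<Rightarrow> nat \<Rightarrow> real" where
  "volume_const \<epsilon> n = 12 * 15 ^ Suc n * exp (4 * \<epsilon>) * 12 ^ n"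

definition log_bound :: "real \<Rightarrow> nat \<Rightarrow> real" where
  "log_bound \<delta> n = (let \<epsilon> = visual_exponent \<delta> in
     64 * volume_const \<epsilon> n * (1 / (1 - exp (- (\<epsilon> / n)))) + 1)"

context hyperbolic
begin

text \<open>
  Since \<open>w\<close> lies between the ends of the chain, these are at distance one in the visual quasi-metric
  \<open>exp (- (\<epsilon> * gromov_product w a b))\<close>, and the chain carries weights of total mass at least one half.
  The shadow of \<open>q\<close> consists of the chain points with a geodesic to \<open>w\<close> that passes near \<open>q\<close>; any two
  of them have Gromov product at least \<open>qd w q - 2\<close>, so the shadow has small visual diameter and
  small weight.
\<close>

lemma shadow_weights_exist:
  fixes b :: "nat \<Rightarrow> 'a"
  defines "\<epsilon> \<equiv> visual_exponent \<delta>"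
  assumes w: "w \<in> \<Omega>" and b: "\<And>i. i \<le> N \<Longrightarrow> b i \<in> \<Omega>"
    and step: "\<And>i. i < N \<Longrightarrow> qd (b i) (b (Suc i)) \<le> 1"
    and between: "gromov_product w (b 0) (b N) = 0" and "0 < N"
  obtains \<nu> :: "nat \<Rightarrow> real" where "\<And>i. 0 \<le> \<nu> i" "1 / 2 \<le> (\<Sum>i\<le>N. \<nu> i)"
    "\<And>S q. S \<subseteq> {..N} \<Longrightarrow> q \<in> \<Omega> \<Longrightarrow>
      (\<And>i. i \<in> S \<Longrightarrow> \<exists>z\<in>\<Omega>. qd z q \<le> 1 \<and> qd w z + qd z (b i) = qd w (b i)) \<Longrightarrow>
      sum \<nu> S \<le> 2 * exp (- (\<epsilon> * (qd w q - 2)))"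
proof -
  have \<epsilon>: "0 < \<epsilon>" using visual_exponent(1)[OF \<delta>_nonneg] by (simp add: \<epsilon>_def)
  define K where "K = exp (\<epsilon> * (3 * \<delta> + 1))"
  have K: "1 \<le> K" "K\<^sup>2 \<le> 2"
    using \<epsilon> \<delta>_nonneg visual_exponent(2)[OF \<delta>_nonneg] by (auto simp: K_def \<epsilon>_def)
  define D where "D i j = exp (- (\<epsilon> * gromov_product w (b i) (b j)))" for i j
  have Dnn: "0 \<le> D i j" for i j by (simp add: D_def)
  have quasi: "D i k \<le> K * max (D i j) (D j k)" if "i \<le> N" "j \<le> N" "k \<le> N" for i j k
  proof -
    have "\<epsilon> * min (gromov_product w (b i) (b j)) (gromov_product w (b j) (b k)) \<le> \<epsilon> * (gromov_product w (b i) (b k) + (3 * \<delta> + 1))"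
      using gromov_product_quasi_ultrametric[OF b b b w, of i j k] that \<epsilon> by (intro mult_left_mono) auto
    then have "- (\<epsilon> * gromov_product w (b i) (b k))
        \<le> \<epsilon> * (3 * \<delta> + 1) + - (\<epsilon> * min (gromov_product w (b i) (b j)) (gromov_product w (b j) (b k)))"
      by (simp add: distrib_left)
    then have "D i k \<le> exp (\<epsilon> * (3 * \<delta> + 1) + - (\<epsilon> * min (gromov_product w (b i) (b j)) (gromov_product w (b j) (b k))))"
      unfolding D_def by simp
    also have "\<dots> = K * exp (- (\<epsilon> * min (gromov_product w (b i) (b j)) (gromov_product w (b j) (b k))))"
      unfolding K_def by (rule exp_add)
    also have "\<dots> \<le> K * max (D i j) (D j k)"
      using K(1) by (intro mult_left_mono) (auto simp: D_def min_def max_def)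
    finally show ?thesis .
  qed
  obtain \<nu> :: "nat \<Rightarrow> real" where \<nu>: "\<And>i. 0 \<le> \<nu> i" "D 0 N / 2 \<le> (\<Sum>i\<le>N. \<nu> i)"
    "\<And>S c. S \<subseteq> {..N} \<Longrightarrow> 0 \<le> c \<Longrightarrow> (\<And>i j. i \<in> S \<Longrightarrow> j \<in> S \<Longrightarrow> D i j \<le> c) \<Longrightarrow>
      (\<And>i. i \<in> S \<Longrightarrow> 0 < i \<Longrightarrow> D (i - 1) i \<le> c) \<Longrightarrow> sum \<nu> S \<le> 2 * c"
    using chain_weights_exist[of K D N, OF K Dnn quasi \<open>0 < N\<close>] by blast
  show thesis
  proof (rule that[OF \<nu>(1)])
    show "1 / 2 \<le> (\<Sum>i\<le>N. \<nu> i)" using \<nu>(2) between by (simp add: D_def)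
    fix S q
    assume S: "S \<subseteq> {..N}" and q: "q \<in> \<Omega>"
      and near: "\<And>i. i \<in> S \<Longrightarrow> \<exists>z\<in>\<Omega>. qd z q \<le> 1 \<and> qd w z + qd z (b i) = qd w (b i)"
    have D_le: "D i j \<le> exp (- (\<epsilon> * (qd w q - 2)))" if "qd w q - 2 \<le> gromov_product w (b i) (b j)" for i j
      unfolding D_def using mult_left_mono[OF that, of \<epsilon>] \<epsilon> by simp
    have dist_le: "qd q (b i) + qd w q \<le> qd w (b i) + 2" if i: "i \<in> S" for i
    proof -
      obtain z where z: "z \<in> \<Omega>" "qd z q \<le> 1" "qd w z + qd z (b i) = qd w (b i)" using near[OF i] by blast
      have "b i \<in> \<Omega>" using b S i by auto
      then show ?thesis
        using qh_dist_triangle[of q z "b i"] qh_dist_triangle[of w z q] z q w qh_dist_commute[of q z] by simp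
    qed
    show "sum \<nu> S \<le> 2 * exp (- (\<epsilon> * (qd w q - 2)))"
    proof (rule \<nu>(3)[OF S])
      fix i j assume ij: "i \<in> S" "j \<in> S"
      then have "qd (b i) (b j) \<le> qd q (b i) + qd q (b j)"
        using qh_dist_triangle[of "b i" q "b j"] b S q qh_dist_commute[of "b i" q] by auto
      then have "qd w q - 2 \<le> gromov_product w (b i) (b j)"
        using dist_le[OF ij(1)] dist_le[OF ij(2)] by (simp add: gromov_product_def)
      then show "D i j \<le> exp (- (\<epsilon> * (qd w q - 2)))" by (rule D_le)
    next
      fix i assume i: "i \<in> S" "0 < i"
      then have d: "b i \<in> \<Omega>" "b (i - 1) \<in> \<Omega>" "qd (b (i - 1)) (b i) \<le> 1"
        using b S step[of "i - 1"] by auto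
      then have "qd w (b i) - 1 \<le> gromov_product w (b (i - 1)) (b i)"
        using qh_dist_triangle[of w "b (i - 1)" "b i"] w by (simp add: gromov_product_def)
      moreover have "qd w q - 1 \<le> qd w (b i)"
      proof -
        obtain z where z: "z \<in> \<Omega>" "qd z q \<le> 1" "qd w z + qd z (b i) = qd w (b i)" using near[OF i(1)] by blast
        then show ?thesis using qh_dist_nonneg[OF z(1) d(1)] qh_dist_triangle[OF w z(1) q] by simp
      qed
      ultimately have "qd w q - 2 \<le> gromov_product w (b (i - 1)) (b i)" by simp
      then show "D (i - 1) i \<le> exp (- (\<epsilon> * (qd w q - 2)))" by (rule D_le)
    qed simp
  qed
qed

text \<open>
  The logarithm \<open>T\<close> to be bounded is, for every chain point, at most twice the sum of the relative
  sizes along the geodesic from \<open>w\<close>. The weighted average of these sums is estimated by splitting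
  each relative size at a threshold that decays geometrically with the number \<open>m\<close> of the mark. The
  part below the threshold is a geometric series. The part above it is controlled by powers of the
  relative sizes, whose sums over separated sets grow only linearly in \<open>T\<close>, while the decay of the shadow weights offsets
  that of the threshold; a large factor \<open>\<eta>\<close> in the threshold makes its coefficient small, so that
  it is absorbed by \<open>T\<close>.
\<close>

lemma log_distance_bounded:
  fixes b :: "nat \<Rightarrow> 'a"
  assumes w: "w \<in> \<Omega>" and b: "\<And>i. i \<le> N \<Longrightarrow> b i \<in> \<Omega>"
    and step: "\<And>i. i < N \<Longrightarrow> qd (b i) (b (Suc i)) \<le> 1"
    and between: "gromov_product w (b 0) (b N) = 0" and N: "0 < N"
    and r: "0 < r" and br: "\<And>i. i \<le> N \<Longrightarrow> dist (b i) x \<le> r"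
    and x: "bdist \<Omega> x \<le> 2 * r" and far: "r \<le> dist w x"
  shows "ln ((dist w x + r) / (2 * r)) \<le> log_bound \<delta> DIM('a)"
proof -
  define n where "n = DIM('a)"
  have n: "1 \<le> n" using DIM_positive[where 'a='a] by (simp add: n_def)
  define \<epsilon> where "\<epsilon> = visual_exponent \<delta>"
  have \<epsilon>: "0 < \<epsilon>" using visual_exponent(1)[OF \<delta>_nonneg] by (simp add: \<epsilon>_def)
  define B where "B = volume_const \<epsilon> n"
  have "1 \<le> (15::real) ^ Suc n" "1 \<le> (12::real) ^ n" by (intro one_le_power; simp)+
  then have "1 * 1 * 1 * 1 \<le> B"
    unfolding B_def volume_const_def using \<epsilon> by (intro mult_mono) (auto simp del: power_Suc)
  then have B: "1 \<le> B" by simp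
  define A where "A = 1 / (1 - exp (- (\<epsilon> / n)))"
  \<comment> \<open>With this choice \<open>B * L / \<eta> ^ n\<close> is at most \<open>L / 16\<close>, where \<open>L\<close> is at most \<open>2 * T + 2\<close>.\<close>
  define \<eta> where "\<eta> = 16 * B"
  have \<eta>: "1 \<le> \<eta>" using B by (simp add: \<eta>_def)
  define R where "R = dist w x"
  define T where "T = ln ((R + r) / (2 * r))"
  have T0: "0 \<le> T" unfolding T_def using r far by (intro ln_ge_zero) (simp add: R_def)
  let ?G = "relative_size x r"
  have G: "0 \<le> ?G p" "?G p \<le> 2" for p
    using relative_size_nonneg[of r x p] relative_size_le_2[OF x r] r by auto
  obtain \<nu> where \<nu>: "\<And>i. 0 \<le> \<nu> i" "1 / 2 \<le> (\<Sum>i\<le>N. \<nu> i)"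
    "\<And>S q. S \<subseteq> {..N} \<Longrightarrow> q \<in> \<Omega> \<Longrightarrow>
      (\<And>i. i \<in> S \<Longrightarrow> \<exists>z\<in>\<Omega>. qd z q \<le> 1 \<and> qd w z + qd z (b i) = qd w (b i)) \<Longrightarrow>
      sum \<nu> S \<le> 2 * exp (- (\<epsilon> * (qd w q - 2)))"
    using shadow_weights_exist[OF w b step between N] unfolding \<epsilon>_def by blast
  define s where "s = (\<Sum>i\<le>N. \<nu> i)"
  define l where "l i = nat \<lceil>qd w (b i)\<rceil>" for i
  have "\<exists>z::nat \<Rightarrow> 'a. i \<le> N \<longrightarrow> z 0 = w \<and> z (l i) = b i \<and>
      (\<forall>m. z m \<in> \<Omega> \<and> qd w (z m) = min (real m) (qd w (b i)) \<and>
        qd w (z m) + qd (z m) (b i) = qd w (b i) \<and> qd (z m) (z (Suc m)) \<le> 1)" for i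
    using geodesic_unit_steps[OF w b] unfolding l_def by blast
  then have "\<exists>z::nat \<Rightarrow> nat \<Rightarrow> 'a. \<forall>i. i \<le> N \<longrightarrow> z i 0 = w \<and> z i (l i) = b i \<and>
      (\<forall>m. z i m \<in> \<Omega> \<and> qd w (z i m) = min (real m) (qd w (b i)) \<and>
        qd w (z i m) + qd (z i m) (b i) = qd w (b i) \<and> qd (z i m) (z i (Suc m)) \<le> 1)"
    by (intro choice allI)
  then obtain z :: "nat \<Rightarrow> nat \<Rightarrow> 'a" where z: "\<And>i. i \<le> N \<Longrightarrow> z i 0 = w" "\<And>i. i \<le> N \<Longrightarrow> z i (l i) = b i"
    "\<And>i m. i \<le> N \<Longrightarrow> z i m \<in> \<Omega>" "\<And>i m. i \<le> N \<Longrightarrow> qd w (z i m) = min (real m) (qd w (b i))"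
    "\<And>i m. i \<le> N \<Longrightarrow> qd w (z i m) + qd (z i m) (b i) = qd w (b i)"
    "\<And>i m. i \<le> N \<Longrightarrow> qd (z i m) (z i (Suc m)) \<le> 1" by blast
  define I where "I i = {m. m \<le> l i \<and> dist (z i m) x < R}" for i
  have finI: "finite (I i)" for i by (rule finite_subset[of _ "{..l i}"]) (auto simp: I_def)
  define P where "P = Sigma {..N} I"
  have finP: "finite P" using finI by (simp add: P_def)
  have "s * T \<le> (\<Sum>i\<le>N. \<nu> i * (2 * (\<Sum>m\<in>I i. ?G (z i m))))"
    unfolding s_def sum_distrib_right
  proof (intro sum_mono mult_left_mono \<nu>(1))
    fix i assume "i \<in> {..N}"
    then show "T \<le> 2 * (\<Sum>m\<in>I i. ?G (z i m))"
      unfolding T_def R_def I_def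
      using z br far by (intro log_ratio_le_sum_relative_size[OF _ _ r]) auto
  qed
  also have "\<dots> = 2 * (\<Sum>(i,m)\<in>P. \<nu> i * ?G (z i m))"
    unfolding P_def using finI
    by (simp add: sum.Sigma[symmetric] sum_distrib_left mult_ac)
  also have "(\<Sum>(i,m)\<in>P. \<nu> i * ?G (z i m))
      \<le> (\<Sum>(i,m)\<in>P. \<nu> i * (\<eta> * exp (- (\<epsilon> / n * real m))) + \<nu> i * (?G (z i m) ^ Suc n * exp (\<epsilon> * real m)) / \<eta> ^ n)"
  proof (rule sum_mono, clarify)
    fix i m :: nat
    define \<mu> where "\<mu> = \<eta> * exp (- (\<epsilon> / n * real m))"
    have "\<mu> ^ n = \<eta> ^ n * exp (- (\<epsilon> / n * real m)) ^ n" by (simp add: \<mu>_def power_mult_distrib)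
    also have "exp (- (\<epsilon> / n * real m)) ^ n = exp (real n * (- (\<epsilon> / n * real m)))" by (rule exp_of_nat_mult[symmetric])
    also have "real n * (- (\<epsilon> / n * real m)) = - (\<epsilon> * real m)" using n by simp
    finally have \<mu>n: "\<mu> ^ n = \<eta> ^ n * exp (- (\<epsilon> * real m))" .
    have "?G (z i m) \<le> \<mu> + ?G (z i m) ^ Suc n / \<mu> ^ n"
      using G \<eta> by (intro Young_threshold) (auto simp: \<mu>_def)
    also have "?G (z i m) ^ Suc n / \<mu> ^ n = ?G (z i m) ^ Suc n * exp (\<epsilon> * real m) / \<eta> ^ n"
      unfolding \<mu>n by (simp add: exp_minus divide_inverse)
    finally have "\<nu> i * ?G (z i m) \<le> \<nu> i * (\<mu> + ?G (z i m) ^ Suc n * exp (\<epsilon> * real m) / \<eta> ^ n)"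
      using \<nu>(1) by (intro mult_left_mono)
    then show "\<nu> i * ?G (z i m) \<le> \<nu> i * (\<eta> * exp (- (\<epsilon> / n * real m)))
        + \<nu> i * (?G (z i m) ^ Suc n * exp (\<epsilon> * real m)) / \<eta> ^ n"
      by (simp add: \<mu>_def distrib_left)
  qed
  also have "\<dots> = (\<Sum>(i,m)\<in>P. \<nu> i * (\<eta> * exp (- (\<epsilon> / n * real m))))
      + (\<Sum>(i,m)\<in>P. \<nu> i * (?G (z i m) ^ Suc n * exp (\<epsilon> * real m))) / \<eta> ^ n"
    by (simp add: sum.distrib sum_divide_distrib split_def)
  finally have main: "s * T \<le> 2 * ((\<Sum>(i,m)\<in>P. \<nu> i * (\<eta> * exp (- (\<epsilon> / n * real m))))
      + (\<Sum>(i,m)\<in>P. \<nu> i * (?G (z i m) ^ Suc n * exp (\<epsilon> * real m))) / \<eta> ^ n)" by simp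
  have "(\<Sum>(i,m)\<in>P. \<nu> i * (\<eta> * exp (- (\<epsilon> / n * real m)))) = (\<Sum>i\<le>N. \<nu> i * (\<eta> * (\<Sum>m\<in>I i. exp (- (\<epsilon> / n * real m)))))"
    unfolding P_def using finI by (simp add: sum.Sigma[symmetric] sum_distrib_left)
  also have "\<dots> \<le> (\<Sum>i\<le>N. \<nu> i * (\<eta> * A))"
    unfolding A_def using \<eta> \<nu>(1) \<epsilon> n finI
    by (intro sum_mono mult_left_mono geometric_sum_le) auto
  also have "\<dots> = s * (\<eta> * A)" by (simp add: s_def sum_distrib_right)
  finally have first: "(\<Sum>(i,m)\<in>P. \<nu> i * (\<eta> * exp (- (\<epsilon> / n * real m)))) \<le> s * (\<eta> * A)" .

  \<comment> \<open>The number of dyadic shells about \<open>x\<close> up to the distance of \<open>w\<close>.\<close>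
  define L where "L = nat \<lceil>log 2 ((R + r) / r)\<rceil>"
  have "0 < R" using r far unfolding R_def by linarith
  then have Rr: "1 < (R + r) / r" using r by simp
  have L_ge: "log 2 ((R + r) / r) \<le> L" unfolding L_def by (rule real_nat_ceiling_ge)
  have "(R + r) / r = 2 powr log 2 ((R + r) / r)" using Rr by simp
  also have "\<dots> \<le> 2 powr L" using L_ge by (intro powr_mono) auto
  finally have L_pow: "R + r \<le> 2 ^ L * r" using r by (simp add: powr_realpow pos_divide_le_eq)
  have L_le: "L \<le> 2 * T + 2"
  proof -
    have "0 \<le> log 2 ((R + r) / r)" using Rr by simp
    then have "L \<le> log 2 ((R + r) / r) + 1" unfolding L_def by linarith
    also have "log 2 ((R + r) / r) = 1 + T / ln 2"
    proof -
      have "ln ((R + r) / r) = ln 2 + T"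
        unfolding T_def using r \<open>0 < R\<close> by (simp add: ln_div ln_mult)
      then show ?thesis by (simp add: log_def add_divide_distrib)
    qed
    also have "T / ln 2 \<le> T / (1 / 2)" using T0 ln2_ge_two_thirds by (intro divide_left_mono) auto
    finally show ?thesis by simp
  qed

  \<comment> \<open>Marks are grouped by a nearby point of a maximal separated set \<open>Z\<close> of marks.\<close>
  define Q where "Q = (\<lambda>(i,m). z i m) ` P"
  have Q: "finite Q" "Q \<subseteq> \<Omega>" "\<And>p. p \<in> Q \<Longrightarrow> dist p x < R"
    using finP z(3) by (auto simp: Q_def P_def I_def)
  obtain Z where Z: "Z \<subseteq> Q" "\<And>p q. p \<in> Z \<Longrightarrow> q \<in> Z \<Longrightarrow> p \<noteq> q \<Longrightarrow> 1 \<le> qd p q"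
    "\<And>p. p \<in> Q \<Longrightarrow> \<exists>q\<in>Z. qd p q < 1"
  proof -
    have "qd p p = 0" if "p \<in> Q" for p using that Q(2) by auto
    from maximal_separated_subset[OF Q(1), of qd, OF this qh_dist_commute]
    show thesis using that by blast
  qed
  have finZ: "finite Z" and Zdom: "Z \<subseteq> \<Omega>" using Z(1) Q finite_subset by auto
  obtain c where c: "\<And>p. p \<in> Q \<Longrightarrow> c p \<in> Z" "\<And>p. p \<in> Q \<Longrightarrow> qd p (c p) < 1" using Z(3) by metis
  let ?f = "\<lambda>(i,m). \<nu> i * (?G (z i m) ^ Suc n * exp (\<epsilon> * real m))"
  have fibre: "(\<Sum>a\<in>{a\<in>P. c (z (fst a) (snd a)) = q}. ?f a) \<le> 12 * 15 ^ Suc n * exp (4 * \<epsilon>) * ?G q ^ n"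
    if q: "q \<in> Z" for q
  proof -
    let ?F = "{a\<in>P. c (z (fst a) (snd a)) = q}"
    have q\<Omega>: "q \<in> \<Omega>" using q Zdom by blast
    define k where "k = qd w q"
    have k0: "0 \<le> k" unfolding k_def by (rule qh_dist_nonneg[OF w q\<Omega>])
    define C where "C = 2 * 15 ^ Suc n * ?G q ^ n * exp (\<epsilon> * (k + 2))"
    have C0: "0 \<le> C" using G by (simp add: C_def)
    \<comment> \<open>A mark near \<open>q\<close> has number in \<open>{j..<j + 3}\<close>, since its number is less than one above its
      distance from \<open>w\<close>.\<close>
    define j where "j = nat \<lfloor>k\<rfloor>"
    have F: "i \<le> N" "m \<in> {j..<j + 3}" "qd (z i m) q \<le> 1" "?G (z i m) ^ Suc n * exp (\<epsilon> * real m) \<le> C"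
      if "(i, m) \<in> ?F" for i m
    proof -
      have im: "i \<le> N" "m \<le> l i" "z i m \<in> Q" "c (z i m) = q"
        using that by (auto simp: P_def I_def Q_def)
      then show "i \<le> N" "qd (z i m) q \<le> 1" using c(2)[of "z i m"] by auto
      have near: "qd (z i m) q < 1" using c(2)[OF im(3)] im(4) by simp
      have "\<bar>qd w (z i m) - k\<bar> < 1"
        using qh_dist_triangle[OF w z(3)[OF im(1)] q\<Omega>, of m] qh_dist_triangle[OF w q\<Omega> z(3)[OF im(1)], of m]
          near qh_dist_commute[of q "z i m"] by (simp add: k_def)
      moreover have "real m < qd w (b i) + 1" using im(2) qh_dist_nonneg[OF w b[OF im(1)]] unfolding l_def by linarith
      ultimately have m: "k - 1 < m" "m < k + 2" using z(4)[OF im(1), of m] by linarith+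
      then show "m \<in> {j..<j + 3}" unfolding j_def using k0 by (simp; linarith)
      have "?G (z i m) \<le> 15 * ?G q"
        using near by (intro relative_size_Harnack[OF z(3)[OF im(1)] q\<Omega> _ x r]) simp
      then have "?G (z i m) ^ Suc n \<le> (15 * ?G q) ^ Suc n" using G by (intro power_mono)
      also have "\<dots> = 15 ^ Suc n * ?G q ^ n * ?G q" by (simp add: power_mult_distrib)
      also have "\<dots> \<le> 15 ^ Suc n * ?G q ^ n * 2" using G by (intro mult_left_mono) auto
      finally have "?G (z i m) ^ Suc n \<le> 2 * 15 ^ Suc n * ?G q ^ n" by simp
      moreover have "exp (\<epsilon> * real m) \<le> exp (\<epsilon> * (k + 2))" using m \<epsilon> by simp
      ultimately show "?G (z i m) ^ Suc n * exp (\<epsilon> * real m) \<le> C"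
        unfolding C_def using G by (intro mult_mono) auto
    qed
    define S where "S = fst ` ?F"
    have finF: "finite ?F" using finP by simp
    have S: "S \<subseteq> {..N}" using F(1) by (auto simp: S_def)
    have shadow: "sum \<nu> S \<le> 2 * exp (- (\<epsilon> * (k - 2)))"
      unfolding k_def
    proof (rule \<nu>(3)[OF S q\<Omega>])
      fix i assume "i \<in> S"
      then obtain m where im: "(i, m) \<in> ?F" by (auto simp: S_def)
      then show "\<exists>z\<in>\<Omega>. qd z q \<le> 1 \<and> qd w z + qd z (b i) = qd w (b i)"
        using F(1,3)[OF im] z(3,5) by blast
    qed
    have "(\<Sum>a\<in>?F. ?f a) \<le> (\<Sum>a\<in>?F. \<nu> (fst a) * C)"
      using F(4) \<nu>(1) by (intro sum_mono) (auto intro!: mult_left_mono)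
    also have "\<dots> \<le> (\<Sum>a\<in>S \<times> {j..<j + 3}. \<nu> (fst a) * C)"
    proof (rule sum_mono2)
      show "finite (S \<times> {j..<j + 3})" using finF by (simp add: S_def)
      show "?F \<subseteq> S \<times> {j..<j + 3}"
      proof
        fix a assume a: "a \<in> ?F"
        then show "a \<in> S \<times> {j..<j + 3}" using F(2)[of "fst a" "snd a"] by (simp add: S_def mem_Times_iff)
      qed
    qed (use \<nu>(1) C0 in auto)
    also have "\<dots> = 3 * C * sum \<nu> S"
      by (simp add: sum.cartesian_product' sum_distrib_left sum_distrib_right mult_ac)
    also have "\<dots> \<le> 3 * C * (2 * exp (- (\<epsilon> * (k - 2))))"
      using shadow C0 by (intro mult_left_mono) auto
    also have "3 * C * (2 * exp (- (\<epsilon> * (k - 2))))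
        = 12 * 15 ^ Suc n * ?G q ^ n * (exp (\<epsilon> * (k + 2)) * exp (- (\<epsilon> * (k - 2))))"
      by (simp add: C_def)
    also have "exp (\<epsilon> * (k + 2)) * exp (- (\<epsilon> * (k - 2))) = exp (4 * \<epsilon>)"
      by (simp add: exp_add[symmetric] algebra_simps)
    finally show ?thesis by (simp add: mult_ac)
  qed
  have "(\<Sum>a\<in>P. ?f a) = (\<Sum>q\<in>Z. \<Sum>a\<in>{a\<in>P. c (z (fst a) (snd a)) = q}. ?f a)"
  proof (rule sum.group[OF finP finZ, symmetric])
    have "z i m \<in> Q" if "(i, m) \<in> P" for i m using that by (force simp: Q_def)
    then show "(\<lambda>a. c (z (fst a) (snd a))) ` P \<subseteq> Z" using c(1) by auto
  qed
  also have "\<dots> \<le> (\<Sum>q\<in>Z. 12 * 15 ^ Suc n * exp (4 * \<epsilon>) * ?G q ^ n)" by (intro sum_mono fibre)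
  also have "\<dots> = 12 * 15 ^ Suc n * exp (4 * \<epsilon>) * (\<Sum>q\<in>Z. ?G q ^ n)" by (simp add: sum_distrib_left)
  also have "(\<Sum>q\<in>Z. ?G q ^ n) \<le> L * 12 ^ n"
    unfolding n_def
  proof (rule sum_relative_size_power_le[OF finZ Zdom Z(2) r x])
    fix q assume "q \<in> Z"
    then show "dist q x + r < 2 ^ L * r" using Z(1) Q(3)[of q] L_pow by auto
  qed
  finally have "(\<Sum>a\<in>P. ?f a) \<le> 12 * 15 ^ Suc n * exp (4 * \<epsilon>) * (L * 12 ^ n)" by simp
  also have "\<dots> = B * L" by (simp add: B_def volume_const_def)
  finally have "(\<Sum>a\<in>P. ?f a) / \<eta> ^ n \<le> (B * L) / \<eta> ^ n" using \<eta> by (intro divide_right_mono) auto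
  also have "\<dots> \<le> (B * L) / \<eta>"
    using \<eta> B n power_increasing[of 1 n \<eta>] by (intro divide_left_mono) auto
  also have "\<dots> = L / 16" using B by (simp add: \<eta>_def)
  also have "\<dots> \<le> s * (L / 8)"
    using mult_right_mono[of "1/2" s "L / 8"] \<nu>(2) by (simp add: s_def)
  finally have second: "(\<Sum>a\<in>P. ?f a) / \<eta> ^ n \<le> s * (L / 8)" .
  have "s * T \<le> s * (2 * (\<eta> * A) + L / 4)"
    using main first second by (simp add: algebra_simps)
  then have "T \<le> 2 * (\<eta> * A) + L / 4" using \<nu>(2) by (simp add: s_def)
  then have "T \<le> 4 * (\<eta> * A) + 1" using L_le by simp
  then show ?thesis
    unfolding T_def R_def log_bound_def Let_def \<eta>_def A_def B_def \<epsilon>_def n_def by (simp add: mult_ac)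
qed

text \<open>
  If \<open>x\<close> is far from the boundary relative to \<open>r\<close> the geodesic is short.
  If both \<open>bdist \<Omega> x \<le> 2 * r\<close> and \<open>r \<le> dist w x\<close> the logarithmic estimate applies to a chain on \<open>\<gamma>\<close>.
\<close>

lemma dist_geodesic_le:
  assumes \<Gamma>: "qh_geodesic \<Omega> x y \<Gamma>" and w: "w \<in> path_image \<Gamma>"
    and \<gamma>: "joins_in \<Omega> x y \<gamma>" "diameter (path_image \<gamma>) < r"
  shows "dist w x \<le> (6 + 2 * exp (log_bound \<delta> DIM('a))) * r"
proof -
  note jD = joins_inD[OF \<gamma>(1)]
  have w\<Omega>: "w \<in> \<Omega>" using qh_geodesic_in_dom[OF \<Gamma> w] .
  have bnd: "bounded (path_image \<gamma>)" using jD(1) by (rule bounded_path_image)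
  have near: "dist p x < r" if "p \<in> path_image \<gamma>" for p
  proof -
    have "x \<in> path_image \<gamma>" using jD(3) by (auto simp: path_image_def)
    then show ?thesis using diameter_bounded_bound[OF bnd that, of x] \<gamma>(2) by simp
  qed
  have r: "0 < r" using near[of x] jD(3) by (auto simp: path_image_def)
  consider "2 * r < bdist \<Omega> x" | "dist w x < r" | "bdist \<Omega> x \<le> 2 * r" "r \<le> dist w x" by linarith
  then show ?thesis
  proof cases
    case 1
    have "dist x y < r" using near[of y] jD(4) by (auto simp: path_image_def dist_commute)
    then have qxy: "qd x y \<le> 2 * dist x y / bdist \<Omega> x" using 1 jD by (intro qh_dist_le_dist(2)) auto
    have bx: "0 < bdist \<Omega> x" using 1 r by simp
    define t where "t = 2 * r / bdist \<Omega> x"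
    have t: "0 \<le> t" "t \<le> 1" using 1 r by (auto simp: t_def)
    have "rd x w \<le> qd x w" using jD w\<Omega> by (intro ratio_dist_le_qh_dist)
    also have "\<dots> \<le> qd x y"
      using qh_geodesic_add[OF \<Gamma> w] qh_dist_nonneg[OF w\<Omega> jD(7)] by simp
    also have "\<dots> \<le> t"
      using qxy \<open>dist x y < r\<close> bx unfolding t_def by (elim order_trans) (auto intro!: divide_right_mono)
    finally have "rd x w \<le> t" .
    have "dist x w \<le> bdist \<Omega> x * (exp (rd x w) - 1)" by (rule dist_le_ratio_dist(1)[OF jD(6) w\<Omega>])
    also have "\<dots> \<le> bdist \<Omega> x * (exp t - 1)" using \<open>rd x w \<le> t\<close> bx by (intro mult_left_mono) auto
    also have "exp t - 1 \<le> 3 * t"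
    proof -
      have "exp t \<le> 1 + t + t\<^sup>2" using exp_bound t by blast
      also have "t\<^sup>2 \<le> t" using t by (simp add: power2_eq_square mult_left_le)
      finally show ?thesis using t by simp
    qed
    finally have "dist x w \<le> bdist \<Omega> x * (3 * t)" using bx by simp
    also have "\<dots> = 6 * r" using bx by (simp add: t_def)
    finally show ?thesis using r by (simp add: dist_commute distrib_right add_increasing2)
  next
    case 2
    have "1 * r \<le> (6 + 2 * exp (log_bound \<delta> DIM('a))) * r" using r by (intro mult_right_mono) (auto intro: add_increasing2)
    then show ?thesis using 2 by simp
  next
    case 3
    obtain N where N: "0 < N" "\<And>i. i < N \<Longrightarrow> qd (\<gamma> (real i / real N)) (\<gamma> (real (Suc i) / real N)) \<le> 1"
      using qh_chain_on_path[OF jD(1,2)] by blast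
    have img: "\<gamma> (real i / real N) \<in> path_image \<gamma>" if "i \<le> N" for i
      using that N(1) by (auto simp: path_image_def)
    have "ln ((dist w x + r) / (2 * r)) \<le> log_bound \<delta> DIM('a)"
    proof (rule log_distance_bounded[where b = "\<lambda>i. \<gamma> (real i / real N)",
          OF w\<Omega> _ N(2) _ N(1) r _ 3])
      show "gromov_product w (\<gamma> (real 0 / real N)) (\<gamma> (real N / real N)) = 0"
        using gromov_product_on_geodesic[OF \<Gamma> w] N(1) jD(3,4) by simp
      show "\<gamma> (real i / real N) \<in> \<Omega>" if "i \<le> N" for i using img[OF that] jD(2) by blast
      show "dist (\<gamma> (real i / real N)) x \<le> r" if "i \<le> N" for i using near[OF img[OF that]] by simp
    qed
    moreover have "0 < (dist w x + r) / (2 * r)" using r by (simp add: add_nonneg_pos)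
    ultimately have "(dist w x + r) / (2 * r) \<le> exp (log_bound \<delta> DIM('a))"
      by (metis exp_le_cancel_iff exp_ln)
    then have "dist w x + r \<le> exp (log_bound \<delta> DIM('a)) * (2 * r)" using r by (simp add: pos_divide_le_eq)
    then show ?thesis using r by (simp add: algebra_simps)
  qed
qed

lemma diameter_geodesic_le:
  assumes \<Gamma>: "qh_geodesic \<Omega> x y \<Gamma>"
  shows "diameter (path_image \<Gamma>) \<le> 2 * (6 + 2 * exp (log_bound \<delta> DIM('a))) * intrinsic_diam_dist \<Omega> x y"
proof -
  define M where "M = 6 + 2 * exp (log_bound \<delta> DIM('a))"
  have M: "0 < M" unfolding M_def by (intro add_pos_pos) auto
  have le: "diameter (path_image \<Gamma>) / (2 * M) \<le> diameter (path_image \<gamma>)" if \<gamma>: "joins_in \<Omega> x y \<gamma>" for \<gamma>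
  proof (rule dense_ge)
    fix r assume r: "diameter (path_image \<gamma>) < r"
    have "dist w x \<le> M * r" if "w \<in> path_image \<Gamma>" for w
      using dist_geodesic_le[OF \<Gamma> that \<gamma> r] by (simp add: M_def)
    have "dist v w \<le> 2 * M * r" if "v \<in> path_image \<Gamma>" "w \<in> path_image \<Gamma>" for v w
    proof -
      have "dist v x \<le> M * r" "dist w x \<le> M * r"
        using that \<open>\<And>w. w \<in> path_image \<Gamma> \<Longrightarrow> dist w x \<le> M * r\<close> by auto
      then show ?thesis using dist_triangle2[of v w x] by simp
    qed
    moreover have "path_image \<Gamma> \<noteq> {}" by simp
    ultimately have "diameter (path_image \<Gamma>) \<le> 2 * M * r"
      by (intro diameter_le) (auto simp: dist_norm)
    then show "diameter (path_image \<Gamma>) / (2 * M) \<le> r" using M by (simp add: pos_divide_le_eq mult.commute)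
  qed
  have "diameter (path_image \<Gamma>) / (2 * M) \<le> intrinsic_diam_dist \<Omega> x y"
    unfolding intrinsic_diam_dist_def
  proof (rule cInf_greatest)
    show "{diameter (path_image g) |g. joins_in \<Omega> x y g} \<noteq> {}"
      using \<Gamma> by (auto simp: qh_geodesic_def)
  qed (use le in auto)
  then show ?thesis using M by (simp add: M_def pos_divide_le_eq mult.commute)
qed

end

theorem theorem5p6:
  fixes \<delta> :: real
  assumes "0 \<le> \<delta>"
  shows "\<exists>M::real. \<forall>\<Omega> :: (real ^ 'n) set. gromov_hyperbolic_domain \<delta> \<Omega> \<longrightarrow>
           (\<forall>x\<in>\<Omega>. \<forall>y\<in>\<Omega>. \<forall>\<Gamma>. qh_geodesic \<Omega> x y \<Gamma> \<longrightarrow>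
              diameter (path_image \<Gamma>) \<le> M * intrinsic_diam_dist \<Omega> x y)"
  using hyperbolic.diameter_geodesic_le[OF hyperbolic.intro[OF _ assms]] by blast

end
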